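(* Let $X$ be the randomly trapped random walk on $\mathbb Z$ with i.i.d. trapping landscape $\boldsymbol\pi=(\pi_z)_{z\in\mathbb Z}$ with marginal $P\in M_1(M_1((0,\infty)))$. For a probability measure $\nu$ on $(0,\infty)$ let $m(\nu)=\int x\,\nu(dx)$. Assume that $$M:=\int m(\pi)\,P(d\pi)\in(0,\infty).$$ Then $\mathbb P$-a.s., as $\varepsilon\to0$, the rescaled process $(\varepsilon X_{M\varepsilon^{-2}t})_{t\ge0}$ converges to a standard Brownian motion, in $P^{\boldsymbol\pi}$-distribution on the space $D(\mathbb R_+)$. (That is, the convergence in distribution holds for $\mathbb P$-almost every realization of the trapping landscape $\boldsymbol\pi$.)
   Context: **Randomly trapped random walk (RTRW) with i.i.d. trapping landscape.** $M_1(E)$ denotes the space of Borel probability measures on $E$ with the weak topology. Let $P\in M_1(M_1((0,\infty)))$ and let $\boldsymbol\pi=(\pi_z)_{z\in\mathbb Z}$ be an i.i.d. sequence of random probability measures on $(0,\infty)$ with marginal law $P$, defined on $(\Omega,\mathcal F,\mathbb P)$. Given $\boldsymbol\pi$, let $(s_z^i)_{z\in\mathbb Z,i\ge1}$ be independent random variables, $s_z^i$ having law $\pi_z$, and let $Y=(Y_n)_{n\ge0}$ be a simple symmetric random walk on $\mathbb Z$, $Y_0=0$, independent of everything else. Put $L(x,n)=\sum_{k=0}^n 1_{\{Y_k=x\}}$ and $S(n)=\sum_{k=0}^{n-1}s_{Y_k}^{L(Y_k,k)}$. The RTRW is $X_t=Y_n$ if $S(n)\le t<S(n+1)$. $P^{\boldsymbol\pi}$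 is the law of $X$ given $\boldsymbol\pi$ (quenched law). $D(\mathbb R_+)$ is the space of real cadlag functions with the Skorokhod $J_1$ topology. *)

theory Defs
  imports "HOL-Probability.Probability"
begin

section \<open>Spaces of probability measures and the weak topology\<close>

definition borel_of :: "'a topology \<Rightarrow> 'a measure" where
  "borel_of X = sigma (topspace X) {U. openin X U}"

lemma space_borel_of [simp]: "space (borel_of X) = topspace X"
  by (simp add: borel_of_def space_measure_of_conv)

definition prob_measures :: "'a topology \<Rightarrow> 'a measure set" where
  "prob_measures X = {\<nu>. prob_space \<nu> \<and> sets \<nu> = sets (borel_of X)}"

text \<open>The space \<open>M\<^sub>1(X)\<close>: the coarsest topology on the Borel probability measures making
  \<open>\<nu> \<mapsto> \<integral>f d\<nu>\<close> continuous for every bounded continuous \<open>f\<close>.  The construction can be iterated,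
  which is how \<open>M\<^sub>1(M\<^sub>1((0,\<infinity>)))\<close> is obtained, and convergence in distribution of
  \<open>X\<close>-valued random elements is convergence of their laws in \<open>weak_topology X\<close>.\<close>

definition weak_topology :: "'a topology \<Rightarrow> 'a measure topology" where
  "weak_topology X = topology_generated_by
     {{\<nu> \<in> prob_measures X. (\<integral>x. f x \<partial>\<nu>) \<in> U} |f U.
        continuous_map X euclideanreal f \<and> bounded (f ` topspace X) \<and> open U}"

lemma topspace_weak_topology [simp]: "topspace (weak_topology X) = prob_measures X"
proof -
  have "prob_measures X \<in> {{\<nu> \<in> prob_measures X. (\<integral>x. f x \<partial>\<nu>) \<in> U} |f U.
      continuous_map X euclideanreal f \<and> bounded (f ` topspace X) \<and> open U}"
    by (rule CollectI, intro exI[of _ "\<lambda>_. 0"] exI[of _ UNIV]) (auto simp: image_constant_conv)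
  then show ?thesis
    unfolding weak_topology_def topology_generated_by_topspace by blast
qed


section \<open>The space \<open>D(\<real>\<^sub>+)\<close> with the Skorokhod \<open>J\<^sub>1\<close> topology\<close>

text \<open>A path is a function on \<open>[0,\<infinity>)\<close>; its values at negative reals are fixed to \<open>undefined\<close>.\<close>

definition cadlag_paths :: "(real \<Rightarrow> real) set" where
  "cadlag_paths = {x \<in> extensional {0..}.
     (\<forall>t\<ge>0. continuous (at_right t) x) \<and> (\<forall>t>0. \<exists>l. (x \<longlongrightarrow> l) (at_left t))}"

text \<open>Increasing homeomorphisms of \<open>[0,\<infinity>)\<close> (continuity and \<open>l 0 = 0\<close> are automatic for
  a strictly increasing surjection).\<close>

definition time_changes :: "(real \<Rightarrow> real) set" where
  "time_changes = {l. strict_mono_on {0..} l \<and> l ` {0..} = {0..}}"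

definition J1_nbhd :: "(real \<Rightarrow> real) \<Rightarrow> real \<Rightarrow> real \<Rightarrow> (real \<Rightarrow> real) set" where
  "J1_nbhd x T d = {y \<in> cadlag_paths. \<exists>l\<in>time_changes.
     (\<forall>s\<ge>0. \<bar>l s - s\<bar> < d) \<and> (\<forall>s\<in>{0..T}. \<bar>y (l s) - x s\<bar> < d)}"

text \<open>The sets \<^term>\<open>J1_nbhd x T d\<close> form a neighbourhood base at \<open>x\<close> (\<open>limitin_skorokhod_J1\<close> below).
  Taking \<open>T = n\<close>, \<open>d = 1/n\<close>, the topology is first countable, hence determined by its convergent
  sequences; these are the ones of the \<open>J\<^sub>1\<close> topology (Jacod and Shiryaev, Limit Theorems for
  Stochastic Processes, Theorem VI.1.14), see \<open>limitin_skorokhod_J1_sequentially\<close>.\<close>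

definition skorokhod_J1 :: "(real \<Rightarrow> real) topology" where
  "skorokhod_J1 = topology (\<lambda>U. U \<subseteq> cadlag_paths \<and>
     (\<forall>x\<in>U. \<exists>T>0. \<exists>d>0. J1_nbhd x T d \<subseteq> U))"

lemma J1_nbhd_mono: "T' \<le> T \<Longrightarrow> d \<le> d' \<Longrightarrow> J1_nbhd x T d \<subseteq> J1_nbhd x T' d'"
  unfolding J1_nbhd_def by (auto; meson atLeastAtMost_iff less_le_trans order_trans)

lemma openin_skorokhod_J1:
  "openin skorokhod_J1 U \<longleftrightarrow> U \<subseteq> cadlag_paths \<and> (\<forall>x\<in>U. \<exists>T>0. \<exists>d>0. J1_nbhd x T d \<subseteq> U)"
proof -
  have "istopology (\<lambda>U. U \<subseteq> cadlag_paths \<and> (\<forall>x\<in>U. \<exists>T>0. \<exists>d>0. J1_nbhd x T d \<subseteq> U))"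
    unfolding istopology_def
  proof (intro conjI allI impI ballI)
    fix S U x
    assume S: "S \<subseteq> cadlag_paths \<and> (\<forall>x\<in>S. \<exists>T>0. \<exists>d>0. J1_nbhd x T d \<subseteq> S)"
      and U: "U \<subseteq> cadlag_paths \<and> (\<forall>x\<in>U. \<exists>T>0. \<exists>d>0. J1_nbhd x T d \<subseteq> U)"
      and x: "x \<in> S \<inter> U"
    obtain T d where 1: "T > 0" "d > 0" "J1_nbhd x T d \<subseteq> S" using S x by blast
    obtain T' d' where 2: "T' > 0" "d' > 0" "J1_nbhd x T' d' \<subseteq> U" using U x by blast
    have "J1_nbhd x (max T T') (min d d') \<subseteq> S \<inter> U"
      using J1_nbhd_mono[of T "max T T'" "min d d'" d x]
        J1_nbhd_mono[of T' "max T T'" "min d d'" d' x] 1 2 by auto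
    then show "\<exists>T>0. \<exists>d>0. J1_nbhd x T d \<subseteq> S \<inter> U"
      using 1 2 by (intro exI[of _ "max T T'"] exI[of _ "min d d'"] conjI) auto
  next
    fix \<K> x
    assume K: "\<forall>K\<in>\<K>. K \<subseteq> cadlag_paths \<and> (\<forall>x\<in>K. \<exists>T>0. \<exists>d>0. J1_nbhd x T d \<subseteq> K)"
      and "x \<in> \<Union>\<K>"
    then obtain K0 where "K0 \<in> \<K>" "x \<in> K0" by blast
    then obtain T d where "T > 0" "d > 0" "J1_nbhd x T d \<subseteq> K0" using K by meson
    then show "\<exists>T>0. \<exists>d>0. J1_nbhd x T d \<subseteq> \<Union>\<K>" using \<open>K0 \<in> \<K>\<close> by blast
  qed blast+
  then show ?thesis by (simp add: skorokhod_J1_def topology_inverse')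
qed

lemma topspace_skorokhod_J1 [simp]: "topspace skorokhod_J1 = cadlag_paths"
proof
  show "topspace skorokhod_J1 \<subseteq> cadlag_paths"
    using openin_topspace[of skorokhod_J1] unfolding openin_skorokhod_J1 by blast
  have "openin skorokhod_J1 cadlag_paths"
    unfolding openin_skorokhod_J1
    using J1_nbhd_def zero_less_one by blast
  then show "cadlag_paths \<subseteq> topspace skorokhod_J1" by (rule openin_subset)
qed

lemma J1_nbhd_trans:
  assumes y: "y \<in> J1_nbhd x T (d/2)" and T: "T \<ge> 0"
  shows "J1_nbhd y (T + d/2) (d/2) \<subseteq> J1_nbhd x T d"
proof
  fix z assume z: "z \<in> J1_nbhd y (T + d/2) (d/2)"
  obtain l where l: "l \<in> time_changes" "\<And>s. s \<ge> 0 \<Longrightarrow> \<bar>l s - s\<bar> < d/2"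
    "\<And>s. s \<in> {0..T} \<Longrightarrow> \<bar>y (l s) - x s\<bar> < d/2" using y by (auto simp: J1_nbhd_def)
  obtain m where m: "m \<in> time_changes" "\<And>s. s \<ge> 0 \<Longrightarrow> \<bar>m s - s\<bar> < d/2"
    "\<And>s. s \<in> {0..T + d/2} \<Longrightarrow> \<bar>z (m s) - y s\<bar> < d/2" using z by (auto simp: J1_nbhd_def)
  have l0: "l s \<ge> 0" if "s \<ge> 0" for s using l(1) that by (auto simp: time_changes_def)
  have "(m \<circ> l) ` {0..} = {0..}"
    using l(1) m(1) unfolding image_comp[symmetric] time_changes_def by simp
  then have "m \<circ> l \<in> time_changes"
    using l(1) m(1) l0 unfolding time_changes_def strict_mono_on_def by simp
  moreover have "\<bar>(m \<circ> l) s - s\<bar> < d" if "s \<ge> 0" for s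
    using l(2)[OF that] m(2)[OF l0[OF that]] unfolding o_def by linarith
  moreover have "\<bar>z ((m \<circ> l) s) - x s\<bar> < d" if "s \<in> {0..T}" for s
  proof -
    have s: "0 \<le> s" "s \<le> T" using that by auto
    have "l s \<in> {0..T + d/2}" using l(2)[OF s(1)] l0[OF s(1)] s unfolding atLeastAtMost_iff by linarith
    from m(3)[OF this] l(3)[OF that] show ?thesis unfolding o_def by linarith
  qed
  ultimately show "z \<in> J1_nbhd x T d" using z unfolding J1_nbhd_def by blast
qed

lemma J1_nbhd_refl: "x \<in> cadlag_paths \<Longrightarrow> d > 0 \<Longrightarrow> x \<in> J1_nbhd x T d"
  unfolding J1_nbhd_def
  by (intro CollectI conjI bexI[of _ "\<lambda>s. s"]) (simp_all add: time_changes_def strict_mono_on_def)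

lemma limitin_skorokhod_J1:
  "limitin skorokhod_J1 f x F \<longleftrightarrow>
     x \<in> cadlag_paths \<and> (\<forall>T>0. \<forall>d>0. \<forall>\<^sub>F i in F. f i \<in> J1_nbhd x T d)"
proof (intro iffI conjI allI impI)
  assume L: "limitin skorokhod_J1 f x F"
  then show x: "x \<in> cadlag_paths" by (auto simp: limitin_def)
  fix T d :: real assume Td: "T > 0" "d > 0"
  define U where "U = {y \<in> cadlag_paths. \<exists>T'>0. \<exists>d'>0. J1_nbhd y T' d' \<subseteq> J1_nbhd x T d}"
  have "openin skorokhod_J1 U"
    unfolding openin_skorokhod_J1
  proof (intro conjI ballI)
    fix y assume "y \<in> U"
    then obtain T' d' where y: "T' > 0" "d' > 0" "J1_nbhd y T' d' \<subseteq> J1_nbhd x T d"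
      by (auto simp: U_def)
    have "J1_nbhd y T' (d'/2) \<subseteq> U"
    proof
      fix z assume z: "z \<in> J1_nbhd y T' (d'/2)"
      have "J1_nbhd z (T' + d'/2) (d'/2) \<subseteq> J1_nbhd x T d"
        using J1_nbhd_trans[OF z] y by auto
      moreover have "T' + d'/2 > 0" "d'/2 > 0" using y by auto
      ultimately show "z \<in> U" using z unfolding U_def J1_nbhd_def[of y] by blast
    qed
    then show "\<exists>T>0. \<exists>d>0. J1_nbhd y T d \<subseteq> U" using y half_gt_zero by blast
  qed (auto simp: U_def)
  moreover have "x \<in> U" using x Td unfolding U_def by blast
  ultimately have "\<forall>\<^sub>F i in F. f i \<in> U" using L by (auto simp: limitin_def)
  then show "\<forall>\<^sub>F i in F. f i \<in> J1_nbhd x T d"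
    by eventually_elim (auto simp: U_def dest: J1_nbhd_refl)
next
  assume R: "x \<in> cadlag_paths \<and> (\<forall>T>0. \<forall>d>0. \<forall>\<^sub>F i in F. f i \<in> J1_nbhd x T d)"
  show "limitin skorokhod_J1 f x F"
    unfolding limitin_def topspace_skorokhod_J1
  proof (intro conjI allI impI)
    fix U assume "openin skorokhod_J1 U \<and> x \<in> U"
    then obtain T d where Td: "T > 0" "d > 0" "J1_nbhd x T d \<subseteq> U"
      unfolding openin_skorokhod_J1 by blast
    then have "\<forall>\<^sub>F i in F. f i \<in> J1_nbhd x T d" using R by blast
    then show "\<forall>\<^sub>F i in F. f i \<in> U" by eventually_elim (use Td in blast)
  qed (use R in blast)
qed

lemma limitin_skorokhod_J1_sequentially:
  "limitin skorokhod_J1 f x sequentially \<longleftrightarrow>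
     x \<in> cadlag_paths \<and> (\<forall>\<^sub>F n in sequentially. f n \<in> cadlag_paths) \<and>
     (\<exists>l. (\<forall>n. l n \<in> time_changes) \<and> uniform_limit {0..} l (\<lambda>s. s) sequentially \<and>
        (\<forall>T>0. uniform_limit {0..T} (\<lambda>n s. f n (l n s)) x sequentially))"
  (is "_ \<longleftrightarrow> ?R")
proof
  assume ?R
  then obtain l where l: "\<And>n. l n \<in> time_changes" "uniform_limit {0..} l (\<lambda>s. s) sequentially"
    "\<And>T. T > 0 \<Longrightarrow> uniform_limit {0..T} (\<lambda>n s. f n (l n s)) x sequentially" by blast
  have "\<forall>\<^sub>F n in sequentially. f n \<in> J1_nbhd x T d" if "T > 0" "d > 0" for T d
  proof -
    have "\<forall>\<^sub>F n in sequentially. f n \<in> cadlag_paths" using \<open>?R\<close> by blast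
    with uniform_limitD[OF l(2) \<open>d > 0\<close>] uniform_limitD[OF l(3)[OF \<open>T > 0\<close>] \<open>d > 0\<close>]
    show ?thesis
      by eventually_elim (use l(1) in \<open>auto simp: J1_nbhd_def dist_real_def\<close>)
  qed
  then show "limitin skorokhod_J1 f x sequentially"
    using \<open>?R\<close> unfolding limitin_skorokhod_J1 by blast
next
  assume L: "limitin skorokhod_J1 f x sequentially"
  define V where "V k = J1_nbhd x (real (Suc k)) (1 / real (Suc k))" for k
  have ev: "\<forall>\<^sub>F n in sequentially. f n \<in> V k" for k
    using L unfolding limitin_skorokhod_J1 V_def by simp
  define good where "good n k l \<longleftrightarrow> l \<in> time_changes \<and> (\<forall>s\<ge>0. \<bar>l s - s\<bar> < 1 / real (Suc k)) \<and>
      (\<forall>s\<in>{0..real (Suc k)}. \<bar>f n (l s) - x s\<bar> < 1 / real (Suc k))" for n k l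
  define K where "K n = {k. k \<le> n \<and> f n \<in> V k}" for n
  define l where "l n = (if K n = {} then (\<lambda>s. s) else SOME l. good n (Max (K n)) l)" for n
  have fin: "finite (K n)" for n by (auto simp: K_def)
  have lgood: "good n (Max (K n)) (l n)" if "K n \<noteq> {}" for n
  proof -
    have "f n \<in> V (Max (K n))" using Max_in[OF fin that] by (simp add: K_def)
    then have "\<exists>l. good n (Max (K n)) l" unfolding V_def J1_nbhd_def good_def by blast
    then show ?thesis using that by (simp add: l_def someI_ex)
  qed
  have lt: "l n \<in> time_changes" for n
    using lgood[of n] by (cases "K n = {}")
      (auto simp: l_def good_def time_changes_def strict_mono_on_def)
  have main: "\<forall>\<^sub>F n in sequentially. (\<forall>s\<ge>0. \<bar>l n s - s\<bar> < 1 / real (Suc k)) \<and>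
      (\<forall>s\<in>{0..real (Suc k)}. \<bar>f n (l n s) - x s\<bar> < 1 / real (Suc k))" for k
    using ev[of k] eventually_ge_at_top[of k]
  proof eventually_elim
    case (elim n)
    then have k: "k \<in> K n" by (simp add: K_def)
    then have le: "k \<le> Max (K n)" using fin by simp
    have g: "good n (Max (K n)) (l n)" using lgood k by blast
    have "1 / real (Suc (Max (K n))) \<le> 1 / real (Suc k)"
      using le by (simp add: field_simps)
    note d = less_le_trans[OF _ this]
    show ?case
    proof (intro conjI allI ballI impI)
      fix s :: real assume "s \<ge> 0"
      then show "\<bar>l n s - s\<bar> < 1 / real (Suc k)" using g d unfolding good_def by blast
    next
      fix s assume "s \<in> {0..real (Suc k)}"
      then have "s \<in> {0..real (Suc (Max (K n)))}" using le by auto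
      then show "\<bar>f n (l n s) - x s\<bar> < 1 / real (Suc k)" using g d unfolding good_def by blast
    qed
  qed
  have arch: "\<exists>k. T \<le> real (Suc k) \<and> 1 / real (Suc k) < d" if "d > 0" for T d :: real
  proof -
    obtain k where k: "max T (1/d) < real k" using reals_Archimedean2 by blast
    have "1 / d < real (Suc k)" using k by simp
    then have "1 / real (Suc k) < d" using that by (simp add: field_simps)
    then show ?thesis using k by (intro exI[of _ k]) auto
  qed
  have "uniform_limit {0..} l (\<lambda>s. s) sequentially"
  proof (rule uniform_limitI)
    fix d :: real assume "d > 0"
    then obtain k where "1 / real (Suc k) < d" using arch by blast
    with main[of k] show "\<forall>\<^sub>F n in sequentially. \<forall>s\<in>{0..}. dist (l n s) s < d"
      by (auto elim!: eventually_mono simp: dist_real_def intro: less_trans)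
  qed
  moreover have "uniform_limit {0..T} (\<lambda>n s. f n (l n s)) x sequentially" for T
  proof (rule uniform_limitI)
    fix d :: real assume "d > 0"
    then obtain k where k: "T \<le> real (Suc k)" "1 / real (Suc k) < d" using arch by blast
    from main[of k] show "\<forall>\<^sub>F n in sequentially. \<forall>s\<in>{0..T}. dist (f n (l n s)) (x s) < d"
    proof eventually_elim
      case (elim n)
      show ?case
      proof
        fix s assume "s \<in> {0..T}"
        then have "s \<in> {0..real (Suc k)}" using k by auto
        with elim have "\<bar>f n (l n s) - x s\<bar> < 1 / real (Suc k)" by blast
        then show "dist (f n (l n s)) (x s) < d" using k by (simp add: dist_real_def)
      qed
    qed
  qed
  moreover have "\<forall>\<^sub>F n in sequentially. f n \<in> cadlag_paths"
    using ev[of 0] by eventually_elim (auto simp: V_def J1_nbhd_def)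
  ultimately show ?R using lt L unfolding limitin_skorokhod_J1 by blast
qed


section \<open>Standard Brownian motion\<close>

definition standard_brownian_motion :: "'b measure \<Rightarrow> (real \<Rightarrow> 'b \<Rightarrow> real) \<Rightarrow> bool" where
  "standard_brownian_motion N B \<longleftrightarrow>
     prob_space N \<and>
     (\<forall>t\<ge>0. B t \<in> borel_measurable N) \<and>
     (\<forall>\<omega>\<in>space N. B 0 \<omega> = 0 \<and> continuous_on {0..} (\<lambda>t. B t \<omega>)) \<and>
     (\<forall>s t. 0 \<le> s \<and> s < t \<longrightarrow>
        distributed N lborel (\<lambda>\<omega>. B t \<omega> - B s \<omega>) (normal_density 0 (sqrt (t - s)))) \<and>
     (\<forall>n (t :: nat \<Rightarrow> real). 0 \<le> t 0 \<and> mono t \<longrightarrow>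
        prob_space.indep_vars N (\<lambda>_. borel) (\<lambda>k \<omega>. B (t (Suc k)) \<omega> - B (t k) \<omega>) {..<n})"


section \<open>Randomly trapped random walk\<close>

abbreviation trap_laws :: "real measure topology" where
  "trap_laws \<equiv> weak_topology (top_of_set {0<..})"

text \<open>The mean is allowed to be infinite.\<close>

definition trap_mean :: "real measure \<Rightarrow> ennreal" where
  "trap_mean \<nu> = (\<integral>\<^sup>+x. ennreal x \<partial>\<nu>)"

definition walk :: "(nat \<Rightarrow> int) \<Rightarrow> nat \<Rightarrow> int" where
  "walk \<xi> n = (\<Sum>k<n. \<xi> k)"

definition local_time :: "(nat \<Rightarrow> int) \<Rightarrow> int \<Rightarrow> nat \<Rightarrow> nat" where
  "local_time y x n = (\<Sum>k=0..n. if y k = x then 1 else 0)"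

definition clock :: "(nat \<Rightarrow> int) \<Rightarrow> (int \<times> nat \<Rightarrow> real) \<Rightarrow> nat \<Rightarrow> real" where
  "clock y s n = (\<Sum>k<n. s (y k, local_time y (y k) k))"

text \<open>If the clock stays bounded then the defining relation \<open>S(n) \<le> t < S(n+1)\<close> has no solution for
  large \<open>t\<close>.  This event is null under every quenched law; there the path is set to \<open>0\<close>, so that
  the trapped walk takes values in \<open>D(\<real>\<^sub>+)\<close> everywhere.\<close>

definition rtrw :: "(nat \<Rightarrow> int) \<Rightarrow> (int \<times> nat \<Rightarrow> real) \<Rightarrow> real \<Rightarrow> real" where
  "rtrw y s =
     (if \<forall>t\<ge>0. \<exists>n. clock y s n \<le> t \<and> t < clock y s (Suc n)
      then (\<lambda>t\<in>{0..}. real_of_int (y (THE n. clock y s n \<le> t \<and> t < clock y s (Suc n))))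
      else (\<lambda>t\<in>{0..}. 0))"

text \<open>For a given landscape, the probability space carrying the i.i.d. \<open>\<plusminus>1\<close> steps of the walk
  and, independently of them, the independent trapping times \<open>s\<^sub>z\<^sup>i\<close>, \<open>i \<ge> 1\<close>, with laws \<open>\<pi>\<^sub>z\<close>.\<close>

definition quenched_space ::
    "(int \<Rightarrow> real measure) \<Rightarrow> ((nat \<Rightarrow> int) \<times> (int \<times> nat \<Rightarrow> real)) measure" where
  "quenched_space p =
     (\<Pi>\<^sub>M k\<in>UNIV. measure_pmf (pmf_of_set {-1, 1})) \<Otimes>\<^sub>M (\<Pi>\<^sub>M (z, i)\<in>UNIV \<times> {1..}. p z)"

definition rescale :: "real \<Rightarrow> real \<Rightarrow> (real \<Rightarrow> real) \<Rightarrow> real \<Rightarrow> real" where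
  "rescale M \<epsilon> x = (\<lambda>t\<in>{0..}. \<epsilon> * x (M * t / \<epsilon>\<^sup>2))"

definition quenched_rescaled_law :: "(int \<Rightarrow> real measure) \<Rightarrow> real \<Rightarrow> real \<Rightarrow> (real \<Rightarrow> real) measure" where
  "quenched_rescaled_law p M \<epsilon> =
     distr (quenched_space p) (borel_of skorokhod_J1) (\<lambda>(\<xi>, s). rescale M \<epsilon> (rtrw (walk \<xi>) s))"

end

theory Submission
  imports Defs
begin

text \<open>
  The clock satisfies a quenched law of large numbers \<open>S(n)/n \<rightarrow> M\<close>.  Truncate the trapping times
  at \<open>K\<close>.  Given walk and landscape, the truncated clock has variance at most \<open>n K\<^sup>2\<close>; its conditional
  mean is a sum of i.i.d. centred bounded variables over the visited sites, whose second moment is of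
  order \<open>n\<^bsup>3/2\<^esup>\<close>, the number of self-intersections of the walk, so that the Borel-Cantelli argument works along
  \<open>n = j\<^sup>4\<close>.  The part above \<open>K\<close> has quenched mean \<open>\<Sum>\<^sub>x G\<^sub>n(x) e(x)\<close>; as the Green function \<open>G\<^sub>n\<close> is symmetric
  and unimodal, this is at most \<open>n\<close> times the largest average of \<open>e\<close> over symmetric intervals, which a maximal
  inequality shows to be small for suitable large \<open>K\<close>.  Hence \<open>X\<close> is a simple random walk run through an
  almost linear clock.

  Convergence in law is obtained without tightness arguments on \<open>D(\<real>\<^sub>+)\<close>.  The limit has continuous paths, at which
  a bounded \<open>J\<^sub>1\<close>-continuous \<open>f\<close> is the increasing limit of \<open>f\<^sub>k(x) = inf\<^sub>y (f(y) + k d\<^sub>k(x,y))\<close>, where \<open>d\<^sub>k\<close> is the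
  truncated uniform distance on \<open>[0,k]\<close>.  Up to the oscillation within blocks of steps, which a
  fourth-moment maximal inequality controls, \<open>f\<^sub>k\<close> of the rescaled walk is a continuous function of finitely many
  independent block increments, to which the central limit theorem applies.  This yields
  \<open>liminf E f(X) \<ge> E f(B)\<close>, and the same for \<open>-f\<close>.
\<close>

section \<open>Step functions in the Skorokhod space\<close>

text \<open>Only a first moment is available, so what exceeds the truncation level cannot be treated
  by variances, and under a fixed landscape its mean weights the sites by expected visits instead of
  uniformly. Parity keeps a single transition probability from decreasing in \<open>|x|\<close>; the
  sum over times does decrease, and is thus a positive combination of indicators of symmetric
  intervals. For the truncated means, self-intersections of order \<open>n^(3/2)\<close> against
  \<open>n^2\<close> leave \<open>n^(-1/2)\<close>, which is not summable over all \<open>n\<close>;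
  at \<open>n = j^4\<close> it is \<open>j^(-2)\<close>, while the ratio of consecutive fourth
  powers tends to 1, so that interpolation is free. Everything random about the landscape is
  condensed into the deterministic property \<open>homogenizes\<close>. It mentions neither a test
  function nor \<open>\<epsilon>\<close>, so one null set serves all of them. For a fixed landscape
  it is enough that the clock converges in probability: it is consulted at finitely many multiples
  of a block length only, and monotonicity controls it in between.\<close>

definition jump_path :: "(nat \<Rightarrow> real) \<Rightarrow> (nat \<Rightarrow> real) \<Rightarrow> real \<Rightarrow> real" where
  "jump_path y S = (\<lambda>t\<in>{0..}. y (THE n. S n \<le> t \<and> t < S (Suc n)))"

text \<open>Unboundedness is asked for natural \<open>m\<close> only, so that for a random clock it
  is a countable, hence measurable, condition.\<close>

definition jump_times :: "(nat \<Rightarrow> real) \<Rightarrow> bool" where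
  "jump_times S \<longleftrightarrow> S 0 = 0 \<and> strict_mono S \<and> (\<forall>m::nat. \<exists>n. real m < S n)"

lemma jump_times_nonneg: "jump_times S \<Longrightarrow> 0 \<le> S n"
  unfolding jump_times_def by (metis le0 strict_mono_less_eq)

lemma jump_times_less_Suc: "jump_times S \<Longrightarrow> S n < S (Suc n)"
  unfolding jump_times_def by (simp add: strict_monoD[of S n "Suc n"])

lemma jump_times_less_iff: "jump_times S \<Longrightarrow> S n < S k \<longleftrightarrow> n < k"
  unfolding jump_times_def by (simp add: strict_mono_less[of S])

lemma jump_times_le_iff: "jump_times S \<Longrightarrow> S n \<le> S k \<longleftrightarrow> n \<le> k"
  unfolding jump_times_def by (simp add: strict_mono_less_eq[of S])

lemma jump_times_exceeds: "jump_times S \<Longrightarrow> \<exists>n. t < S n"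
  unfolding jump_times_def using reals_Archimedean2[of t] less_trans by blast

lemma jump_times_index:
  assumes "jump_times S" "0 \<le> t"
  obtains n where "S n \<le> t" "t < S (Suc n)"
proof -
  define n where "n = (LEAST n. t < S n)"
  have n: "t < S n" unfolding n_def using jump_times_exceeds[OF assms(1)] by (rule LeastI_ex)
  then have "n \<noteq> 0" using assms by (cases "n = 0") (auto simp: jump_times_def)
  then obtain k where k: "n = Suc k" using not0_implies_Suc by blast
  have "\<not> t < S k" using not_less_Least[of k "\<lambda>n. t < S n"] k by (simp add: n_def)
  with n k that show ?thesis by force
qed

lemma strict_mono_index_unique:
  fixes S :: "nat \<Rightarrow> real"
  assumes "strict_mono S" "S n \<le> t" "t < S (Suc n)" "S k \<le> t" "t < S (Suc k)"
  shows "k = n"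
proof -
  have "S n < S (Suc k)" "S k < S (Suc n)"
    by (rule le_less_trans[OF assms(2) assms(5)], rule le_less_trans[OF assms(4) assms(3)])
  then have "n < Suc k" "k < Suc n"
    by (simp_all only: strict_mono_less[OF assms(1)])
  then show ?thesis by simp
qed

lemma jump_path_eq:
  assumes "jump_times S" "S n \<le> t" "t < S (Suc n)"
  shows "jump_path y S t = y n"
proof -
  have "(THE n. S n \<le> t \<and> t < S (Suc n)) = n"
  proof (rule the_equality)
    show "S n \<le> t \<and> t < S (Suc n)" using assms(2,3) by simp
    show "k = n" if "S k \<le> t \<and> t < S (Suc k)" for k
      using that assms strict_mono_index_unique[of S n t k] unfolding jump_times_def by blast
  qed
  moreover have "t \<ge> 0" using jump_times_nonneg[OF assms(1), of n] assms(2) by simp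
  ultimately show ?thesis by (simp add: jump_path_def)
qed

lemma jump_path_cadlag:
  assumes S: "jump_times S"
  shows "jump_path y S \<in> cadlag_paths"
  unfolding cadlag_paths_def
proof (intro CollectI conjI allI impI)
  show "jump_path y S \<in> extensional {0..}" by (simp add: jump_path_def)
  fix t :: real assume t: "0 \<le> t"
  obtain n where n: "S n \<le> t" "t < S (Suc n)" using jump_times_index[OF S t] by blast
  have "\<forall>\<^sub>F u in at_right t. jump_path y S u = y n"
    unfolding eventually_at_right[OF n(2)]
    using n by (intro exI[of _ "S (Suc n)"]) (auto intro!: jump_path_eq S)
  then have "(jump_path y S \<longlongrightarrow> y n) (at_right t)"
    by (rule tendsto_eventually)
  then show "continuous (at_right t) (jump_path y S)"
    unfolding continuous_within using jump_path_eq[OF S n, of y] by simp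
next
  fix t :: real assume t: "0 < t"
  obtain n where n: "S n \<le> t" "t < S (Suc n)" using jump_times_index[OF S, of t] t by auto
  show "\<exists>l. (jump_path y S \<longlongrightarrow> l) (at_left t)"
  proof (cases "S n < t")
    case True
    have "\<forall>\<^sub>F u in at_left t. jump_path y S u = y n"
      unfolding eventually_at_left[OF True]
      using n by (intro exI[of _ "S n"]) (auto intro!: jump_path_eq S simp: True)
    then show ?thesis using tendsto_eventually by blast
  next
    case False
    with n have nt: "S n = t" by simp
    with t S obtain k where k: "n = Suc k" by (cases n) (auto simp: jump_times_def)
    have kt: "S k < t" using jump_times_less_Suc[OF S, of k] k nt by simp
    have "\<forall>\<^sub>F u in at_left t. jump_path y S u = y k"
      unfolding eventually_at_left[OF kt]
      using kt nt k by (intro exI[of _ "S k"]) (auto intro!: jump_path_eq S)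
    then show ?thesis using tendsto_eventually by blast
  qed
qed

text \<open>The piecewise linear map that carries the knots \<open>S n\<close> to the knots
  \<open>R n\<close>. It serves as the time change that aligns the jumps of two step paths.\<close>

definition interp :: "(nat \<Rightarrow> real) \<Rightarrow> (nat \<Rightarrow> real) \<Rightarrow> real \<Rightarrow> real" where
  "interp S R t = (let n = (THE n. S n \<le> t \<and> t < S (Suc n))
     in R n + (t - S n) / (S (Suc n) - S n) * (R (Suc n) - R n))"

lemma interp_eq:
  assumes "jump_times S" "S n \<le> t" "t < S (Suc n)"
  shows "interp S R t = R n + (t - S n) / (S (Suc n) - S n) * (R (Suc n) - R n)"
proof -
  have "(THE n. S n \<le> t \<and> t < S (Suc n)) = n"
  proof (rule the_equality)
    show "S n \<le> t \<and> t < S (Suc n)" using assms(2,3) by simp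
    show "k = n" if "S k \<le> t \<and> t < S (Suc k)" for k
      using that assms strict_mono_index_unique[of S n t k] unfolding jump_times_def by blast
  qed
  then show ?thesis by (simp add: interp_def)
qed

lemma interp_bounds:
  assumes S: "jump_times S" and R: "jump_times R" and n: "S n \<le> t" "t < S (Suc n)"
  shows "R n \<le> interp S R t" "interp S R t < R (Suc n)"
proof -
  have d: "S n < S (Suc n)" "R n < R (Suc n)"
    by (rule jump_times_less_Suc[OF S], rule jump_times_less_Suc[OF R])
  define a where "a = (t - S n) / (S (Suc n) - S n)"
  have a: "0 \<le> a" "a < 1" using n d by (simp_all add: a_def divide_simps)
  have e: "interp S R t = R n + a * (R (Suc n) - R n)" unfolding a_def by (rule interp_eq[OF S n])
  show "R n \<le> interp S R t" using a d by (simp add: e)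
  have "a * (R (Suc n) - R n) < 1 * (R (Suc n) - R n)" using a d by (intro mult_strict_right_mono) auto
  then show "interp S R t < R (Suc n)" by (simp add: e)
qed

lemma interp_time_change:
  assumes S: "jump_times S" and R: "jump_times R"
  shows "interp S R \<in> time_changes"
  unfolding time_changes_def
proof (intro CollectI conjI)
  show "strict_mono_on {0..} (interp S R)"
  proof (rule strict_mono_onI)
    fix s t :: real assume st: "s \<in> {0..}" "t \<in> {0..}" "s < t"
    obtain n where n: "S n \<le> s" "s < S (Suc n)" using jump_times_index[OF S] st(1) unfolding atLeast_iff by blast
    obtain k where k: "S k \<le> t" "t < S (Suc k)" using jump_times_index[OF S] st(2) unfolding atLeast_iff by blast
    have "S n < S (Suc k)" using n k st(3) by linarith
    then have "n \<le> k" by (simp add: jump_times_less_iff[OF S] less_Suc_eq_le)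
    show "interp S R s < interp S R t"
    proof (cases "n = k")
      case True
      have d: "S k < S (Suc k)" "R k < R (Suc k)"
        by (rule jump_times_less_Suc[OF S], rule jump_times_less_Suc[OF R])
      have "(s - S k) / (S (Suc k) - S k) < (t - S k) / (S (Suc k) - S k)"
        using st d by (intro divide_strict_right_mono) simp_all
      then have "(s - S k) / (S (Suc k) - S k) * (R (Suc k) - R k)
          < (t - S k) / (S (Suc k) - S k) * (R (Suc k) - R k)"
        using d by (intro mult_strict_right_mono) simp_all
      then show ?thesis
        unfolding interp_eq[OF S n] interp_eq[OF S k] True by (rule add_strict_left_mono)
    next
      case False
      then have "R (Suc n) \<le> R k"
        using \<open>n \<le> k\<close> by (simp add: jump_times_le_iff[OF R])
      then show ?thesis
        using interp_bounds[OF S R n] interp_bounds[OF S R k] by linarith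
    qed
  qed
  show "interp S R ` {0..} = {0..}"
  proof
    show "interp S R ` {0..} \<subseteq> {0..}"
    proof
      fix u assume "u \<in> interp S R ` {0..}"
      then obtain t where t: "t \<ge> 0" "u = interp S R t" by auto
      obtain n where n: "S n \<le> t" "t < S (Suc n)" using jump_times_index[OF S t(1)] by blast
      show "u \<in> {0..}" using interp_bounds(1)[OF S R n] jump_times_nonneg[OF R, of n] unfolding t(2) by simp
    qed
    show "{0..} \<subseteq> interp S R ` {0..}"
    proof
      fix u :: real assume "u \<in> {0..}"
      then obtain n where n: "R n \<le> u" "u < R (Suc n)" using jump_times_index[OF R] unfolding atLeast_iff by blast
      have d: "S n < S (Suc n)" "R n < R (Suc n)"
        by (rule jump_times_less_Suc[OF S], rule jump_times_less_Suc[OF R])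
      \<comment> \<open>Interpolating in the opposite direction gives the inverse map.\<close>
      define t where "t = interp R S u"
      have t: "S n \<le> t" "t < S (Suc n)" using interp_bounds[OF R S n] unfolding t_def .
      have "t - S n = (u - R n) / (R (Suc n) - R n) * (S (Suc n) - S n)"
        unfolding t_def interp_eq[OF R n] by (rule add_diff_cancel_left')
      then have "(t - S n) / (S (Suc n) - S n) = (u - R n) / (R (Suc n) - R n)"
        using d by (simp only:) simp
      then have "interp S R t = u"
        unfolding interp_eq[OF S t] using d by simp
      moreover have "t \<in> {0..}" using t jump_times_nonneg[OF S, of n] by simp
      ultimately show "u \<in> interp S R ` {0..}" by (intro image_eqI[of _ _ t]) simp_all
    qed
  qed
qed

text \<open>Between two knots the displacement is a convex combination of the displacements at these
  knots.\<close>

lemma interp_close: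
  assumes S: "jump_times S" and R: "jump_times R" and t: "t \<ge> 0"
    and d: "\<And>n. \<bar>R n - S n\<bar> < d"
  shows "\<bar>interp S R t - t\<bar> < d"
proof -
  obtain n where n: "S n \<le> t" "t < S (Suc n)" using jump_times_index[OF S t] by auto
  have dS: "S n < S (Suc n)" by (rule jump_times_less_Suc[OF S])
  define a where "a = (t - S n) / (S (Suc n) - S n)"
  have a: "0 \<le> a" "a \<le> 1" using n dS by (simp_all add: a_def divide_simps)
  have "a * (S (Suc n) - S n) = t - S n" using dS by (simp add: a_def)
  then have ta: "t = (1 - a) * S n + a * S (Suc n)" by (simp add: algebra_simps)
  have e: "interp S R t - t = (1 - a) * (R n - S n) + a * (R (Suc n) - S (Suc n))"
    unfolding interp_eq[OF S n] a_def[symmetric] using ta by (simp add: algebra_simps)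
  have m: "\<bar>R n - S n\<bar> \<le> max \<bar>R n - S n\<bar> \<bar>R (Suc n) - S (Suc n)\<bar>" (is "_ \<le> ?m") by simp
  have "\<bar>interp S R t - t\<bar> \<le> (1 - a) * \<bar>R n - S n\<bar> + a * \<bar>R (Suc n) - S (Suc n)\<bar>"
    unfolding e by (rule order_trans[OF abs_triangle_ineq]) (use a in \<open>simp add: abs_mult\<close>)
  also have "\<dots> \<le> (1 - a) * ?m + a * ?m" using a by (intro add_mono mult_left_mono) auto
  also have "\<dots> = ?m" by (simp add: algebra_simps)
  also have "\<dots> < d" using d[of n] d[of "Suc n"] by simp
  finally show ?thesis .
qed

text \<open>Only finitely many jump times and heights matter up to time \<open>T\<close>. This gives
  continuity of \<open>jump_path\<close> for the product topology on sequences, from which its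
  measurability is derived.\<close>

lemma jump_path_J1_nbhd:
  assumes S: "jump_times S" and S': "jump_times S'" and T: "T < S n"
    and dS: "\<And>i. i \<le> n \<Longrightarrow> \<bar>S' i - S i\<bar> < d" and dy: "\<And>i. i \<le> n \<Longrightarrow> \<bar>y' i - y i\<bar> < d"
  shows "jump_path y' S' \<in> J1_nbhd (jump_path y S) T d"
proof -
  \<comment> \<open>The times after the \<open>n\<close>-th are irrelevant; moving them rigidly keeps the time change
      close to the identity on all of \<open>[0,\<infinity>)\<close>.\<close>
  define R where "R i = (if i \<le> n then S' i else S' n + S i - S n)" for i
  have sm: "S i < S (Suc i)" "S' i < S' (Suc i)" for i
    by (rule jump_times_less_Suc[OF S], rule jump_times_less_Suc[OF S'])
  have "R i < R (Suc i)" for i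
    using sm[of i] by (cases "i = n") (auto simp: R_def)
  then have "strict_mono R" by (rule strict_mono_Suc_iff[THEN iffD2, rule_format])
  moreover have "R 0 = 0" using S' by (simp add: R_def jump_times_def)
  moreover have "\<exists>i. real m < R i" for m :: nat
  proof -
    obtain i where i: "max (real m - S' n + S n) (S n) < S i" using jump_times_exceeds[OF S] by blast
    then have "n < i" by (simp add: jump_times_less_iff[OF S])
    then show ?thesis using i by (intro exI[of _ i]) (auto simp: R_def)
  qed
  ultimately have R: "jump_times R" by (simp add: jump_times_def)
  have RS: "\<bar>R i - S i\<bar> < d" for i
    using dS[of i] dS[of n] by (auto simp: R_def)
  have "\<bar>jump_path y' S' (interp S R s) - jump_path y S s\<bar> < d" if s: "s \<in> {0..T}" for s
  proof -
    obtain i where i: "S i \<le> s" "s < S (Suc i)" using jump_times_index[OF S, of s] s by auto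
    have "S i < S n" using i s T by simp
    then have "i < n" by (simp add: jump_times_less_iff[OF S])
    then have Ri: "R i = S' i" "R (Suc i) = S' (Suc i)" by (auto simp: R_def)
    have "jump_path y' S' (interp S R s) = y' i"
      using interp_bounds[OF S R i] Ri by (intro jump_path_eq S') auto
    then show ?thesis using jump_path_eq[OF S i, of y] dy[of i] \<open>i < n\<close> by simp
  qed
  then show ?thesis
    unfolding J1_nbhd_def using interp_time_change[OF S R] interp_close[OF S R _ RS] jump_path_cadlag[OF S']
    by blast
qed

section \<open>Measurability of random step paths\<close>

lemma borel_of_measurable:
  assumes "f \<in> space A \<rightarrow> topspace X" "\<And>U. openin X U \<Longrightarrow> f -` U \<inter> space A \<in> sets A"
  shows "f \<in> measurable A (borel_of X)"
  unfolding borel_of_def using assms by (intro measurable_measure_of) (auto dest: openin_subset)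

lemma sets_borel_of_open: "openin X U \<Longrightarrow> U \<in> sets (borel_of X)"
  unfolding borel_of_def by (auto simp: sets_measure_of dest: openin_subset)

lemma jump_path_measurable:
  fixes y S :: "'a \<Rightarrow> nat \<Rightarrow> real"
  assumes y[measurable]: "\<And>n. (\<lambda>q. y q n) \<in> borel_measurable A"
    and S[measurable]: "\<And>n. (\<lambda>q. S q n) \<in> borel_measurable A"
    and J: "\<And>q. q \<in> space A \<Longrightarrow> jump_times (S q)"
  shows "(\<lambda>q. jump_path (y q) (S q)) \<in> measurable A (borel_of skorokhod_J1)"
proof (rule borel_of_measurable)
  show "(\<lambda>q. jump_path (y q) (S q)) \<in> space A \<rightarrow> topspace skorokhod_J1"
    using J jump_path_cadlag by auto
  fix U assume U: "openin skorokhod_J1 U"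
  \<comment> \<open>The open sets of pairs of sequences that \<open>jump_path\<close> sends into
    \<open>U\<close>, tested only where the second entry is a genuine sequence of jump times. Their
    union is open, and its preimage is the event in question; no countable base of the Skorokhod
    topology enters.\<close>
  define V where "V = {V :: ((nat \<Rightarrow> real) \<times> (nat \<Rightarrow> real)) set. open V \<and>
      (\<forall>(a,b)\<in>V. jump_times b \<longrightarrow> jump_path a b \<in> U)}"
  have "open (\<Union>V)" unfolding V_def by blast
  have V: "\<exists>W\<in>V. (y q, S q) \<in> W" if q: "q \<in> space A" "jump_path (y q) (S q) \<in> U" for q
  proof -
    obtain T d where Td: "T > 0" "d > 0" "J1_nbhd (jump_path (y q) (S q)) T d \<subseteq> U"
      using U q(2) unfolding openin_skorokhod_J1 by blast
    obtain n where n: "T < S q n" using jump_times_exceeds[OF J[OF q(1)]] by blast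
    define W where "W = {x :: (nat \<Rightarrow> real) \<times> (nat \<Rightarrow> real).
        (\<forall>i\<in>{..n}. \<bar>snd x i - S q i\<bar> < d) \<and> (\<forall>i\<in>{..n}. \<bar>fst x i - y q i\<bar> < d)}"
    have c: "continuous_on UNIV (\<lambda>x :: (nat \<Rightarrow> real) \<times> (nat \<Rightarrow> real). snd x i)"
      "continuous_on UNIV (\<lambda>x :: (nat \<Rightarrow> real) \<times> (nat \<Rightarrow> real). fst x i)" for i
      by (rule continuous_on_product_then_coordinatewise[OF continuous_on_snd[OF continuous_on_id]],
          rule continuous_on_product_then_coordinatewise[OF continuous_on_fst[OF continuous_on_id]])
    have "W = (\<Inter>i\<in>{..n}. {x. \<bar>snd x i - S q i\<bar> < d} \<inter> {x. \<bar>fst x i - y q i\<bar> < d})"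
      unfolding W_def by blast
    also have "open \<dots>"
      by (intro open_INT ballI open_Int open_Collect_less continuous_intros c finite_atMost)
    finally have "open W" .
    moreover have "jump_path a b \<in> U" if "(a, b) \<in> W" "jump_times b" for a b
      using jump_path_J1_nbhd[OF J[OF q(1)] that(2) n, of d a "y q"] that(1) Td by (auto simp: W_def)
    ultimately have "W \<in> V" by (auto simp: V_def)
    moreover have "(y q, S q) \<in> W" using Td by (simp add: W_def)
    ultimately show ?thesis by blast
  qed
  have "(\<lambda>q. jump_path (y q) (S q)) -` U \<inter> space A = (\<lambda>q. (y q, S q)) -` (\<Union>V) \<inter> space A"
  proof (intro set_eqI iffI)
    fix q assume "q \<in> (\<lambda>q. (y q, S q)) -` (\<Union>V) \<inter> space A"
    then obtain W where "W \<in> V" "(y q, S q) \<in> W" "q \<in> space A" by blast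
    then show "q \<in> (\<lambda>q. jump_path (y q) (S q)) -` U \<inter> space A"
      using J[of q] unfolding V_def by auto
  qed (use V in auto)
  also have "\<dots> \<in> sets A"
  proof (rule measurable_sets[OF _ borel_open])
    have "y \<in> borel_measurable A" "S \<in> borel_measurable A"
      using measurable_coordinatewise_then_product[OF y] measurable_coordinatewise_then_product[OF S] .
    then show "(\<lambda>q. (y q, S q)) \<in> borel_measurable A"
      by (rule borel_measurable_Pair[of y A S])
  qed fact
  finally show "(\<lambda>q. jump_path (y q) (S q)) -` U \<inter> space A \<in> sets A" .
qed


section \<open>The rescaled trapped walk as a step path\<close>

lemma zero_path_cadlag: "(\<lambda>t\<in>{0..}. 0) \<in> cadlag_paths"
proof -
  have "jump_times real" unfolding jump_times_def strict_mono_def using reals_Archimedean2 by auto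
  from jump_path_cadlag[OF this, of "\<lambda>_. 0"] show ?thesis by (simp add: jump_path_def)
qed

text \<open>The test in \<open>rtrw\<close> quantifies over all real \<open>t\<close>; for a
  strictly increasing clock it reduces to a countable condition.\<close>

lemma jump_times_iff:
  fixes S :: "nat \<Rightarrow> real"
  assumes "S 0 = 0" "strict_mono S"
  shows "(\<forall>t\<ge>0. \<exists>n. S n \<le> t \<and> t < S (Suc n)) \<longleftrightarrow> jump_times S"
proof
  assume h: "\<forall>t\<ge>0. \<exists>n. S n \<le> t \<and> t < S (Suc n)"
  have "\<exists>n. real m < S n" for m :: nat using h[rule_format, of "real m"] by auto
  then show "jump_times S" using assms by (simp add: jump_times_def)
next
  assume "jump_times S"
  then show "\<forall>t\<ge>0. \<exists>n. S n \<le> t \<and> t < S (Suc n)" using jump_times_index by metis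
qed

lemma jump_times_scale:
  assumes "jump_times S" "0 < c"
  shows "jump_times (\<lambda>n. c * S n)"
proof -
  have "\<exists>n. real m < c * S n" for m :: nat
  proof -
    obtain n where "real m / c < S n" using jump_times_exceeds[OF assms(1)] by blast
    then show ?thesis using assms(2) by (intro exI[of _ n]) (simp add: divide_less_eq mult.commute)
  qed
  then show ?thesis using assms by (simp add: jump_times_def strict_mono_def)
qed

lemma rtrw_eq:
  assumes "jump_times (clock y s)" "clock y s n \<le> t" "t < clock y s (Suc n)"
  shows "rtrw y s t = real_of_int (y n)"
proof -
  have "\<forall>t\<ge>0. \<exists>n. clock y s n \<le> t \<and> t < clock y s (Suc n)"
    using jump_times_iff[of "clock y s"] assms(1) by (simp add: jump_times_def)
  then have "rtrw y s = jump_path (\<lambda>n. real_of_int (y n)) (clock y s)"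
    by (simp add: rtrw_def jump_path_def)
  then show ?thesis using jump_path_eq[OF assms] by simp
qed

lemma rescale_rtrw:
  assumes S: "jump_times (clock y s)" and "0 < M" "0 < \<epsilon>"
  shows "rescale M \<epsilon> (rtrw y s) = jump_path (\<lambda>n. \<epsilon> * y n) (\<lambda>n. \<epsilon>\<^sup>2 / M * clock y s n)"
proof
  fix t
  have c: "0 < \<epsilon>\<^sup>2 / M" using assms by simp
  have J: "jump_times (\<lambda>n. \<epsilon>\<^sup>2 / M * clock y s n)" using jump_times_scale[OF S c] .
  show "rescale M \<epsilon> (rtrw y s) t = jump_path (\<lambda>n. \<epsilon> * y n) (\<lambda>n. \<epsilon>\<^sup>2 / M * clock y s n) t"
  proof (cases "t \<ge> 0")
    case True
    then have "M * t / \<epsilon>\<^sup>2 \<ge> 0" using assms by simp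
    then obtain n where n: "clock y s n \<le> M * t / \<epsilon>\<^sup>2" "M * t / \<epsilon>\<^sup>2 < clock y s (Suc n)"
      using jump_times_index[OF S] by blast
    have "\<epsilon>\<^sup>2 / M * clock y s n \<le> \<epsilon>\<^sup>2 / M * (M * t / \<epsilon>\<^sup>2)" using n c by (intro mult_left_mono) auto
    moreover have "\<epsilon>\<^sup>2 / M * (M * t / \<epsilon>\<^sup>2) < \<epsilon>\<^sup>2 / M * clock y s (Suc n)"
      using n c by (intro mult_strict_left_mono) auto
    moreover have "\<epsilon>\<^sup>2 / M * (M * t / \<epsilon>\<^sup>2) = t" using assms by simp
    ultimately show ?thesis
      using jump_path_eq[OF J, of n t] rtrw_eq[OF S n] True by (simp add: rescale_def)
  qed (simp add: rescale_def jump_path_def)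
qed

lemma rescale_rtrw_degenerate:
  assumes "clock y s 0 = 0" "strict_mono (clock y s)" "\<not> jump_times (clock y s)" "0 < M"
  shows "rescale M \<epsilon> (rtrw y s) = (\<lambda>t\<in>{0..}. 0)"
proof -
  have "rtrw y s = (\<lambda>t\<in>{0..}. 0)"
    unfolding rtrw_def jump_times_iff[OF assms(1,2)] using assms(3) by simp
  then show ?thesis using assms(4) by (auto simp: rescale_def restrict_def fun_eq_iff)
qed

text \<open>Because of the default path in \<open>rtrw\<close> the map is pieced together from a
  step path and the zero path, on an event and its complement.\<close>

lemma rescale_rtrw_measurable:
  fixes y :: "'a \<Rightarrow> nat \<Rightarrow> int" and s :: "'a \<Rightarrow> int \<times> nat \<Rightarrow> real"
  assumes y[measurable]: "\<And>n. (\<lambda>q. y q n) \<in> measurable A (count_space UNIV)"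
    and c[measurable]: "\<And>n. (\<lambda>q. clock (y q) (s q) n) \<in> borel_measurable A"
    and S: "\<And>q. q \<in> space A \<Longrightarrow> strict_mono (clock (y q) (s q))"
    and M: "0 < M" "0 < \<epsilon>"
  shows "(\<lambda>q. rescale M \<epsilon> (rtrw (y q) (s q))) \<in> measurable A (borel_of skorokhod_J1)"
proof -
  let ?J = "\<lambda>q. \<forall>m::nat. \<exists>n. real m < clock (y q) (s q) n"
  have J: "jump_times (clock (y q) (s q)) \<longleftrightarrow> ?J q" if "q \<in> space A" for q
    using S[OF that] by (simp add: jump_times_def clock_def)
  define f where "f q = jump_path (\<lambda>n. \<epsilon> * y q n) (\<lambda>n. \<epsilon>\<^sup>2 / M * clock (y q) (s q) n)" for q
  have e: "rescale M \<epsilon> (rtrw (y q) (s q)) = (if ?J q then f q else (\<lambda>t\<in>{0..}. 0))" if "q \<in> space A" for q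
    using rescale_rtrw[of "y q" "s q" M \<epsilon>] rescale_rtrw_degenerate[of "y q" "s q" M \<epsilon>] M J[OF that] S[OF that]
    by (simp add: f_def clock_def)
  have Jm: "{q \<in> space A. ?J q} \<in> sets A" by measurable
  have "f \<in> measurable (restrict_space A {q. ?J q}) (borel_of skorokhod_J1)"
    unfolding f_def
  proof (rule jump_path_measurable)
    show "jump_times (\<lambda>n. \<epsilon>\<^sup>2 / M * clock (y q) (s q) n)" if "q \<in> space (restrict_space A {q. ?J q})" for q
      using that J[of q] M by (intro jump_times_scale) (auto simp: space_restrict_space)
  qed (intro measurable_restrict_space1; measurable)+
  moreover have "(\<lambda>q. \<lambda>t\<in>{0..}. 0) \<in> measurable (restrict_space A {q. \<not> ?J q}) (borel_of skorokhod_J1)"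
    by (rule measurable_const) (simp add: zero_path_cadlag)
  ultimately have "(\<lambda>q. if ?J q then f q else (\<lambda>t\<in>{0..}. 0)) \<in> measurable A (borel_of skorokhod_J1)"
    by (intro measurable_If_restrict_space_iff[THEN iffD2, OF Jm] conjI)
  then show ?thesis using e by (simp cong: measurable_cong)
qed

section \<open>Lipschitz envelopes\<close>

text \<open>Truncation at 1 keeps the supremum finite for arbitrary functions, so that no path
  regularity is required.\<close>

definition sup_dist :: "nat \<Rightarrow> (real \<Rightarrow> real) \<Rightarrow> (real \<Rightarrow> real) \<Rightarrow> real" where
  "sup_dist k x y = (SUP t\<in>{0..real k}. min 1 \<bar>x t - y t\<bar>)"

lemma sup_dist_bdd:
  fixes x y :: "real \<Rightarrow> real"
  shows "bdd_above ((\<lambda>t. min 1 \<bar>x t - y t\<bar>) ` {0..real k})"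
  by (intro bdd_aboveI2[of _ _ 1] min.cobounded1)

lemma sup_dist_le:
  assumes "\<And>t. 0 \<le> t \<Longrightarrow> t \<le> real k \<Longrightarrow> min 1 \<bar>x t - y t\<bar> \<le> e"
  shows "sup_dist k x y \<le> e"
  unfolding sup_dist_def using assms by (intro cSUP_least) auto

lemma sup_dist_upper:
  assumes "0 \<le> t" "t \<le> real k"
  shows "min 1 \<bar>x t - y t\<bar> \<le> sup_dist k x y"
  unfolding sup_dist_def using assms by (intro cSUP_upper sup_dist_bdd) auto

lemma sup_dist_nonneg: "0 \<le> sup_dist k x y"
  using sup_dist_upper[of 0 k x y] by linarith

lemma sup_dist_le_1: "sup_dist k x y \<le> 1"
  by (rule sup_dist_le) simp

lemma sup_dist_refl: "sup_dist k x x = 0"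
  using sup_dist_le[of k x x 0] sup_dist_nonneg[of k x x] by simp

lemma sup_dist_commute: "sup_dist k x y = sup_dist k y x"
  unfolding sup_dist_def by (simp add: abs_minus_commute)

lemma sup_dist_triangle: "sup_dist k x z \<le> sup_dist k x y + sup_dist k y z"
proof (rule sup_dist_le)
  fix t assume t: "0 \<le> t" "t \<le> real k"
  show "min 1 \<bar>x t - z t\<bar> \<le> sup_dist k x y + sup_dist k y z"
    using sup_dist_upper[OF t, of x y] sup_dist_upper[OF t, of y z] by linarith
qed

text \<open>The Pasch-Hausdorff envelope (infimal convolution) of \<open>f\<close>. The index
  \<open>k\<close> is at once the Lipschitz constant and the time horizon.\<close>

definition lip_env :: "((real \<Rightarrow> real) \<Rightarrow> real) \<Rightarrow> nat \<Rightarrow> (real \<Rightarrow> real) \<Rightarrow> real" where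
  "lip_env f k x = (INF y\<in>cadlag_paths. f y + real k * sup_dist k x y)"

lemma cadlag_paths_continuous:
  assumes "continuous_on {0..} x"
  shows "(\<lambda>t\<in>{0..}. x t) \<in> cadlag_paths"
  unfolding cadlag_paths_def
proof (intro CollectI conjI allI impI)
  have R: "continuous_on {0..} (\<lambda>t\<in>{0..}. x t)"
    using assms by (rule continuous_on_eq) simp
  then have C: "((\<lambda>t\<in>{0..}. x t) \<longlongrightarrow> (\<lambda>t\<in>{0..}. x t) t) (at t within {0..})" if "t \<ge> 0" for t :: real
    using that unfolding continuous_on_def by blast
  show "continuous (at_right t) (\<lambda>t\<in>{0..}. x t)" if "t \<ge> 0" for t :: real
    unfolding continuous_within by (rule tendsto_within_subset[OF C[OF that]]) (use that in auto)
  show "\<exists>l. ((\<lambda>t\<in>{0..}. x t) \<longlongrightarrow> l) (at_left t)" if "t > 0" for t :: real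
  proof -
    have "((\<lambda>t\<in>{0..}. x t) \<longlongrightarrow> (\<lambda>t\<in>{0..}. x t) t) (at t within {0..t})"
      by (rule tendsto_within_subset[OF C]) (use that in auto)
    moreover have "at t within {0..t} = at_left t"
      using that by (rule at_within_Icc_at_left)
    ultimately show ?thesis by auto
  qed
qed simp

locale bounded_path_functional =
  fixes f :: "(real \<Rightarrow> real) \<Rightarrow> real" and C :: real
  assumes bound: "x \<in> cadlag_paths \<Longrightarrow> \<bar>f x\<bar> \<le> C"
begin

lemma cadlag_nonempty: "cadlag_paths \<noteq> {}"
  using cadlag_paths_continuous[of "\<lambda>_. 0"] by auto

lemma env_bdd: "bdd_below ((\<lambda>y. f y + real k * sup_dist k x y) ` cadlag_paths)"
proof (rule bdd_belowI2)
  fix y assume "y \<in> cadlag_paths"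
  then have "- C \<le> f y" using bound[of y] by linarith
  moreover have "0 \<le> real k * sup_dist k x y" using sup_dist_nonneg by simp
  ultimately show "- C \<le> f y + real k * sup_dist k x y" by linarith
qed

lemma env_le: "x \<in> cadlag_paths \<Longrightarrow> lip_env f k x \<le> f x"
  unfolding lip_env_def by (rule cINF_lower2[OF env_bdd]) (auto simp: sup_dist_refl)

lemma env_ge: "- C \<le> lip_env f k x"
  unfolding lip_env_def
proof (rule cINF_greatest[OF cadlag_nonempty])
  fix y assume "y \<in> cadlag_paths"
  then have "- C \<le> f y" using bound[of y] by linarith
  moreover have "0 \<le> real k * sup_dist k x y" using sup_dist_nonneg by simp
  ultimately show "- C \<le> f y + real k * sup_dist k x y" by linarith
qed

lemma env_lipschitz: "lip_env f k x \<le> lip_env f k x' + real k * sup_dist k x x'"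
proof -
  have "lip_env f k x - real k * sup_dist k x x' \<le> lip_env f k x'"
    unfolding lip_env_def[of f k x']
  proof (rule cINF_greatest[OF cadlag_nonempty])
    fix y assume y: "y \<in> cadlag_paths"
    have "lip_env f k x \<le> f y + real k * sup_dist k x y"
      unfolding lip_env_def using y by (rule cINF_lower[OF env_bdd])
    also have "real k * sup_dist k x y \<le> real k * (sup_dist k x x' + sup_dist k x' y)"
      by (intro mult_left_mono sup_dist_triangle) simp
    finally show "lip_env f k x - real k * sup_dist k x x' \<le> f y + real k * sup_dist k x' y"
      by (simp add: algebra_simps)
  qed
  then show ?thesis by simp
qed

lemma env_lipschitz_abs: "\<bar>lip_env f k x - lip_env f k x'\<bar> \<le> real k * sup_dist k x x'"
  using env_lipschitz[of k x x'] env_lipschitz[of k x' x] by (simp add: sup_dist_commute[of k x' x])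

text \<open>Holds at every function \<open>x\<close>. Step paths, which take real values at negative
  times too, need not belong to \<open>cadlag_paths\<close>, so \<open>env_le\<close> cannot be used
  for them.\<close>

lemma env_abs_le: "\<bar>lip_env f k x\<bar> \<le> C + real k"
proof -
  obtain z where z: "z \<in> cadlag_paths" using cadlag_nonempty by blast
  have "lip_env f k x \<le> f z + real k * sup_dist k x z"
    unfolding lip_env_def using z by (rule cINF_lower[OF env_bdd])
  moreover have "real k * sup_dist k x z \<le> real k * 1"
    by (intro mult_left_mono sup_dist_le_1) simp
  ultimately show ?thesis using env_ge[of k x] bound[OF z] by linarith
qed

text \<open>The second hypothesis is lower semicontinuity at \<open>x\<close>. A competitor
  \<open>y\<close> uniformly close to \<open>x\<close> lies in the Skorokhod neighbourhood through
  the identity time change; one that is not close pays a penalty exceeding the oscillation of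
  \<open>f\<close>.\<close>

lemma env_tendsto:
  assumes x: "x \<in> cadlag_paths"
    and lsc: "\<And>\<eta>. 0 < \<eta> \<Longrightarrow> \<exists>T>0. \<exists>d>0. \<forall>y\<in>J1_nbhd x T d. f x - \<eta> < f y"
  shows "(\<lambda>k. lip_env f k x) \<longlonglongrightarrow> f x"
proof (rule LIMSEQ_I)
  fix r :: real assume r: "0 < r"
  obtain T d where Td: "T > 0" "d > 0" "\<And>y. y \<in> J1_nbhd x T d \<Longrightarrow> f x - r/2 < f y"
    using lsc[of "r/2"] r by auto
  \<comment> \<open>The cap at 1 allows the truncation in \<open>sup_dist\<close> to be undone below
    \<open>\<delta>\<close>.\<close>
  define \<delta> where "\<delta> = min d 1"
  have \<delta>: "0 < \<delta>" "\<delta> \<le> d" "\<delta> \<le> 1" using Td by (auto simp: \<delta>_def)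
  \<comment> \<open>From \<open>k0\<close> on the horizon covers \<open>T\<close> and the penalty
    \<open>k * \<delta>\<close> is at least \<open>2 * C\<close>.\<close>
  obtain k0 :: nat where k0: "max T (2 * C / \<delta>) < real k0" using reals_Archimedean2 by blast
  have "norm (lip_env f k x - f x) < r" if k: "k \<ge> k0" for k
  proof -
    have kT: "T \<le> real k" "2 * C / \<delta> \<le> real k" using k0 k by (auto intro: order_trans less_imp_le)
    have "f x - r/2 \<le> lip_env f k x"
      unfolding lip_env_def
    proof (rule cINF_greatest[OF cadlag_nonempty])
      fix y assume y: "y \<in> cadlag_paths"
      show "f x - r/2 \<le> f y + real k * sup_dist k x y"
      proof (cases "sup_dist k x y < \<delta>")
        case True
        have "\<bar>y s - x s\<bar> < d" if "s \<in> {0..T}" for s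
        proof -
          have "min 1 \<bar>x s - y s\<bar> < \<delta>"
            using sup_dist_upper[of s k x y] True that kT by auto
          then show ?thesis using \<delta> by linarith
        qed
        then have "y \<in> J1_nbhd x T d"
          unfolding J1_nbhd_def using y Td(2)
          by (intro CollectI conjI bexI[of _ "\<lambda>s. s"]) (auto simp: time_changes_def strict_mono_on_def)
        moreover have "0 \<le> real k * sup_dist k x y" using sup_dist_nonneg by simp
        ultimately show ?thesis using Td(3)[of y] by linarith
      next
        case False
        have "2 * C \<le> real k * \<delta>" using kT(2) \<delta>(1) by (simp add: divide_le_eq)
        also have "\<dots> \<le> real k * sup_dist k x y" using False by (intro mult_left_mono) auto
        finally show ?thesis using bound[OF x] bound[OF y] r by linarith
      qed
    qed
    then show ?thesis using env_le[OF x, of k] r by simp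
  qed
  then show "\<exists>no. \<forall>k\<ge>no. norm (lip_env f k x - f x) < r" by blast
qed

end

section \<open>Discretisation on a time grid\<close>

definition step_path :: "nat \<Rightarrow> (nat \<Rightarrow> real) \<Rightarrow> real \<Rightarrow> real" where
  "step_path m v t = v (nat \<lfloor>t * real m\<rfloor>)"

lemma step_index_le:
  assumes "0 \<le> t" "t \<le> real k"
  shows "nat \<lfloor>t * real m\<rfloor> \<le> k * m"
proof -
  have "t * real m \<le> real k * real m" using assms by (intro mult_right_mono) auto
  then have "\<lfloor>t * real m\<rfloor> \<le> \<lfloor>real (k * m)\<rfloor>" by (intro floor_mono) simp
  then have "\<lfloor>t * real m\<rfloor> \<le> int (k * m)" by (simp only: floor_of_nat)
  then show ?thesis by (simp only: nat_le_iff)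
qed

lemma step_path_tendsto:
  assumes "\<And>i. i \<le> k * m \<Longrightarrow> (\<lambda>n. v n i) \<longlonglongrightarrow> w i"
  shows "(\<lambda>n. sup_dist k (step_path m (v n)) (step_path m w)) \<longlonglongrightarrow> 0"
proof (rule LIMSEQ_I)
  fix r :: real assume r: "0 < r"
  have "\<forall>\<^sub>F n in sequentially. \<forall>i\<in>{..k*m}. dist (v n i) (w i) < r / 2"
    using assms r by (intro eventually_ball_finite ballI tendstoD) auto
  then obtain N where N: "\<And>n i. n \<ge> N \<Longrightarrow> i \<le> k * m \<Longrightarrow> \<bar>v n i - w i\<bar> < r / 2"
    unfolding eventually_sequentially dist_real_def by auto
  have "norm (sup_dist k (step_path m (v n)) (step_path m w) - 0) < r" if "n \<ge> N" for n
  proof -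
    have "sup_dist k (step_path m (v n)) (step_path m w) \<le> r / 2"
    proof (rule sup_dist_le)
      fix t assume t: "0 \<le> t" "t \<le> real k"
      show "min 1 \<bar>step_path m (v n) t - step_path m w t\<bar> \<le> r / 2"
        unfolding step_path_def using N[OF that step_index_le[OF t, of m]] by linarith
    qed
    then show ?thesis using sup_dist_nonneg[of k "step_path m (v n)" "step_path m w"] r by simp
  qed
  then show "\<exists>no. \<forall>n\<ge>no. norm (sup_dist k (step_path m (v n)) (step_path m w) - 0) < r" by blast
qed

lemma step_path_continuous_tendsto:
  assumes x: "continuous_on {0..} x"
  shows "(\<lambda>m. sup_dist k (step_path (Suc m) (\<lambda>i. x (real i / real (Suc m)))) x) \<longlonglongrightarrow> 0"
proof (rule LIMSEQ_I)
  fix r :: real assume r: "0 < r"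
  have "uniformly_continuous_on {0..real k} x"
    by (intro compact_uniformly_continuous continuous_on_subset[OF x]) auto
  then obtain d where d: "d > 0" "\<And>s t. s \<in> {0..real k} \<Longrightarrow> t \<in> {0..real k} \<Longrightarrow> dist s t < d \<Longrightarrow> dist (x s) (x t) < r / 2"
    unfolding uniformly_continuous_on_def using r half_gt_zero by metis
  obtain N :: nat where N: "1 / d < real N" using reals_Archimedean2 by blast
  have "norm (sup_dist k (step_path (Suc m) (\<lambda>i. x (real i / real (Suc m)))) x - 0) < r" if m: "m \<ge> N" for m
  proof -
    have "1 / d < real (Suc m)" using N m by linarith
    then have md: "1 / real (Suc m) < d" using d(1) by (simp add: field_simps)
    have "sup_dist k (step_path (Suc m) (\<lambda>i. x (real i / real (Suc m)))) x \<le> r / 2"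
    proof (rule sup_dist_le)
      fix t assume t: "0 \<le> t" "t \<le> real k"
      define u where "u = real (nat \<lfloor>t * real (Suc m)\<rfloor>) / real (Suc m)"
      have fl: "real (nat \<lfloor>t * real (Suc m)\<rfloor>) = of_int \<lfloor>t * real (Suc m)\<rfloor>" using t by simp
      have u1: "u \<le> t" unfolding u_def fl by (subst divide_le_eq) (use of_int_floor_le in auto)
      have "t * real (Suc m) < of_int \<lfloor>t * real (Suc m)\<rfloor> + 1" by linarith
      then have "t < (of_int \<lfloor>t * real (Suc m)\<rfloor> + 1) / real (Suc m)" by (subst less_divide_eq) auto
      then have u2: "t < u + 1 / real (Suc m)" unfolding u_def fl by (simp add: add_divide_distrib)
      have "u \<ge> 0" by (simp add: u_def)
      then have "dist (x u) (x t) < r / 2"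
        using t u1 u2 md by (intro d(2)) (auto simp: dist_real_def)
      then show "min 1 \<bar>step_path (Suc m) (\<lambda>i. x (real i / real (Suc m))) t - x t\<bar> \<le> r / 2"
        unfolding step_path_def u_def[symmetric] dist_real_def by linarith
    qed
    then show ?thesis using sup_dist_nonneg[of k "step_path (Suc m) (\<lambda>i. x (real i / real (Suc m)))" x] r by simp
  qed
  then show "\<exists>no. \<forall>m\<ge>no. norm (sup_dist k (step_path (Suc m) (\<lambda>i. x (real i / real (Suc m)))) x - 0) < r" by blast
qed

context bounded_path_functional
begin

lemma env_tendsto_of_sup_dist:
  assumes "(\<lambda>n. sup_dist k (x n) y) \<longlonglongrightarrow> 0"
  shows "(\<lambda>n. lip_env f k (x n)) \<longlonglongrightarrow> lip_env f k y"
proof -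
  have "(\<lambda>n. lip_env f k (x n) - lip_env f k y) \<longlonglongrightarrow> 0"
  proof (rule Lim_null_comparison)
    show "\<forall>\<^sub>F n in sequentially. norm (lip_env f k (x n) - lip_env f k y) \<le> real k * sup_dist k (x n) y"
      using env_lipschitz_abs by simp
    show "(\<lambda>n. real k * sup_dist k (x n) y) \<longlonglongrightarrow> 0"
      using tendsto_mult_left[OF assms, of "real k"] by simp
  qed
  then show ?thesis by (rule LIM_zero_cancel)
qed

text \<open>An infimum over uncountably many paths is not measurable by itself; the Lipschitz bound
  makes it a continuous function of the grid values.\<close>

lemma env_step_measurable:
  assumes "\<And>i. (\<lambda>q. V q i) \<in> borel_measurable A"
  shows "(\<lambda>q. lip_env f k (step_path m (V q))) \<in> borel_measurable A"
proof -
  have "continuous_on UNIV (\<lambda>v. lip_env f k (step_path m v))"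
  proof (rule continuous_on_sequentiallyI)
    fix u :: "nat \<Rightarrow> nat \<Rightarrow> real" and a assume u: "u \<longlonglongrightarrow> a"
    have "(\<lambda>n. u n i) \<longlonglongrightarrow> a i" for i
      using continuous_on_tendsto_compose[OF continuous_on_product_coordinates u] by simp
    then show "(\<lambda>n. lip_env f k (step_path m (u n))) \<longlonglongrightarrow> lip_env f k (step_path m a)"
      by (intro env_tendsto_of_sup_dist step_path_tendsto)
  qed
  then have "(\<lambda>v. lip_env f k (step_path m v)) \<in> borel_measurable borel"
    by (rule borel_measurable_continuous_onI)
  moreover have "V \<in> borel_measurable A"
    using assms by (rule measurable_coordinatewise_then_product)
  ultimately show ?thesis by (rule measurable_compose_rev)
qed

lemma env_continuous_measurable:
  assumes B: "\<And>t. t \<ge> 0 \<Longrightarrow> B t \<in> borel_measurable N"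
    and c: "\<And>w. w \<in> space N \<Longrightarrow> continuous_on {0..} (\<lambda>t. B t w)"
  shows "(\<lambda>w. lip_env f k (\<lambda>t. B t w)) \<in> borel_measurable N"
proof (rule borel_measurable_LIMSEQ_real)
  fix w assume "w \<in> space N"
  from env_tendsto_of_sup_dist[OF step_path_continuous_tendsto[OF c[OF this]]]
  show "(\<lambda>m. lip_env f k (step_path (Suc m) (\<lambda>i. B (real i / real (Suc m)) w))) \<longlonglongrightarrow> lip_env f k (\<lambda>t. B t w)" .
qed (intro env_step_measurable B; simp)

lemma env_restrict: "lip_env f k (\<lambda>t\<in>{0..}. x t) = lip_env f k x"
proof -
  have "sup_dist k (\<lambda>t\<in>{0..}. x t) y = sup_dist k x y" for y
    unfolding sup_dist_def by (intro SUP_cong) auto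
  then show ?thesis by (simp add: lip_env_def)
qed

end

text \<open>The indicator of an open set is lower semicontinuous, so its envelopes converge to it
  along the continuous paths of the process. They are measurable as limits over finer and finer
  grids.\<close>

lemma continuous_process_measurable:
  assumes B: "\<And>t. t \<ge> 0 \<Longrightarrow> B t \<in> borel_measurable N"
    and c: "\<And>w. w \<in> space N \<Longrightarrow> continuous_on {0..} (\<lambda>t. B t w)"
  shows "(\<lambda>w. \<lambda>t\<in>{0..}. B t w) \<in> measurable N (borel_of skorokhod_J1)"
  unfolding borel_of_def
proof (rule measurable_measure_of)
  show "(\<lambda>w. \<lambda>t\<in>{0..}. B t w) \<in> space N \<rightarrow> topspace skorokhod_J1"
    using cadlag_paths_continuous[OF c] by auto
  fix U assume "U \<in> {U. openin skorokhod_J1 U}"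
  then have U: "openin skorokhod_J1 U" by simp
  interpret bounded_path_functional "indicat_real U" 1
    by standard (simp add: indicator_def)
  have "(\<lambda>w. indicat_real U (\<lambda>t\<in>{0..}. B t w)) \<in> borel_measurable N"
  proof (rule borel_measurable_LIMSEQ_real[OF _ env_continuous_measurable[OF B c]])
    fix w assume w: "w \<in> space N"
    let ?x = "\<lambda>t\<in>{0..}. B t w"
    have "(\<lambda>k. lip_env (indicat_real U) k ?x) \<longlonglongrightarrow> indicat_real U ?x"
    proof (rule env_tendsto)
      show x: "?x \<in> cadlag_paths" by (rule cadlag_paths_continuous[OF c[OF w]])
      fix \<eta> :: real assume "0 < \<eta>"
      show "\<exists>T>0. \<exists>d>0. \<forall>y\<in>J1_nbhd ?x T d. indicat_real U ?x - \<eta> < indicat_real U y"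
      proof (cases "?x \<in> U")
        case True
        then obtain T d where "T > 0" "d > 0" "J1_nbhd ?x T d \<subseteq> U"
          using U unfolding openin_skorokhod_J1 by blast
        then show ?thesis using \<open>0 < \<eta>\<close>
          by (intro exI[of _ T] conjI exI[of _ d]) (auto simp: indicator_def)
      next
        case False
        then show ?thesis using \<open>0 < \<eta>\<close>
          by (intro exI[of _ 1] conjI) (auto simp: indicator_def)
      qed
    qed
    then show "(\<lambda>k. lip_env (indicat_real U) k (\<lambda>t. B t w)) \<longlonglongrightarrow> indicat_real U ?x"
      unfolding env_restrict .
  qed
  then have "{w \<in> space N. indicat_real U (\<lambda>t\<in>{0..}. B t w) > 0} \<in> sets N" by measurable
  also have "{w \<in> space N. indicat_real U (\<lambda>t\<in>{0..}. B t w) > 0} = (\<lambda>w. \<lambda>t\<in>{0..}. B t w) -` U \<inter> space N"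
    by (auto simp: indicator_def)
  finally show "(\<lambda>w. \<lambda>t\<in>{0..}. B t w) -` U \<inter> space N \<in> sets N" .
qed (use openin_subset in fastforce)

section \<open>The simple random walk\<close>

abbreviation step_space :: "(nat \<Rightarrow> int) measure" where
  "step_space \<equiv> (\<Pi>\<^sub>M k\<in>(UNIV :: nat set). measure_pmf (pmf_of_set {-1, 1}))"

interpretation steps: sequence_space "measure_pmf (pmf_of_set {-1, 1 :: int})"
  by standard

lemma space_step_space [simp]: "space step_space = UNIV"
  by (simp add: space_PiM)

lemma step_measurable [measurable]: "(\<lambda>\<xi>. \<xi> k) \<in> measurable step_space (count_space UNIV)"
  using measurable_component_singleton[of k UNIV "\<lambda>_. measure_pmf (pmf_of_set {-1, 1 :: int})"]
  by (simp cong: measurable_cong_sets)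

lemma walk_Suc: "walk \<xi> (Suc n) = walk \<xi> n + \<xi> n"
  by (simp add: walk_def)

lemma walk_0 [simp]: "walk \<xi> 0 = 0"
  by (simp add: walk_def)

lemma walk_measurable [measurable]: "(\<lambda>\<xi>. walk \<xi> n) \<in> measurable step_space (count_space UNIV)"
proof (induction n)
  case (Suc n)
  show ?case unfolding walk_Suc
    by (rule measurable_compose_countable[OF _ Suc, of "\<lambda>i \<xi>. i + \<xi> n"]) measurable
qed simp

lemma walk_case_nat: "walk (case_nat e \<xi>) (Suc n) = e + walk \<xi> n"
  unfolding walk_def by (subst sum.lessThan_Suc_shift) simp

lemma steps_AE: "AE \<xi> in step_space. \<forall>k. \<xi> k \<in> {-1, 1}"
  unfolding AE_all_countable
proof
  fix k
  show "AE \<xi> in step_space. \<xi> k \<in> {-1, 1}"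
    by (rule AE_PiM_component) (auto simp: AE_measure_pmf_iff intro: prob_space_measure_pmf)
qed

lemma walk_bounded: "(\<forall>k. \<xi> k \<in> {-1, 1}) \<Longrightarrow> \<bar>walk \<xi> n\<bar> \<le> int n"
proof (induction n)
  case (Suc n)
  have "\<xi> n = -1 \<or> \<xi> n = 1" using Suc.prems by blast
  then have "\<bar>\<xi> n\<bar> = 1" by auto
  then show ?case using Suc by (simp add: walk_Suc)
qed simp

text \<open>Putting an independent fair step in front of a step sequence preserves
  \<open>step_space\<close>. The recursions for \<open>walk_prob\<close> and for the maximum of the
  walk rest on this decomposition.\<close>

lemma first_step_nn_integral:
  assumes f: "f \<in> borel_measurable step_space"
  shows "(\<integral>\<^sup>+\<xi>. f \<xi> \<partial>step_space)
    = ((\<integral>\<^sup>+\<xi>. f (case_nat (-1) \<xi>) \<partial>step_space) + (\<integral>\<^sup>+\<xi>. f (case_nat 1 \<xi>) \<partial>step_space)) / 2"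
proof -
  let ?M = "measure_pmf (pmf_of_set {-1, 1 :: int})"
  have m: "(\<lambda>(s, \<xi>). case_nat s \<xi>) \<in> measurable (?M \<Otimes>\<^sub>M step_space) step_space"
    by measurable
  have f2: "(\<lambda>(s, \<xi>). f (case_nat s \<xi>)) \<in> borel_measurable (?M \<Otimes>\<^sub>M step_space)"
    using measurable_compose[OF m f] by (simp add: case_prod_beta)
  have "(\<integral>\<^sup>+\<xi>. f \<xi> \<partial>step_space) = (\<integral>\<^sup>+\<xi>. f \<xi> \<partial>distr (?M \<Otimes>\<^sub>M step_space) step_space (\<lambda>(s, \<xi>). case_nat s \<xi>))"
    by (simp add: steps.PiM_iter)
  also have "\<dots> = (\<integral>\<^sup>+z. f (case z of (s, \<xi>) \<Rightarrow> case_nat s \<xi>) \<partial>(?M \<Otimes>\<^sub>M step_space))"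
    by (rule nn_integral_distr[OF m]) (simp add: f)
  also have "\<dots> = (\<integral>\<^sup>+z. (case z of (s, \<xi>) \<Rightarrow> f (case_nat s \<xi>)) \<partial>(?M \<Otimes>\<^sub>M step_space))"
    by (intro nn_integral_cong) (simp split: prod.split)
  also have "\<dots> = (\<integral>\<^sup>+s. \<integral>\<^sup>+\<xi>. f (case_nat s \<xi>) \<partial>step_space \<partial>?M)"
    using steps.P.nn_integral_fst[OF f2] by simp
  also have "\<dots> = (\<Sum>s\<in>{-1, 1}. (\<integral>\<^sup>+\<xi>. f (case_nat s \<xi>) \<partial>step_space) * ennreal (pmf (pmf_of_set {-1, 1}) s))"
    by (subst nn_integral_measure_pmf_finite) auto
  also have "\<dots> = ((\<integral>\<^sup>+\<xi>. f (case_nat (-1) \<xi>) \<partial>step_space) + (\<integral>\<^sup>+\<xi>. f (case_nat 1 \<xi>) \<partial>step_space)) / 2"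
  proof -
    have "ennreal (1/2) = 1 / 2"
      by (metis divide_ennreal ennreal_1 ennreal_numeral zero_less_numeral zero_le_one zero_le_numeral)
    then show ?thesis
      by (simp add: ennreal_times_divide add_divide_distrib_ennreal distrib_right[symmetric])
  qed
  finally show ?thesis .
qed

lemma first_step_measure:
  assumes P[measurable]: "Measurable.pred step_space P"
  shows "measure step_space {\<xi>. P \<xi>}
    = (measure step_space {\<xi>. P (case_nat (-1) \<xi>)} + measure step_space {\<xi>. P (case_nat 1 \<xi>)}) / 2"
proof -
  have c: "(\<lambda>\<xi>. case_nat e \<xi>) \<in> measurable step_space step_space" for e :: int
    by measurable
  have P': "Measurable.pred step_space (\<lambda>\<xi>. P (case_nat e \<xi>))" for e
    using measurable_compose[OF c P] .
  have s: "{\<xi>. P \<xi>} \<in> sets step_space" "{\<xi>. P (case_nat e \<xi>)} \<in> sets step_space" for e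
    using P P'[of e] by (simp_all add: pred_def)
  have I: "indicator {\<xi>. P \<xi>} (case_nat e \<xi>) = (indicator {\<xi>. P (case_nat e \<xi>)} \<xi> :: ennreal)" for e \<xi>
    by (simp add: indicator_def)
  have "emeasure step_space {\<xi>. P \<xi>} =
      (emeasure step_space {\<xi>. P (case_nat (-1) \<xi>)} + emeasure step_space {\<xi>. P (case_nat 1 \<xi>)}) / 2"
    using first_step_nn_integral[of "indicator {\<xi>. P \<xi>}"] s by (simp add: I)
  then have "ennreal (measure step_space {\<xi>. P \<xi>}) = ennreal
      ((measure step_space {\<xi>. P (case_nat (-1) \<xi>)} + measure step_space {\<xi>. P (case_nat 1 \<xi>)}) / 2)"
    by (simp add: steps.P.emeasure_eq_measure ennreal_plus[symmetric] divide_ennreal[symmetric] del: ennreal_plus)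
  then show ?thesis by (simp add: ennreal_inj)
qed

section \<open>Transition probabilities and the Green function\<close>

definition walk_prob :: "nat \<Rightarrow> int \<Rightarrow> real" where
  "walk_prob k x = measure step_space {\<xi>. walk \<xi> k = x}"

lemma walk_prob_0: "walk_prob 0 x = (if x = 0 then 1 else 0)"
  using steps.P.prob_space by (auto simp: walk_prob_def)

lemma walk_prob_Suc: "walk_prob (Suc k) x = (walk_prob k (x - 1) + walk_prob k (x + 1)) / 2"
proof -
  have "{\<xi>. -1 + walk \<xi> k = x} = {\<xi>. walk \<xi> k = x + 1}" "{\<xi>. 1 + walk \<xi> k = x} = {\<xi>. walk \<xi> k = x - 1}"
    by auto
  moreover have "Measurable.pred step_space (\<lambda>\<xi>. walk \<xi> (Suc k) = x)" by measurable
  ultimately show ?thesis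
    using first_step_measure[of "\<lambda>\<xi>. walk \<xi> (Suc k) = x"] by (simp add: walk_prob_def walk_case_nat)
qed

lemma walk_prob_nonneg: "0 \<le> walk_prob k x"
  by (simp add: walk_prob_def)

lemma walk_prob_sum_le: "finite A \<Longrightarrow> (\<Sum>x\<in>A. walk_prob k x) \<le> 1"
proof -
  assume A: "finite A"
  have "(\<Sum>x\<in>A. walk_prob k x) = measure step_space (\<Union>x\<in>A. {\<xi>. walk \<xi> k = x})"
    unfolding walk_prob_def
  proof (rule steps.P.finite_measure_finite_Union[symmetric, OF A])
    have "{\<xi> \<in> space step_space. walk \<xi> k = x} \<in> sets step_space" for x by measurable
    then show "(\<lambda>x. {\<xi>. walk \<xi> k = x}) ` A \<subseteq> sets step_space" by auto
  qed (auto simp: disjoint_family_on_def)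
  also have "\<dots> \<le> 1" by (rule steps.P.prob_le_1)
  finally show ?thesis .
qed

definition green :: "nat \<Rightarrow> int \<Rightarrow> real" where
  "green n x = (\<Sum>k<n. walk_prob k x)"

lemma green_0 [simp]: "green 0 x = 0" by (simp add: green_def)

lemma green_Suc: "green (Suc n) x = (if x = 0 then 1 else 0) + (green n (x - 1) + green n (x + 1)) / 2"
  unfolding green_def sum.lessThan_Suc_shift walk_prob_0 walk_prob_Suc
  by (simp add: sum.distrib sum_divide_distrib[symmetric])

lemma green_nonneg: "0 \<le> green n x"
  unfolding green_def by (intro sum_nonneg walk_prob_nonneg)

lemma green_minus: "green n (- x) = green n x"
proof (induction n arbitrary: x)
  case (Suc n)
  have e: "- x - 1 = - (x + 1)" "- x + 1 = - (x - 1)" by auto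
  have "green n (- x - 1) = green n (x + 1)" "green n (- x + 1) = green n (x - 1)"
    unfolding e Suc by (rule refl)+
  then show ?case by (simp add: green_Suc)
qed simp

text \<open>Both bounds are carried through the recursion \<open>green_Suc\<close> together. Away
  from the origin they are averages of earlier differences. At the origin the unit mass is what
  compensates a previous difference of up to 2 on one side, so the upper bound is needed for
  monotonicity itself.\<close>

lemma green_diff:
  "0 \<le> x \<Longrightarrow> green n (x + 1) \<le> green n x \<and> green n x - green n (x + 1) \<le> 2"
proof (induction n arbitrary: x)
  case (Suc n)
  show ?case
  proof (cases "x = 0")
    case True
    have "green n (- 1) = green n 1" by (rule green_minus)
    have g: "green (Suc n) 0 = 1 + green n 1" "green (Suc n) 1 = (green n 0 + green n 2) / 2"
      using \<open>green n (- 1) = green n 1\<close> by (simp_all add: green_Suc)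
    have "green n 1 \<le> green n 0" "green n 0 - green n 1 \<le> 2" "green n 2 \<le> green n 1" "green n 1 - green n 2 \<le> 2"
      using Suc.IH[of 0] Suc.IH[of 1] by auto
    then have "green (Suc n) 1 \<le> green (Suc n) 0 \<and> green (Suc n) 0 - green (Suc n) 1 \<le> 2"
      unfolding g by (simp add: field_simps)
    then show ?thesis using True by simp
  next
    case False
    then have "0 \<le> x - 1" using Suc.prems by simp
    from Suc.IH[OF this] Suc.IH[of "x + 1"] False Suc.prems
    show ?thesis by (auto simp: green_Suc field_simps)
  qed
qed simp

lemma green_sum_le: "finite A \<Longrightarrow> (\<Sum>x\<in>A. green n x) \<le> real n"
  unfolding green_def
  by (subst sum.swap) (use sum_bounded_above[of "{..<n}" "\<lambda>k. \<Sum>x\<in>A. walk_prob k x" 1] walk_prob_sum_le in auto)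

lemma green_ge: "green n 0 - 2 * real r \<le> green n (int r)"
proof (induction r)
  case (Suc r)
  then show ?case using green_diff[of "int r" n] by (simp add: add.commute)
qed simp

text \<open>A tent argument in place of Stirling's formula: slopes are at most 2, so the kernel
  stays above \<open>g / 2\<close> on \<open>|x| \<le> g / 4\<close>, while its total mass is at
  most \<open>n\<close>. This yields \<open>g\<^sup>2 \<le> 8 * n\<close>, relaxed to
  \<open>9 * n\<close> for an integer root.\<close>

lemma green_origin_le: "green n 0 \<le> 3 * sqrt (real n)"
proof -
  define g where "g = green n 0"
  have g0: "0 \<le> g" by (simp add: g_def green_nonneg)
  define r where "r = nat \<lfloor>g / 4\<rfloor>"
  have r: "real r \<le> g / 4" "g / 4 < real r + 1" using g0 unfolding r_def by linarith+
  have "(\<Sum>x\<in>{- int r..int r}. g / 2) \<le> (\<Sum>x\<in>{- int r..int r}. green n x)"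
  proof (rule sum_mono)
    fix x assume x: "x \<in> {- int r..int r}"
    have "green n x = green n (int (nat \<bar>x\<bar>))"
      using green_minus[of n x] by (auto simp: abs_if)
    then have "g - 2 * real (nat \<bar>x\<bar>) \<le> green n x" using green_ge[of n "nat \<bar>x\<bar>"] by (simp add: g_def)
    moreover have "nat \<bar>x\<bar> \<le> r" using x by auto
    then have "real (nat \<bar>x\<bar>) \<le> real r" by simp
    ultimately show "g / 2 \<le> green n x" using r by linarith
  qed
  also have "\<dots> \<le> real n" by (rule green_sum_le) simp
  finally have "(2 * real r + 1) * (g / 2) \<le> real n" by (simp add: nat_add_distrib algebra_simps)
  moreover have "g / 4 * (g / 2) \<le> (2 * real r + 1) * (g / 2)"
    using r g0 by (intro mult_right_mono) auto
  ultimately have "g\<^sup>2 \<le> 9 * real n" by (simp add: power2_eq_square)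
  then have "sqrt (g\<^sup>2) \<le> sqrt (9 * real n)" by (rule real_sqrt_le_mono)
  then have "\<bar>g\<bar> \<le> sqrt 9 * sqrt (real n)" by (simp add: real_sqrt_mult)
  moreover have "sqrt 9 = (3::real)" by (rule real_sqrt_unique) auto
  ultimately show ?thesis using g0 by (simp add: g_def)
qed

text \<open>Summation by parts against a symmetric kernel that decreases in \<open>\<bar>x\<bar>\<close>; only the averages of
  \<open>e\<close> over symmetric intervals enter.\<close>

lemma green_average_le:
  assumes e: "\<And>r. r \<le> N \<Longrightarrow> (\<Sum>x\<in>{- int r..int r}. e x) \<le> c * (2 * real r + 1)"
    and c: "0 \<le> c"
  shows "(\<Sum>x\<in>{- int N..int N}. green n x * e x) \<le> c * real n"
proof -
  have D: "0 \<le> (\<Sum>x\<in>{- int r..int r}. c - e x)" if "r \<le> N" for r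
    using e[OF that] by (simp add: sum_subtractf nat_add_distrib algebra_simps)
  have split: "(\<Sum>x\<in>{- int (Suc r)..int (Suc r)}. h x)
      = (\<Sum>x\<in>{- int r..int r}. h x) + (h (int r + 1) + h (- (int r + 1)))" for h :: "int \<Rightarrow> real" and r
  proof -
    have "{- int (Suc r)..int (Suc r)} = insert (int r + 1) (insert (- (int r + 1)) {- int r..int r})"
      by auto
    then show ?thesis by simp
  qed
  \<comment> \<open>Abel summation as an induction over growing intervals: the partial sums of
    \<open>c - e x\<close> are non-negative, so lowering all inner weights to the outermost one only
    decreases the total.\<close>
  have "green n (int r) * (\<Sum>x\<in>{- int r..int r}. c - e x) \<le> (\<Sum>x\<in>{- int r..int r}. green n x * (c - e x))"
    if "r \<le> N" for r
    using that
  proof (induction r)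
    case (Suc r)
    let ?G = "green n (int r + 1)"
    let ?D = "\<Sum>x\<in>{- int r..int r}. c - e x"
    have "?G * ?D \<le> green n (int r) * ?D"
      using green_diff[of "int r" n] D[of r] Suc.prems by (intro mult_right_mono) auto
    moreover have "green n (int r) * ?D \<le> (\<Sum>x\<in>{- int r..int r}. green n x * (c - e x))"
      using Suc by simp
    moreover have Gm: "green n (- (int r + 1)) = ?G" by (rule green_minus)
    moreover have Gs: "green n (int (Suc r)) = ?G" by (simp add: add.commute)
    ultimately show ?case
      unfolding split distrib_left Gm Gs by linarith
  qed simp
  from this[of N] have "0 \<le> (\<Sum>x\<in>{- int N..int N}. green n x * (c - e x))"
    using mult_nonneg_nonneg[OF green_nonneg[of n "int N"] D[of N]] by simp
  then have "(\<Sum>x\<in>{- int N..int N}. green n x * e x) \<le> c * (\<Sum>x\<in>{- int N..int N}. green n x)"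
    by (simp add: sum_subtractf right_diff_distrib sum_distrib_left mult.commute)
  also have "\<dots> \<le> c * real n" using c by (intro mult_left_mono green_sum_le) auto
  finally show ?thesis .
qed

section \<open>Shifted walks and self-intersections\<close>

lemma shift_steps:
  "distr step_space step_space (\<lambda>\<xi> n. \<xi> (i + n)) = step_space"
proof -
  have "distr (Pi\<^sub>M UNIV (\<lambda>_. measure_pmf (pmf_of_set {-1, 1 :: int})))
      (\<Pi>\<^sub>M n\<in>UNIV. (\<lambda>_. measure_pmf (pmf_of_set {-1, 1 :: int})) (i + n)) (\<lambda>\<omega>. \<lambda>n\<in>UNIV. \<omega> (i + n))
    = (\<Pi>\<^sub>M n\<in>UNIV. (\<lambda>_. measure_pmf (pmf_of_set {-1, 1 :: int})) (i + n))"
    by (rule distr_PiM_reindex) (auto intro: prob_space_measure_pmf)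
  then show ?thesis by (simp add: restrict_UNIV)
qed

lemma shift_measurable: "(\<lambda>\<xi> n. \<xi> (i + n)) \<in> measurable step_space step_space"
  by (intro measurable_PiM_single') (auto simp: space_PiM)

lemma walk_shift: "walk (\<lambda>n. \<xi> (i + n)) m = walk \<xi> (i + m) - walk \<xi> i"
proof (induction m)
  case (Suc m)
  then show ?case by (simp add: walk_Suc)
qed simp

lemma shift_prob:
  assumes P[measurable]: "Measurable.pred step_space P"
  shows "measure step_space {\<xi>. P (\<lambda>n. \<xi> (i + n))} = measure step_space {\<xi>. P \<xi>}"
proof -
  have "{\<xi>. P \<xi>} \<in> sets step_space" using P by (simp add: pred_def)
  from measure_distr[OF shift_measurable[of i] this] show ?thesis
    unfolding shift_steps by (simp add: vimage_def)
qed

lemma walk_meet_prob: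
  "measure step_space {\<xi>. walk \<xi> k = walk \<xi> l} = walk_prob (if k \<le> l then l - k else k - l) 0"
proof -
  have *: "measure step_space {\<xi>. walk \<xi> k = walk \<xi> l} = walk_prob (l - k) 0" if "k \<le> l" for k l
  proof -
    have "Measurable.pred step_space (\<lambda>\<xi>. walk \<xi> (l - k) = 0)" by measurable
    from shift_prob[OF this, of k]
    have "measure step_space {\<xi>. walk \<xi> l = walk \<xi> k} = walk_prob (l - k) 0"
      using that by (simp add: walk_shift walk_prob_def)
    moreover have "{\<xi>. walk \<xi> l = walk \<xi> k} = {\<xi>. walk \<xi> k = walk \<xi> l}" by auto
    ultimately show ?thesis by simp
  qed
  show ?thesis
  proof (cases "k \<le> l")
    case True
    then show ?thesis using *[OF True] by simp
  next
    case False
    then have "measure step_space {\<xi>. walk \<xi> l = walk \<xi> k} = walk_prob (k - l) 0" by (intro *) simp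
    moreover have "{\<xi>. walk \<xi> l = walk \<xi> k} = {\<xi>. walk \<xi> k = walk \<xi> l}" by auto
    ultimately have "measure step_space {\<xi>. walk \<xi> k = walk \<xi> l} = walk_prob (k - l) 0" by (simp only:)
    then show ?thesis using False by simp
  qed
qed

text \<open>For fixed \<open>k\<close> the later times contribute expected returns to the origin,
  and by stationarity so do the earlier ones; each half is at most \<open>green n 0\<close>.\<close>

lemma walk_meetings_le:
  "(\<Sum>k<n. \<Sum>l<n. measure step_space {\<xi>. walk \<xi> k = walk \<xi> l}) \<le> 6 * real n * sqrt (real n)"
proof -
  have "(\<Sum>l<n. measure step_space {\<xi>. walk \<xi> k = walk \<xi> l}) \<le> 6 * sqrt (real n)" if k: "k < n" for k
  proof -
    have "(\<Sum>l<n. measure step_space {\<xi>. walk \<xi> k = walk \<xi> l})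
        = (\<Sum>l\<in>{..<k} \<union> {k..<n}. measure step_space {\<xi>. walk \<xi> k = walk \<xi> l})"
      using k by (intro sum.cong) auto
    also have "\<dots> = (\<Sum>l\<in>{..<k}. walk_prob (k - l) 0) + (\<Sum>l\<in>{k..<n}. walk_prob (l - k) 0)"
      by (subst sum.union_disjoint) (auto simp: walk_meet_prob intro!: arg_cong2[where f="(+)"] sum.cong)
    also have "(\<Sum>l\<in>{..<k}. walk_prob (k - l) 0) = (\<Sum>j\<in>{0<..k}. walk_prob j 0)"
      by (rule sum.reindex_bij_witness[of _ "\<lambda>j. k - j" "\<lambda>l. k - l"]) auto
    also have "(\<Sum>l\<in>{k..<n}. walk_prob (l - k) 0) = (\<Sum>j\<in>{..<n-k}. walk_prob j 0)"
      by (rule sum.reindex_bij_witness[of _ "\<lambda>j. j + k" "\<lambda>l. l - k"]) auto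
    also have "(\<Sum>j\<in>{0<..k}. walk_prob j 0) \<le> green n 0"
      unfolding green_def using k by (intro sum_mono2) (auto simp: walk_prob_nonneg)
    also have "(\<Sum>j\<in>{..<n-k}. walk_prob j 0) \<le> green n 0"
      unfolding green_def by (intro sum_mono2) (auto simp: walk_prob_nonneg)
    finally show ?thesis using green_origin_le[of n] by simp
  qed
  then have "(\<Sum>k<n. \<Sum>l<n. measure step_space {\<xi>. walk \<xi> k = walk \<xi> l}) \<le> (\<Sum>k<n. 6 * sqrt (real n))"
    by (intro sum_mono) simp
  then show ?thesis by simp
qed

section \<open>Oscillation of the walk within a block\<close>

lemma walk_max_pred [measurable]:
  "Measurable.pred step_space (\<lambda>\<xi>. \<exists>j\<le>n. a \<le> \<bar>x + real_of_int (walk \<xi> j)\<bar>)"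
proof -
  have "(\<lambda>\<xi>. a \<le> \<bar>x + real_of_int (walk \<xi> j)\<bar>) \<in> measurable step_space (count_space UNIV)" for j
    by (rule measurable_compose[OF walk_measurable]) simp
  then have "(\<Union>j\<in>{..n}. {\<xi>. a \<le> \<bar>x + real_of_int (walk \<xi> j)\<bar>}) \<in> sets step_space"
    by (intro sets.finite_UN) (auto simp: pred_def)
  moreover have "{\<xi>. \<exists>j\<le>n. a \<le> \<bar>x + real_of_int (walk \<xi> j)\<bar>} = (\<Union>j\<in>{..n}. {\<xi>. a \<le> \<bar>x + real_of_int (walk \<xi> j)\<bar>})"
    by auto
  ultimately show ?thesis by (simp add: pred_def)
qed

text \<open>The bound is the fourth moment of \<open>x + Y\<^sub>n\<close>; conditioning on the first step makes the
  submartingale maximal inequality an induction over \<open>n\<close>.\<close>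

lemma walk_max_fourth_moment:
  assumes "0 < a"
  shows "a ^ 4 * measure step_space {\<xi>. \<exists>j\<le>n. a \<le> \<bar>x + real_of_int (walk \<xi> j)\<bar>}
    \<le> x ^ 4 + 6 * x\<^sup>2 * real n + 3 * (real n)\<^sup>2 - 2 * real n"
proof (induction n arbitrary: x)
  case 0
  show ?case
  proof (cases "a \<le> \<bar>x\<bar>")
    case True
    then have "a ^ 4 \<le> \<bar>x\<bar> ^ 4" using assms by (intro power_mono) auto
    then show ?thesis using True steps.P.prob_space by simp
  qed simp
next
  case (Suc n)
  show ?case
  proof (cases "a \<le> \<bar>x\<bar>")
    case True
    then have "a ^ 4 \<le> \<bar>x\<bar> ^ 4" using assms by (intro power_mono) auto
    then have "a ^ 4 \<le> x ^ 4" by simp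
    moreover have "a ^ 4 * measure step_space {\<xi>. \<exists>j\<le>Suc n. a \<le> \<bar>x + real_of_int (walk \<xi> j)\<bar>} \<le> a ^ 4 * 1"
      using assms by (intro mult_left_mono steps.P.prob_le_1) auto
    moreover have "0 \<le> 6 * x\<^sup>2 * real (Suc n)" by simp
    moreover have "real (Suc n) * 2 \<le> 3 * (real (Suc n))\<^sup>2"
      unfolding power2_eq_square by (simp add: algebra_simps)
    ultimately show ?thesis by linarith
  next
    case False
    let ?p = "\<lambda>x. measure step_space {\<xi>. \<exists>j\<le>n. a \<le> \<bar>x + real_of_int (walk \<xi> j)\<bar>}"
    have shift: "(\<exists>j\<le>Suc n. a \<le> \<bar>x + real_of_int (walk (case_nat e \<xi>) j)\<bar>) \<longleftrightarrow>
        (\<exists>j\<le>n. a \<le> \<bar>(x + e) + real_of_int (walk \<xi> j)\<bar>)" (is "?L \<longleftrightarrow> ?R") for e :: int and \<xi>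
    proof
      assume ?L
      then obtain j where j: "j \<le> Suc n" "a \<le> \<bar>x + real_of_int (walk (case_nat e \<xi>) j)\<bar>" by blast
      with False obtain i where "j = Suc i" by (cases j) auto
      with j show ?R by (intro exI[of _ i]) (auto simp: walk_case_nat add.assoc)
    next
      assume ?R
      then obtain j where "j \<le> n" "a \<le> \<bar>(x + e) + real_of_int (walk \<xi> j)\<bar>" by blast
      then show ?L by (intro exI[of _ "Suc j"]) (auto simp: walk_case_nat add.assoc)
    qed
    have P: "measure step_space {\<xi>. \<exists>j\<le>Suc n. a \<le> \<bar>x + real_of_int (walk \<xi> j)\<bar>} = (?p (x - 1) + ?p (x + 1)) / 2"
      by (subst first_step_measure[OF walk_max_pred]) (simp only: shift of_int_minus of_int_1 add_uminus_conv_diff)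
    moreover have "a ^ 4 * ?p (x - 1) + a ^ 4 * ?p (x + 1) \<le>
        2 * (x ^ 4 + 6 * x\<^sup>2 * real (Suc n) + 3 * (real (Suc n))\<^sup>2 - 2 * real (Suc n))"
    proof -
      \<comment> \<open>The fourth-moment polynomial is reproduced exactly when averaged over the
        first step.\<close>
      have "((x - 1) ^ 4 + 6 * (x - 1)\<^sup>2 * N + 3 * N\<^sup>2 - 2 * N) + ((x + 1) ^ 4 + 6 * (x + 1)\<^sup>2 * N + 3 * N\<^sup>2 - 2 * N)
        = 2 * (x ^ 4 + 6 * x\<^sup>2 * (1 + N) + 3 * (1 + N)\<^sup>2 - 2 * (1 + N))" for N :: real
        by algebra
      from this[of "real n"] show ?thesis
        using add_mono[OF Suc.IH[of "x - 1"] Suc.IH[of "x + 1"]] by simp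
    qed
    moreover have "X \<le> 2 * Y \<Longrightarrow> X / 2 \<le> Y" for X Y :: real by simp
    ultimately show ?thesis unfolding P times_divide_eq_right distrib_left by blast
  qed
qed

text \<open>The square of \<open>h\<close> matters. With about \<open>m\<close> blocks per unit of
  time and \<open>h\<close> proportional to \<open>1 / m\<close>, a union bound over the blocks is
  of order \<open>1 / m\<close>; second moments would leave it of order 1.\<close>

lemma walk_block_max:
  assumes "0 < a"
  shows "measure step_space {\<xi>. \<exists>j\<le>h. a \<le> \<bar>real_of_int (walk \<xi> (i + j) - walk \<xi> i)\<bar>}
    \<le> 3 * (real h)\<^sup>2 / a ^ 4"
proof -
  have "measure step_space {\<xi>. \<exists>j\<le>h. a \<le> \<bar>real_of_int (walk \<xi> (i + j) - walk \<xi> i)\<bar>}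
      = measure step_space {\<xi>. \<exists>j\<le>h. a \<le> \<bar>0 + real_of_int (walk \<xi> j)\<bar>}"
    using shift_prob[OF walk_max_pred[of h a 0], of i] by (simp add: walk_shift)
  also have "\<dots> \<le> 3 * (real h)\<^sup>2 / a ^ 4"
    using walk_max_fourth_moment[OF assms, of h 0] assms by (simp add: field_simps)
  finally show ?thesis .
qed

section \<open>Block increments of the walk and of Brownian motion\<close>

lemma indep_vars_PiM_coordinates:
  assumes M: "\<And>i. i \<in> I \<Longrightarrow> prob_space (M i)" and I: "I \<noteq> {}"
  shows "prob_space.indep_vars (Pi\<^sub>M I M) M (\<lambda>i x. x i) I"
proof -
  interpret prob_space "Pi\<^sub>M I M" by (rule prob_space_PiM[OF M])
  show ?thesis
  proof (subst indep_vars_iff_distr_eq_PiM'[OF I])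
    have "distr (Pi\<^sub>M I M) (Pi\<^sub>M I M) (\<lambda>x. \<lambda>i\<in>I. x i) = distr (Pi\<^sub>M I M) (Pi\<^sub>M I M) (\<lambda>x. x)"
      by (rule distr_cong) (auto simp: space_PiM)
    also have "\<dots> = Pi\<^sub>M I M" by (rule distr_id)
    also have "\<dots> = Pi\<^sub>M I (\<lambda>i. distr (Pi\<^sub>M I M) (M i) (\<lambda>x. x i))"
    proof (rule PiM_cong[OF refl])
      show "M i = distr (Pi\<^sub>M I M) (M i) (\<lambda>x. x i)" if "i \<in> I" for i
        by (rule distr_PiM_component[OF M that, symmetric])
    qed
    finally show "distr (Pi\<^sub>M I M) (Pi\<^sub>M I M) (\<lambda>x. \<lambda>i\<in>I. x i) = Pi\<^sub>M I (\<lambda>i. distr (Pi\<^sub>M I M) (M i) (\<lambda>x. x i))" .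
  qed simp
qed

abbreviation coin :: "int measure" where "coin \<equiv> measure_pmf (pmf_of_set {-1, 1})"

lemma distr_step: "distr step_space coin (\<lambda>\<xi>. \<xi> k) = coin"
  using distr_PiM_component[of UNIV "\<lambda>_. coin" k] by (simp add: prob_space_measure_pmf)

lemma indep_steps: "steps.P.indep_vars (\<lambda>_. coin) (\<lambda>k \<xi>. \<xi> k) UNIV"
  by (rule indep_vars_PiM_coordinates) (simp_all add: prob_space_measure_pmf)

lemma step_integral: "(\<integral>\<xi>. g (\<xi> k) \<partial>step_space) = (g (-1) + g 1) / (2 :: real)"
proof -
  have "(\<integral>\<xi>. g (\<xi> k) \<partial>step_space) = (\<integral>s. g s \<partial>distr step_space coin (\<lambda>\<xi>. \<xi> k))"
    by (subst integral_distr) auto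
  also have "\<dots> = (g (-1) + g 1) / 2"
    unfolding distr_step by (subst integral_pmf_of_set) auto
  finally show ?thesis .
qed

lemma walk_clt:
  "weak_conv_m (\<lambda>n. distr step_space borel (\<lambda>\<xi>. real_of_int (walk \<xi> n) / sqrt (real n))) std_normal_distribution"
proof -
  let ?X = "\<lambda>i \<xi>. real_of_int (\<xi> i)"
  have "weak_conv_m (\<lambda>n. distr step_space borel (\<lambda>\<xi>. (\<Sum>i<n. ?X i \<xi>) / sqrt (real n * 1\<^sup>2))) std_normal_distribution"
  proof (rule steps.P.central_limit_theorem_zero_mean)
    show "steps.P.indep_vars (\<lambda>_. borel) ?X UNIV"
      by (rule steps.P.indep_vars_compose2[OF indep_steps]) simp
    show "steps.P.expectation (?X n) = 0" for n
      using step_integral[of real_of_int n] by simp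
    then show "steps.P.variance (?X n) = 1\<^sup>2" for n
      using step_integral[of "\<lambda>x. (real_of_int x)\<^sup>2" n] by simp
    show "integrable step_space (\<lambda>\<xi>. (?X n \<xi>)\<^sup>2)" for n
    proof (rule steps.P.integrable_const_bound[of _ 1])
      show "AE \<xi> in step_space. norm ((?X n \<xi>)\<^sup>2) \<le> 1"
        using steps_AE
      proof eventually_elim
        case (elim \<xi>)
        then have "\<xi> n = -1 \<or> \<xi> n = 1" by blast
        then show ?case by auto
      qed
    qed measurable
    show "distr step_space borel (?X n) = distr coin borel real_of_int" for n
      by (subst distr_step[of n, symmetric], subst distr_distr) (auto simp: comp_def)
  qed simp
  then show ?thesis by (simp add: walk_def)
qed

lemma walk_increment_distr:
  "distr step_space borel (\<lambda>\<xi>. c * real_of_int (walk \<xi> (i + h) - walk \<xi> i))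
    = distr step_space borel (\<lambda>\<xi>. c * real_of_int (walk \<xi> h))"
proof -
  have m: "(\<lambda>\<xi>. c * real_of_int (walk \<xi> h)) \<in> borel_measurable step_space"
    by measurable
  have "distr step_space borel (\<lambda>\<xi>. c * real_of_int (walk \<xi> h))
      = distr (distr step_space step_space (\<lambda>\<xi> n. \<xi> (i + n))) borel (\<lambda>\<xi>. c * real_of_int (walk \<xi> h))"
    by (simp only: shift_steps)
  also have "\<dots> = distr step_space borel (\<lambda>\<xi>. c * real_of_int (walk \<xi> (i + h) - walk \<xi> i))"
    by (subst distr_distr[OF m shift_measurable]) (simp add: comp_def walk_shift)
  finally show ?thesis by simp
qed

lemma walk_increment_sum: "walk \<xi> (i + h) - walk \<xi> i = (\<Sum>k\<in>{i..<i+h}. \<xi> k)"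
proof (induction h)
  case (Suc h)
  then show ?case by (simp add: walk_Suc)
qed simp

lemma indep_blocks:
  "steps.P.indep_vars (\<lambda>_. borel) (\<lambda>j \<xi>. c * real_of_int (walk \<xi> (j * h + h) - walk \<xi> (j * h))) {..<J}"
proof -
  define K where "K j = {j * h..<j * h + h}" for j
  have dis: "disjoint_family_on K {..<J}"
    unfolding disjoint_family_on_def
  proof (intro ballI impI)
    fix i j :: nat assume "i \<noteq> j"
    have *: "K i \<inter> K j = {}" if "i < j" for i j
    proof -
      have "i * h + h \<le> j * h" using that mult_le_mono1[of "Suc i" j h] by simp
      then show ?thesis by (auto simp: K_def)
    qed
    show "K i \<inter> K j = {}" using \<open>i \<noteq> j\<close> *[of i j] *[of j i] by (cases "i < j") auto
  qed
  have "steps.P.indep_vars (\<lambda>j. Pi\<^sub>M (K j) (\<lambda>_. coin)) (\<lambda>j \<xi>. restrict (\<lambda>i. \<xi> i) (K j)) {..<J}"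
    by (rule steps.P.indep_vars_restrict[OF indep_steps]) (auto intro: dis)
  moreover have "(\<lambda>v. c * (\<Sum>k\<in>K j. real_of_int (v k))) \<in> borel_measurable (Pi\<^sub>M (K j) (\<lambda>_. coin))" for j
    by (intro borel_measurable_times borel_measurable_const borel_measurable_sum
        measurable_compose[OF measurable_component_singleton]) auto
  ultimately have "steps.P.indep_vars (\<lambda>_. borel) (\<lambda>j \<xi>. c * (\<Sum>k\<in>K j. real_of_int (restrict \<xi> (K j) k))) {..<J}"
    by (rule steps.P.indep_vars_compose2)
  moreover have "(\<Sum>k\<in>K j. real_of_int (restrict \<xi> (K j) k)) = real_of_int (walk \<xi> (j * h + h) - walk \<xi> (j * h))" for j \<xi>
    unfolding walk_increment_sum K_def of_int_sum by (intro sum.cong) auto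
  ultimately show ?thesis by simp
qed

lemma integral_PiM_distr:
  fixes f :: "'a \<Rightarrow> real" and \<Phi> :: "('i \<Rightarrow> real) \<Rightarrow> real"
  assumes A: "prob_space A" and f: "f \<in> borel_measurable A" and I: "finite I"
    and \<Phi>: "\<Phi> \<in> borel_measurable (Pi\<^sub>M I (\<lambda>_. borel))"
  shows "(\<integral>u. \<Phi> u \<partial>Pi\<^sub>M I (\<lambda>_. distr A borel f)) = (\<integral>x. \<Phi> (\<lambda>j\<in>I. f (x j)) \<partial>Pi\<^sub>M I (\<lambda>_. A))"
proof -
  let ?D = "distr A borel f"
  have fD: "f \<in> measurable A ?D" using f by simp
  have s: "sets (Pi\<^sub>M I (\<lambda>_. ?D)) = sets (Pi\<^sub>M I (\<lambda>_. borel))" by (intro sets_PiM_cong) auto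
  have "distr (Pi\<^sub>M I (\<lambda>_. A)) (Pi\<^sub>M I (\<lambda>_. ?D)) (compose I f) = Pi\<^sub>M I (\<lambda>_. distr A ?D f)"
    by (rule distr_PiM_finite_prob_space') (auto intro: I A prob_space.prob_space_distr f fD)
  also have "distr A ?D f = ?D" by (intro distr_cong) auto
  finally have D: "Pi\<^sub>M I (\<lambda>_. ?D) = distr (Pi\<^sub>M I (\<lambda>_. A)) (Pi\<^sub>M I (\<lambda>_. ?D)) (compose I f)" by simp
  have c: "compose I f \<in> measurable (Pi\<^sub>M I (\<lambda>_. A)) (Pi\<^sub>M I (\<lambda>_. ?D))"
    unfolding compose_def using f by (intro measurable_restrict) auto
  have "(\<integral>u. \<Phi> u \<partial>Pi\<^sub>M I (\<lambda>_. ?D)) = (\<integral>u. \<Phi> u \<partial>distr (Pi\<^sub>M I (\<lambda>_. A)) (Pi\<^sub>M I (\<lambda>_. ?D)) (compose I f))"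
    using D by simp
  also have "\<dots> = (\<integral>x. \<Phi> (compose I f x) \<partial>Pi\<^sub>M I (\<lambda>_. A))"
    by (rule integral_distr[OF c]) (use \<Phi> measurable_cong_sets[OF s refl] in auto)
  finally show ?thesis by (simp add: compose_def)
qed

text \<open>Takes the place of a multivariate central limit theorem: the blocks are independent and
  equally distributed, so almost sure convergence for one block lifts to the \<open>J\<close>-fold
  product space, where dominated convergence applies.\<close>

lemma block_increments_converge:
  fixes h :: "nat \<Rightarrow> nat" and e :: "nat \<Rightarrow> real" and \<Phi> :: "(nat \<Rightarrow> real) \<Rightarrow> real"
  assumes h: "filterlim h at_top sequentially" and c: "(\<lambda>n. e n * sqrt (real (h n))) \<longlonglongrightarrow> c" "0 < c"
    and J: "0 < J"
    and \<Phi>m: "\<Phi> \<in> borel_measurable (Pi\<^sub>M {..<J} (\<lambda>_. borel))"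
    and \<Phi>b: "\<And>u. \<bar>\<Phi> u\<bar> \<le> K"
    and \<Phi>c: "\<And>u w. (\<And>j. j < J \<Longrightarrow> (\<lambda>n. u n j) \<longlonglongrightarrow> w j) \<Longrightarrow> (\<lambda>n. \<Phi> (u n)) \<longlonglongrightarrow> \<Phi> w"
  shows "(\<lambda>n. \<integral>\<xi>. \<Phi> (\<lambda>j\<in>{..<J}. e n * real_of_int (walk \<xi> (j * h n + h n) - walk \<xi> (j * h n))) \<partial>step_space)
    \<longlonglongrightarrow> (\<integral>u. \<Phi> u \<partial>Pi\<^sub>M {..<J} (\<lambda>_. density lborel (normal_density 0 c)))"
proof -
  define \<mu> where "\<mu> n = distr step_space borel (\<lambda>\<xi>. real_of_int (walk \<xi> n) / sqrt (real n))" for n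
  have rd: "real_distribution (\<mu> n)" for n
    unfolding \<mu>_def by (rule steps.P.real_distribution_distr) measurable
  have "weak_conv_m (\<lambda>n. \<mu> (h n)) std_normal_distribution"
    using walk_clt filterlim_compose[OF _ h] unfolding weak_conv_m_def weak_conv_def \<mu>_def by blast
  \<comment> \<open>Representation of a single normalised block; the independent copies are the
    coordinates of \<open>?P\<close>.\<close>
  from Skorohod[OF rd real_dist_normal_dist this]
  obtain A :: "real measure" and Zs :: "nat \<Rightarrow> real \<Rightarrow> real" and Z where
    A: "prob_space A" and Zs: "\<And>n. Zs n \<in> borel_measurable A" "\<And>n. distr A borel (Zs n) = \<mu> (h n)"
    and Z: "Z \<in> measurable A lborel" "distr A borel Z = std_normal_distribution"
    and lim: "\<And>x. x \<in> space A \<Longrightarrow> (\<lambda>n. Zs n x) \<longlonglongrightarrow> Z x" by blast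
  interpret A: prob_space A by (rule A)
  have Zm[measurable]: "Z \<in> borel_measurable A" using Z(1) by simp
  note Zs(1)[measurable]
  let ?X = "\<lambda>n j \<xi>. e n * real_of_int (walk \<xi> (j * h n + h n) - walk \<xi> (j * h n))"
  let ?f = "\<lambda>n x. e n * sqrt (real (h n)) * Zs n x"
  let ?P = "Pi\<^sub>M {..<J} (\<lambda>_. A)"
  interpret P: prob_space ?P by (intro prob_space_PiM A)
  \<comment> \<open>Blocks of length 0 are excluded because \<open>sqrt (real (h n))\<close> is
    cancelled; they occur for finitely many \<open>n\<close> only.\<close>
  have one: "distr step_space borel (?X n j) = distr A borel (?f n)" if hn: "0 < h n" for n j
  proof -
    have "distr A borel (?f n) = distr (distr A borel (Zs n)) borel (\<lambda>z. e n * sqrt (real (h n)) * z)"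
      by (subst distr_distr) (auto simp: comp_def)
    also have "\<dots> = distr step_space borel (\<lambda>\<xi>. e n * sqrt (real (h n)) * (real_of_int (walk \<xi> (h n)) / sqrt (real (h n))))"
      unfolding Zs(2) \<mu>_def by (subst distr_distr) (auto simp: comp_def)
    also have "\<dots> = distr step_space borel (\<lambda>\<xi>. e n * real_of_int (walk \<xi> (h n)))"
      using hn by simp
    finally show ?thesis unfolding walk_increment_distr by simp
  qed
  have Xm: "?X n j \<in> borel_measurable step_space" for n j
    unfolding of_int_diff
    by (intro borel_measurable_times borel_measurable_const borel_measurable_diff
        measurable_compose[OF walk_measurable]) auto
  have eq: "(\<integral>\<xi>. \<Phi> (\<lambda>j\<in>{..<J}. ?X n j \<xi>) \<partial>step_space) = (\<integral>x. \<Phi> (\<lambda>j\<in>{..<J}. ?f n (x j)) \<partial>?P)"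
    if hn: "0 < h n" for n
  proof -
    have "(\<integral>\<xi>. \<Phi> (\<lambda>j\<in>{..<J}. ?X n j \<xi>) \<partial>step_space)
        = (\<integral>u. \<Phi> u \<partial>distr step_space (Pi\<^sub>M {..<J} (\<lambda>_. borel)) (\<lambda>\<xi>. \<lambda>j\<in>{..<J}. ?X n j \<xi>))"
      using Xm by (intro integral_distr[symmetric] \<Phi>m measurable_restrict) auto
    also have "distr step_space (Pi\<^sub>M {..<J} (\<lambda>_. borel)) (\<lambda>\<xi>. \<lambda>j\<in>{..<J}. ?X n j \<xi>)
        = Pi\<^sub>M {..<J} (\<lambda>j. distr step_space borel (?X n j))"
      using steps.P.indep_vars_iff_distr_eq_PiM'[where I="{..<J}" and M'="\<lambda>_. borel" and X="?X n"] J Xm indep_blocks[of "e n" "h n" J]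
      by auto
    also have "\<dots> = Pi\<^sub>M {..<J} (\<lambda>_. distr A borel (?f n))" by (simp only: one[OF hn])
    also have "(\<integral>u. \<Phi> u \<partial>\<dots>) = (\<integral>x. \<Phi> (\<lambda>j\<in>{..<J}. ?f n (x j)) \<partial>?P)"
      by (rule integral_PiM_distr[OF A _ _ \<Phi>m]) auto
    finally show ?thesis .
  qed
  have "(\<lambda>n. \<integral>x. \<Phi> (\<lambda>j\<in>{..<J}. ?f n (x j)) \<partial>?P) \<longlonglongrightarrow> (\<integral>x. \<Phi> (\<lambda>j\<in>{..<J}. c * Z (x j)) \<partial>?P)"
  proof (rule integral_dominated_convergence[where w="\<lambda>_. K"])
    have "(\<lambda>x. \<lambda>j\<in>{..<J}. g (x j)) \<in> measurable ?P (Pi\<^sub>M {..<J} (\<lambda>_. borel))"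
      if "g \<in> borel_measurable A" for g :: "real \<Rightarrow> real"
      using that by (intro measurable_restrict measurable_compose[OF measurable_component_singleton]) auto
    note M = measurable_compose[OF this \<Phi>m]
    show "(\<lambda>x. \<Phi> (\<lambda>j\<in>{..<J}. c * Z (x j))) \<in> borel_measurable ?P" by (rule M) measurable
    show "(\<lambda>x. \<Phi> (\<lambda>j\<in>{..<J}. ?f n (x j))) \<in> borel_measurable ?P" for n by (rule M) measurable
    show "AE x in ?P. (\<lambda>n. \<Phi> (\<lambda>j\<in>{..<J}. ?f n (x j))) \<longlonglongrightarrow> \<Phi> (\<lambda>j\<in>{..<J}. c * Z (x j))"
    proof (rule AE_I2, rule \<Phi>c)
      fix x j assume x: "x \<in> space ?P" "j < J"
      then have "x j \<in> space A" by (auto simp: space_PiM)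
      then show "(\<lambda>n. (\<lambda>j\<in>{..<J}. ?f n (x j)) j) \<longlonglongrightarrow> (\<lambda>j\<in>{..<J}. c * Z (x j)) j"
        using x(2) tendsto_mult[OF c(1) lim] by simp
    qed
    show "AE x in ?P. norm (\<Phi> (\<lambda>j\<in>{..<J}. ?f n (x j))) \<le> K" for n using \<Phi>b by simp
  qed simp
  also have "(\<integral>x. \<Phi> (\<lambda>j\<in>{..<J}. c * Z (x j)) \<partial>?P) = (\<integral>u. \<Phi> u \<partial>Pi\<^sub>M {..<J} (\<lambda>_. distr A borel (\<lambda>x. c * Z x)))"
    by (rule integral_PiM_distr[OF A _ _ \<Phi>m, symmetric]) auto
  also have "distr A borel (\<lambda>x. c * Z x) = density lborel (normal_density 0 c)"
  proof -
    have "distr A lborel Z = std_normal_distribution"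
      using Z(2) by (simp cong: distr_cong)
    then have "distributed A lborel Z std_normal_density"
      unfolding distributed_def using Z(1) by auto
    from A.normal_density_affine[OF this, of c 0] c(2)
    have "distributed A lborel (\<lambda>x. c * Z x) (normal_density 0 c)" by simp
    then have "distr A lborel (\<lambda>x. c * Z x) = density lborel (normal_density 0 c)"
      by (rule distributed_distr_eq_density)
    then show ?thesis by (simp cong: distr_cong)
  qed
  finally have "(\<lambda>n. \<integral>x. \<Phi> (\<lambda>j\<in>{..<J}. ?f n (x j)) \<partial>?P)
    \<longlonglongrightarrow> (\<integral>u. \<Phi> u \<partial>Pi\<^sub>M {..<J} (\<lambda>_. density lborel (normal_density 0 c)))" .
  moreover have "\<forall>\<^sub>F n in sequentially. 0 < h n"
    using h eventually_compose_filterlim[OF eventually_gt_at_top[of 0] h] by simp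
  ultimately show ?thesis
    by (rule Lim_transform_eventually[OF _ eventually_mono]) (simp only: eq)
qed

lemma brownian_block_integral:
  fixes \<Phi> :: "(nat \<Rightarrow> real) \<Rightarrow> real"
  assumes B: "standard_brownian_motion N B" and m: "0 < m" and J: "0 < J"
    and \<Phi>m: "\<Phi> \<in> borel_measurable (Pi\<^sub>M {..<J} (\<lambda>_. borel))"
  shows "(\<integral>w. \<Phi> (\<lambda>j\<in>{..<J}. B (real (Suc j) / real m) w - B (real j / real m) w) \<partial>N)
    = (\<integral>u. \<Phi> u \<partial>Pi\<^sub>M {..<J} (\<lambda>_. density lborel (normal_density 0 (sqrt (1 / real m)))))"
proof -
  interpret N: prob_space N using B by (simp add: standard_brownian_motion_def)
  let ?X = "\<lambda>j w. B (real (Suc j) / real m) w - B (real j / real m) w"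
  have Bm: "B t \<in> borel_measurable N" if "0 \<le> t" for t
    using B that by (simp add: standard_brownian_motion_def)
  have Xm: "?X j \<in> borel_measurable N" for j by (intro borel_measurable_diff Bm) auto
  have t: "0 \<le> real 0 / real m" "mono (\<lambda>j. real j / real m)"
    by (auto simp: mono_def divide_right_mono)
  have ind: "N.indep_vars (\<lambda>_. borel) ?X {..<J}"
  proof -
    have "\<forall>n (t :: nat \<Rightarrow> real). 0 \<le> t 0 \<and> mono t \<longrightarrow>
        prob_space.indep_vars N (\<lambda>_. borel) (\<lambda>k \<omega>. B (t (Suc k)) \<omega> - B (t k) \<omega>) {..<n}"
      using B by (simp add: standard_brownian_motion_def)
    from this[rule_format, of "\<lambda>j. real j / real m" J] t show ?thesis by simp
  qed
  have law: "distr N borel (?X j) = density lborel (normal_density 0 (sqrt (1 / real m)))" for j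
  proof -
    have "\<forall>s t. 0 \<le> s \<and> s < t \<longrightarrow>
        distributed N lborel (\<lambda>\<omega>. B t \<omega> - B s \<omega>) (normal_density 0 (sqrt (t - s)))"
      using B by (simp add: standard_brownian_motion_def)
    from this[rule_format, of "real j / real m" "real (Suc j) / real m"] m
    have "distributed N lborel (?X j) (normal_density 0 (sqrt (real (Suc j) / real m - real j / real m)))"
      by (simp add: divide_strict_right_mono)
    moreover have "real (Suc j) / real m - real j / real m = 1 / real m"
      by (simp add: diff_divide_distrib[symmetric])
    ultimately have "distributed N lborel (?X j) (normal_density 0 (sqrt (1 / real m)))" by simp
    then have "distr N lborel (?X j) = density lborel (normal_density 0 (sqrt (1 / real m)))"
      by (rule distributed_distr_eq_density)
    moreover have "distr N borel (?X j) = distr N lborel (?X j)" by (rule distr_cong) auto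
    ultimately show ?thesis by simp
  qed
  have "(\<integral>w. \<Phi> (\<lambda>j\<in>{..<J}. ?X j w) \<partial>N)
      = (\<integral>u. \<Phi> u \<partial>distr N (Pi\<^sub>M {..<J} (\<lambda>_. borel)) (\<lambda>w. \<lambda>j\<in>{..<J}. ?X j w))"
    using Xm by (intro integral_distr[symmetric] \<Phi>m measurable_restrict) auto
  also have "distr N (Pi\<^sub>M {..<J} (\<lambda>_. borel)) (\<lambda>w. \<lambda>j\<in>{..<J}. ?X j w) = Pi\<^sub>M {..<J} (\<lambda>j. distr N borel (?X j))"
    using N.indep_vars_iff_distr_eq_PiM'[where I="{..<J}" and M'="\<lambda>_. borel" and X="?X"] J Xm ind by auto
  finally show ?thesis by (simp only: law)
qed

section \<open>A maximal inequality for averages\<close>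

text \<open>Cover the starting points of intervals on which the average of \<open>a\<close> exceeds \<open>c\<close> greedily,
  from left to right, by disjoint such intervals.\<close>

lemma card_large_average_le:
  fixes a :: "nat \<Rightarrow> ennreal" and c :: ennreal
  assumes "m \<le> N"
  shows "c * of_nat (card {i\<in>{m..<N}. \<exists>r\<in>{1..R}. c * of_nat r < (\<Sum>k<r. a (i + k))}) \<le> (\<Sum>k\<in>{m..<N+R}. a k)"
  using assms
proof (induction "N - m" arbitrary: m rule: less_induct)
  case less
  define S where "S m = {i\<in>{m..<N}. \<exists>r\<in>{1..R}. c * of_nat r < (\<Sum>k<r. a (i + k))}" for m
  have fin: "finite (S m)" for m by (simp add: S_def)
  have IH: "c * of_nat (card (S m')) \<le> (\<Sum>k\<in>{m'..<N+R}. a k)" if "m < m'" "m' \<le> N" for m'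
    using less.hyps[of m'] that by (simp add: S_def)
  have "c * of_nat (card (S m)) \<le> (\<Sum>k\<in>{m..<N+R}. a k)"
  proof (cases "m \<in> S m")
    case False
    show ?thesis
    proof (cases "m = N")
      case True
      then show ?thesis by (simp add: S_def)
    next
      case mN: False
      have "S m = S (Suc m)" using False by (auto simp: S_def le_Suc_eq Suc_le_eq order_le_less)
      then have "c * of_nat (card (S m)) \<le> (\<Sum>k\<in>{Suc m..<N+R}. a k)"
        using IH[of "Suc m"] mN less.prems by simp
      also have "\<dots> \<le> (\<Sum>k\<in>{m..<N+R}. a k)" by (intro sum_mono2) auto
      finally show ?thesis .
    qed
  next
    case True
    then obtain r where r: "1 \<le> r" "r \<le> R" "c * of_nat r < (\<Sum>k<r. a (m + k))" and mN: "m < N"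
      by (auto simp: S_def)
    have shift: "(\<Sum>k<r. a (m + k)) = (\<Sum>k\<in>{m..<m+r}. a k)"
      by (rule sum.reindex_bij_witness[of _ "\<lambda>k. k - m" "\<lambda>k. m + k"]) auto
    show ?thesis
    proof (cases "m + r \<le> N")
      case True
      have "S m \<subseteq> {m..<m+r} \<union> S (m + r)" by (auto simp: S_def)
      then have "card (S m) \<le> card ({m..<m+r} \<union> S (m + r))"
        by (intro card_mono finite_UnI fin) auto
      also have "\<dots> \<le> r + card (S (m + r))"
        using card_Un_le[of "{m..<m+r}" "S (m + r)"] by simp
      finally have "c * of_nat (card (S m)) \<le> c * of_nat (r + card (S (m + r)))"
        by (intro mult_left_mono of_nat_mono) auto
      also have "\<dots> = c * of_nat r + c * of_nat (card (S (m + r)))" by (simp add: distrib_left)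
      also have "\<dots> \<le> (\<Sum>k\<in>{m..<m+r}. a k) + (\<Sum>k\<in>{m+r..<N+R}. a k)"
        using r(1,3) IH[of "m + r"] True unfolding shift by (intro add_mono) auto
      also have "\<dots> = (\<Sum>k\<in>{m..<N+R}. a k)" using True by (intro sum.atLeastLessThan_concat) auto
      finally show ?thesis .
    next
      case False
      \<comment> \<open>The chosen interval may reach beyond \<open>N\<close>, though not beyond
        \<open>N + R\<close>; this is why the sum on the right is extended by \<open>R\<close>
        terms.\<close>
      have "card (S m) \<le> card {m..<N}" by (intro card_mono) (auto simp: S_def)
      then have "c * of_nat (card (S m)) \<le> c * of_nat r"
        using False by (intro mult_left_mono of_nat_mono) auto
      also have "\<dots> \<le> (\<Sum>k\<in>{m..<m+r}. a k)" using r(3) unfolding shift by simp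
      also have "\<dots> \<le> (\<Sum>k\<in>{m..<N+R}. a k)" using r mN by (intro sum_mono2) auto
      finally show ?thesis .
    qed
  qed
  then show ?case by (simp add: S_def)
qed

text \<open>The maximal ergodic inequality by transference: \<open>card_large_average_le\<close> is
  integrated over \<open>N\<close> starting points, all of which have the same probability of being
  bad.\<close>

lemma (in prob_space) iid_maximal_inequality:
  fixes X :: "nat \<Rightarrow> 'a \<Rightarrow> ennreal"
  assumes ind: "indep_vars (\<lambda>_. borel) X UNIV"
    and law: "\<And>i. distr M borel (X i) = D" and mean: "\<And>i. (\<integral>\<^sup>+\<omega>. X i \<omega> \<partial>M) = ennreal d"
    and d: "0 \<le> d" and c: "0 < c"
  shows "c * prob {\<omega>\<in>space M. \<exists>r\<ge>1. ennreal c * of_nat r < (\<Sum>k<r. X k \<omega>)} \<le> d"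
proof -
  have Xm[measurable]: "X i \<in> borel_measurable M" for i
    using ind by (auto simp: indep_vars_def)
  define bad where "bad R i = {\<omega>\<in>space M. \<exists>r\<in>{1..R}. ennreal c * of_nat r < (\<Sum>k<r. X (i + k) \<omega>)}" for R i :: nat
  have bad_sets[measurable]: "bad R i \<in> sets M" for R i unfolding bad_def by measurable
  \<comment> \<open>Stationarity: whatever \<open>i\<close> is, the \<open>R\<close> variables from
    \<open>X i\<close> on have the same product law.\<close>
  have shift: "prob (bad R i) = prob (bad R 0)" for R i
  proof (cases "R = 0")
    case False
    define A where "A = {v \<in> space (Pi\<^sub>M {..<R} (\<lambda>_. borel :: ennreal measure)).
        \<exists>r\<in>{1..R}. ennreal c * of_nat r < (\<Sum>k<r. v k)}"
    have A: "A \<in> sets (Pi\<^sub>M {..<R} (\<lambda>_. borel))"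
    proof -
      have "(\<lambda>v. \<Sum>k<r. v k) \<in> borel_measurable (Pi\<^sub>M {..<R} (\<lambda>_. borel :: ennreal measure))" if "r \<in> {1..R}" for r
        using that by (intro borel_measurable_sum measurable_component_singleton) auto
      then show ?thesis unfolding A_def
        by (intro sets.sets_Collect_finite_Ex borel_measurable_less) auto
    qed
    have "prob (bad R i) = measure (Pi\<^sub>M {..<R} (\<lambda>_. D)) A" for i
    proof -
      have "indep_vars (\<lambda>k. borel) (\<lambda>k. X (i + k)) {..<R}"
      proof (subst indep_vars_iff_distr_eq_PiM')
        have sub: "indep_vars (\<lambda>_. borel) X {i..<i+R}" by (rule indep_vars_subset[OF ind]) simp
        have nat: "{i..<i+R} \<noteq> {}" using False by simp
        let ?r = "\<lambda>v :: nat \<Rightarrow> ennreal. \<lambda>k\<in>{..<R}. v (i + k)"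
        have D: "prob_space D" unfolding law[of 0, symmetric] by (rule prob_space_distr) simp
        have sD: "sets (Pi\<^sub>M I (\<lambda>_. D)) = sets (Pi\<^sub>M I (\<lambda>_. borel))" for I :: "nat set"
          unfolding law[of 0, symmetric] by (intro sets_PiM_cong) auto
        have rm: "?r \<in> measurable (Pi\<^sub>M {i..<i+R} (\<lambda>_. borel)) (Pi\<^sub>M {..<R} (\<lambda>_. borel))"
          by (intro measurable_restrict measurable_component_singleton) auto
        have "distr M (Pi\<^sub>M {..<R} (\<lambda>_. borel)) (\<lambda>\<omega>. \<lambda>k\<in>{..<R}. X (i + k) \<omega>)
            = distr (distr M (Pi\<^sub>M {i..<i+R} (\<lambda>_. borel)) (\<lambda>\<omega>. \<lambda>k\<in>{i..<i+R}. X k \<omega>)) (Pi\<^sub>M {..<R} (\<lambda>_. borel)) ?r"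
        proof (subst distr_distr[OF rm])
          show "(\<lambda>\<omega>. \<lambda>k\<in>{i..<i+R}. X k \<omega>) \<in> measurable M (Pi\<^sub>M {i..<i+R} (\<lambda>_. borel))"
            by (intro measurable_restrict Xm)
        qed (intro distr_cong; auto simp: comp_def restrict_def fun_eq_iff)
        also have "distr M (Pi\<^sub>M {i..<i+R} (\<lambda>_. borel)) (\<lambda>\<omega>. \<lambda>k\<in>{i..<i+R}. X k \<omega>) = Pi\<^sub>M {i..<i+R} (\<lambda>_. D)"
          using indep_vars_iff_distr_eq_PiM'[where I="{i..<i+R}" and M'="\<lambda>_. borel" and X=X] sub nat by (simp add: law)
        also have "distr (Pi\<^sub>M {i..<i+R} (\<lambda>_. D)) (Pi\<^sub>M {..<R} (\<lambda>_. borel)) ?r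
            = distr (Pi\<^sub>M {i..<i+R} (\<lambda>_. D)) (Pi\<^sub>M {..<R} (\<lambda>_. D)) ?r"
          by (rule distr_cong) (auto simp: sD)
        also have "\<dots> = Pi\<^sub>M {..<R} (\<lambda>_. D)"
          by (rule distr_PiM_reindex[where M="\<lambda>_. D" and f="\<lambda>k. i + k"]) (auto intro: D)
        finally show "distr M (Pi\<^sub>M {..<R} (\<lambda>_. borel)) (\<lambda>\<omega>. \<lambda>k\<in>{..<R}. X (i + k) \<omega>)
            = Pi\<^sub>M {..<R} (\<lambda>k. distr M borel (X (i + k)))" by (simp only: law)
      qed (use False in auto)
      then have "distr M (Pi\<^sub>M {..<R} (\<lambda>_. borel)) (\<lambda>\<omega>. \<lambda>k\<in>{..<R}. X (i + k) \<omega>) = Pi\<^sub>M {..<R} (\<lambda>_. D)"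
        using indep_vars_iff_distr_eq_PiM'[where I="{..<R}" and M'="\<lambda>_. borel" and X="\<lambda>k. X (i + k)"] False by (auto simp: law)
      then have "measure (Pi\<^sub>M {..<R} (\<lambda>_. D)) A
          = measure (distr M (Pi\<^sub>M {..<R} (\<lambda>_. borel)) (\<lambda>\<omega>. \<lambda>k\<in>{..<R}. X (i + k) \<omega>)) A" by simp
      also have "\<dots> = prob ((\<lambda>\<omega>. \<lambda>k\<in>{..<R}. X (i + k) \<omega>) -` A \<inter> space M)"
        by (rule measure_distr[OF _ A]) (intro measurable_restrict, auto)
      also have "(\<lambda>\<omega>. \<lambda>k\<in>{..<R}. X (i + k) \<omega>) -` A \<inter> space M = bad R i"
      proof -
        have "(\<Sum>k<r. (\<lambda>k\<in>{..<R}. X (i + k) \<omega>) k) = (\<Sum>k<r. X (i + k) \<omega>)" if "r \<in> {1..R}" for r \<omega>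
          using that by (intro sum.cong) auto
        then show ?thesis unfolding A_def bad_def by (auto simp: space_PiM)
      qed
      finally show ?thesis by simp
    qed
    then show ?thesis by simp
  qed (simp add: bad_def)
  have fin: "c * prob (bad R 0) \<le> d" for R
  proof (rule ccontr)
    assume "\<not> c * prob (bad R 0) \<le> d"
    then have pos: "0 < c * prob (bad R 0) - d" by simp
    \<comment> \<open>The boundary term on the right does not grow with \<open>N\<close>, whereas
      the left side would if the claim failed.\<close>
    have le: "real N * (c * prob (bad R 0) - d) \<le> real R * d" for N
    proof -
      have "(\<integral>\<^sup>+\<omega>. ennreal c * of_nat (card {i\<in>{0..<N}. \<omega> \<in> bad R i}) \<partial>M)
          = (\<integral>\<^sup>+\<omega>. ennreal c * (\<Sum>i<N. indicator (bad R i) \<omega>) \<partial>M)"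
      proof (intro nn_integral_cong arg_cong2[where f="(*)"] refl)
        fix \<omega>
        have "{i\<in>{0..<N}. \<omega> \<in> bad R i} = {..<N} \<inter> {i. \<omega> \<in> bad R i}" by auto
        then show "of_nat (card {i\<in>{0..<N}. \<omega> \<in> bad R i}) = (\<Sum>i<N. indicator (bad R i) \<omega> :: ennreal)"
          by (simp add: indicator_def sum.If_cases)
      qed
      also have "\<dots> = ennreal c * (\<Sum>i<N. emeasure M (bad R i))"
        by (subst nn_integral_cmult) (auto simp: nn_integral_sum)
      also have "\<dots> = ennreal (c * (real N * prob (bad R 0)))"
      proof -
        have "emeasure M (bad R i) = ennreal (prob (bad R 0))" for i
          by (subst emeasure_eq_measure, subst shift, rule refl)
        then show ?thesis using c by (simp add: ennreal_mult ennreal_of_nat_eq_real_of_nat)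
      qed
      finally have L: "(\<integral>\<^sup>+\<omega>. ennreal c * of_nat (card {i\<in>{0..<N}. \<omega> \<in> bad R i}) \<partial>M) = ennreal (c * (real N * prob (bad R 0)))" .
      have "(\<integral>\<^sup>+\<omega>. ennreal c * of_nat (card {i\<in>{0..<N}. \<omega> \<in> bad R i}) \<partial>M) \<le> (\<integral>\<^sup>+\<omega>. (\<Sum>k\<in>{0..<N+R}. X k \<omega>) \<partial>M)"
      proof (rule nn_integral_mono)
        fix \<omega> assume "\<omega> \<in> space M"
        then show "ennreal c * of_nat (card {i\<in>{0..<N}. \<omega> \<in> bad R i}) \<le> (\<Sum>k\<in>{0..<N+R}. X k \<omega>)"
          using card_large_average_le[of 0 N "ennreal c" R "\<lambda>k. X k \<omega>"] by (simp add: bad_def)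
      qed
      also have "\<dots> = ennreal (real (N + R) * d)"
        using d by (simp add: nn_integral_sum mean ennreal_mult ennreal_of_nat_eq_real_of_nat)
      finally have "c * (real N * prob (bad R 0)) \<le> real (N + R) * d"
        unfolding L using d by (subst (asm) ennreal_le_iff) auto
      then show ?thesis by (simp add: algebra_simps)
    qed
    obtain N :: nat where "real R * d / (c * prob (bad R 0) - d) < real N" using reals_Archimedean2 by blast
    then have "real R * d < real N * (c * prob (bad R 0) - d)" using pos by (simp add: divide_less_eq)
    with le[of N] show False by simp
  qed
  have U: "{\<omega>\<in>space M. \<exists>r\<ge>1. ennreal c * of_nat r < (\<Sum>k<r. X k \<omega>)} = (\<Union>R. bad R 0)"
  proof (intro set_eqI iffI)
    fix \<omega> assume "\<omega> \<in> {\<omega>\<in>space M. \<exists>r\<ge>1. ennreal c * of_nat r < (\<Sum>k<r. X k \<omega>)}"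
    then obtain r where "\<omega> \<in> space M" "1 \<le> r" "ennreal c * of_nat r < (\<Sum>k<r. X k \<omega>)" by blast
    then have "\<omega> \<in> bad r 0" unfolding bad_def by (auto intro!: bexI[of _ r])
    then show "\<omega> \<in> (\<Union>R. bad R 0)" by blast
  next
    fix \<omega> assume "\<omega> \<in> (\<Union>R. bad R 0)"
    then show "\<omega> \<in> {\<omega>\<in>space M. \<exists>r\<ge>1. ennreal c * of_nat r < (\<Sum>k<r. X k \<omega>)}"
      unfolding bad_def by auto
  qed
  have "incseq (\<lambda>R. bad R 0)" by (intro monoI) (fastforce simp: bad_def)
  then have "(\<lambda>R. prob (bad R 0)) \<longlonglongrightarrow> prob (\<Union>R. bad R 0)"
    by (intro finite_Lim_measure_incseq) auto
  from tendsto_mult_left[OF this, of c] show ?thesis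
    unfolding U by (rule LIMSEQ_le_const2) (use fin in auto)
qed

section \<open>The landscape\<close>

lemma weak_topology_integral_measurable:
  assumes "continuous_map X euclideanreal g" "bounded (g ` topspace X)"
  shows "(\<lambda>\<nu>. \<integral>x. g x \<partial>\<nu>) \<in> borel_measurable (borel_of (weak_topology X))"
proof (rule borel_measurableI)
  fix U :: "real set" assume "open U"
  then have "openin (weak_topology X) {\<nu> \<in> prob_measures X. (\<integral>x. g x \<partial>\<nu>) \<in> U}"
    unfolding weak_topology_def using assms by (intro topology_generated_by_Basis) blast
  then have "{\<nu> \<in> prob_measures X. (\<integral>x. g x \<partial>\<nu>) \<in> U} \<in> sets (borel_of (weak_topology X))"
    by (rule sets_borel_of_open)
  moreover have "(\<lambda>\<nu>. \<integral>x. g x \<partial>\<nu>) -` U \<inter> space (borel_of (weak_topology X)) = {\<nu> \<in> prob_measures X. (\<integral>x. g x \<partial>\<nu>) \<in> U}"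
    by auto
  ultimately show "(\<lambda>\<nu>. \<integral>x. g x \<partial>\<nu>) -` U \<inter> space (borel_of (weak_topology X)) \<in> sets (borel_of (weak_topology X))"
    by simp
qed

section \<open>Truncated means and excesses of a trapping law\<close>

abbreviation trap_law :: "real measure \<Rightarrow> bool" where
  "trap_law \<nu> \<equiv> \<nu> \<in> prob_measures (top_of_set {0<..})"

lemma trap_law_prob_space: "trap_law \<nu> \<Longrightarrow> prob_space \<nu>"
  by (simp add: prob_measures_def)

lemma trap_law_space: "trap_law \<nu> \<Longrightarrow> space \<nu> = {0<..}"
  using sets_eq_imp_space_eq[of \<nu> "borel_of (top_of_set {0<..})"] by (simp add: prob_measures_def)

lemma trap_law_ident_measurable:
  assumes "trap_law \<nu>"
  shows "(\<lambda>x. x) \<in> borel_measurable \<nu>"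
proof (rule borel_measurableI)
  fix U :: "real set" assume "open U"
  then have "openin (top_of_set {0<..}) ({0<..} \<inter> U)" by (rule openin_open_Int)
  then show "(\<lambda>x. x) -` U \<inter> space \<nu> \<in> sets \<nu>"
    using sets_borel_of_open[of "top_of_set {0<..}"] assms trap_law_space[OF assms]
    by (simp add: prob_measures_def Int_commute)
qed

lemma trap_law_measurable:
  assumes "trap_law \<nu>" "g \<in> borel_measurable borel"
  shows "g \<in> borel_measurable \<nu>"
  using measurable_compose[OF trap_law_ident_measurable[OF assms(1)] assms(2)] by simp

text \<open>On the positive half-line \<open>min x K\<close> is bounded and continuous, unlike a
  sharp cut-off, so the weak topology makes this a continuous function of
  \<open>\<nu>\<close>.\<close>

definition trunc_mean :: "real \<Rightarrow> real measure \<Rightarrow> real" where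
  "trunc_mean K \<nu> = (\<integral>x. min x K \<partial>\<nu>)"

text \<open>\<open>ennreal\<close> sends negative reals to 0, so the integrand is the positive part
  of \<open>x - K\<close>.\<close>

definition excess :: "real \<Rightarrow> real measure \<Rightarrow> ennreal" where
  "excess K \<nu> = (\<integral>\<^sup>+x. ennreal (x - K) \<partial>\<nu>)"

lemma trap_law_integrable_bounded:
  assumes \<nu>: "trap_law \<nu>" and g: "g \<in> borel_measurable borel" and b: "\<And>x. 0 < x \<Longrightarrow> \<bar>g x\<bar> \<le> (C :: real)"
  shows "integrable \<nu> g"
proof -
  interpret prob_space \<nu> using \<nu> by (rule trap_law_prob_space)
  show ?thesis
    by (rule integrable_const_bound[of _ C]) (use trap_law_space[OF \<nu>] b trap_law_measurable[OF \<nu> g] in auto)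
qed

lemma trunc_integrable:
  assumes \<nu>: "trap_law \<nu>" and K: "0 \<le> K"
  shows "integrable \<nu> (\<lambda>x. min x K)"
proof (rule trap_law_integrable_bounded[OF \<nu>, of _ K])
  show "\<bar>min x K\<bar> \<le> K" if "0 < x" for x using that K by linarith
qed measurable

lemma trunc_mean_bounds:
  assumes \<nu>: "trap_law \<nu>" and K: "0 \<le> K"
  shows "0 \<le> trunc_mean K \<nu>" "trunc_mean K \<nu> \<le> K"
proof -
  interpret prob_space \<nu> using \<nu> by (rule trap_law_prob_space)
  show "0 \<le> trunc_mean K \<nu>" unfolding trunc_mean_def
  proof (rule integral_nonneg_AE, rule AE_I2)
    fix x assume "x \<in> space \<nu>"
    then have "0 < x" using trap_law_space[OF \<nu>] by simp
    then show "0 \<le> min x K" using K by simp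
  qed
  have "(\<integral>x. min x K \<partial>\<nu>) \<le> (\<integral>x. K \<partial>\<nu>)"
    by (rule integral_mono[OF trunc_integrable[OF \<nu> K]]) auto
  then show "trunc_mean K \<nu> \<le> K" by (simp add: trunc_mean_def prob_space)
qed

lemma trunc_mean_nn_integral:
  assumes \<nu>: "trap_law \<nu>" and K: "0 \<le> K"
  shows "(\<integral>\<^sup>+x. ennreal (min x K) \<partial>\<nu>) = ennreal (trunc_mean K \<nu>)"
  unfolding trunc_mean_def
proof (rule nn_integral_eq_integral)
  show "integrable \<nu> (\<lambda>x. min x K)" by (rule trunc_integrable[OF \<nu> K])
  show "AE x in \<nu>. 0 \<le> min x K" using trap_law_space[OF \<nu>] K by (intro AE_I2) auto
qed

lemma trap_mean_split:
  assumes \<nu>: "trap_law \<nu>" and K: "0 \<le> K"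
  shows "trap_mean \<nu> = ennreal (trunc_mean K \<nu>) + excess K \<nu>"
proof -
  have "trap_mean \<nu> = (\<integral>\<^sup>+x. ennreal (min x K) + ennreal (x - K) \<partial>\<nu>)"
    unfolding trap_mean_def
  proof (rule nn_integral_cong)
    fix x assume "x \<in> space \<nu>"
    then have "0 < x" using trap_law_space[OF \<nu>] by simp
    then show "ennreal x = ennreal (min x K) + ennreal (x - K)"
      using K by (cases "x \<le> K") (auto simp: min_def ennreal_neg ennreal_plus[symmetric] simp del: ennreal_plus)
  qed
  also have "\<dots> = (\<integral>\<^sup>+x. ennreal (min x K) \<partial>\<nu>) + excess K \<nu>"
    unfolding excess_def by (intro nn_integral_add trap_law_measurable[OF \<nu>]) auto
  finally show ?thesis by (simp add: trunc_mean_nn_integral[OF \<nu> K])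
qed

lemma trunc_mean_measurable:
  assumes "0 \<le> K"
  shows "trunc_mean K \<in> borel_measurable (borel_of trap_laws)"
proof -
  have "continuous_map (top_of_set {0<..}) euclideanreal (\<lambda>x. min x K)"
    by (simp, intro continuous_intros)
  moreover have "bounded ((\<lambda>x. min x K) ` topspace (top_of_set {0<..}))"
    unfolding bounded_iff using assms by (intro exI[of _ K]) auto
  ultimately show ?thesis
    unfolding trunc_mean_def[abs_def] by (rule weak_topology_integral_measurable)
qed

text \<open>Monotone convergence. The integrand of the mean is unbounded, so its measurability for
  the weak topology comes from this supremum; integrated over \<open>P\<close>, the same formula
  shows that truncation loses little.\<close>

lemma trap_mean_SUP:
  assumes \<nu>: "trap_law \<nu>"
  shows "trap_mean \<nu> = (SUP L::nat. ennreal (trunc_mean (real L) \<nu>))"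
proof -
  have "(\<Squnion>L::nat. ennreal (min x (real L))) = ennreal x" for x
  proof (rule antisym)
    show "(\<Squnion>L::nat. ennreal (min x (real L))) \<le> ennreal x" by (intro SUP_least ennreal_leI) simp
    obtain L :: nat where "x < real L" using reals_Archimedean2 by blast
    then show "ennreal x \<le> (\<Squnion>L::nat. ennreal (min x (real L)))" by (intro SUP_upper2[of L]) auto
  qed
  then have "trap_mean \<nu> = (\<integral>\<^sup>+x. (\<Squnion>L::nat. ennreal (min x (real L))) \<partial>\<nu>)" by (simp add: trap_mean_def)
  also have "\<dots> = (\<Squnion>L::nat. \<integral>\<^sup>+x. ennreal (min x (real L)) \<partial>\<nu>)"
  proof (rule nn_integral_monotone_convergence_SUP)
    show "incseq (\<lambda>(L::nat) x. ennreal (min x (real L)))"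
      by (auto simp: incseq_def le_fun_def intro!: ennreal_leI)
  qed (intro trap_law_measurable[OF \<nu>]; simp)
  finally show ?thesis by (simp add: trunc_mean_nn_integral[OF \<nu>])
qed

lemma trap_mean_measurable: "trap_mean \<in> borel_measurable (borel_of trap_laws)"
proof -
  have "(\<lambda>\<nu>. SUP L::nat. ennreal (trunc_mean (real L) \<nu>)) \<in> borel_measurable (borel_of trap_laws)"
    using trunc_mean_measurable by (intro borel_measurable_SUP) auto
  then show ?thesis
    by (rule measurable_cong[THEN iffD2, rotated]) (simp add: trap_mean_SUP)
qed

lemma excess_eq_diff:
  assumes "trap_law \<nu>" "0 \<le> K"
  shows "excess K \<nu> = trap_mean \<nu> - ennreal (trunc_mean K \<nu>)"
  using trap_mean_split[OF assms] by (simp add: ennreal_add_diff_cancel_left)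

lemma excess_measurable:
  assumes "0 \<le> K"
  shows "excess K \<in> borel_measurable (borel_of trap_laws)"
proof -
  have "(\<lambda>\<nu>. trap_mean \<nu> - ennreal (trunc_mean K \<nu>)) \<in> borel_measurable (borel_of trap_laws)"
    using trap_mean_measurable trunc_mean_measurable[OF assms] by measurable
  then show ?thesis
    by (rule measurable_cong[THEN iffD2, rotated]) (simp add: excess_eq_diff assms)
qed

text \<open>Only the pairs with coinciding labels survive. The bound is used twice: for trapping
  times the labels are distinct slots and \<open>n\<close> pairs remain, for the landscape the
  labels are sites and the pairs are self-intersections of the walk.\<close>

lemma (in prob_space) sum_square_le:
  fixes X :: "'i \<Rightarrow> 'a \<Rightarrow> real"
  assumes X: "\<And>i. i \<in> I \<Longrightarrow> X i \<in> borel_measurable M"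
    and b: "\<And>i \<omega>. i \<in> I \<Longrightarrow> \<omega> \<in> space M \<Longrightarrow> \<bar>X i \<omega>\<bar> \<le> K"
    and orth: "\<And>i j. i \<in> I \<Longrightarrow> j \<in> I \<Longrightarrow> i \<noteq> j \<Longrightarrow> expectation (\<lambda>\<omega>. X i \<omega> * X j \<omega>) = 0"
    and c: "\<And>k. k < n \<Longrightarrow> c k \<in> I"
  shows "expectation (\<lambda>\<omega>. (\<Sum>k<n. X (c k) \<omega>)\<^sup>2) \<le> K\<^sup>2 * (\<Sum>k<n. \<Sum>l<n. if c k = c l then 1 else 0)"
proof -
  have le: "\<bar>X i \<omega> * X j \<omega>\<bar> \<le> K\<^sup>2" if "i \<in> I" "j \<in> I" "\<omega> \<in> space M" for i j \<omega>
    unfolding abs_mult power2_eq_square using b[OF that(1,3)] b[OF that(2,3)] by (intro mult_mono) auto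
  have int: "integrable M (\<lambda>\<omega>. X i \<omega> * X j \<omega>)" if "i \<in> I" "j \<in> I" for i j
    by (rule integrable_const_bound[of _ "K\<^sup>2"]) (use le[OF that] X that in auto)
  have "expectation (\<lambda>\<omega>. (\<Sum>k<n. X (c k) \<omega>)\<^sup>2) = expectation (\<lambda>\<omega>. \<Sum>k<n. \<Sum>l<n. X (c k) \<omega> * X (c l) \<omega>)"
    by (simp add: power2_eq_square sum_product)
  also have "\<dots> = (\<Sum>k<n. \<Sum>l<n. expectation (\<lambda>\<omega>. X (c k) \<omega> * X (c l) \<omega>))"
    using int c by (subst Bochner_Integration.integral_sum; (intro sum.cong Bochner_Integration.integral_sum)?; auto)
  also have "\<dots> \<le> (\<Sum>k<n. \<Sum>l<n. K\<^sup>2 * (if c k = c l then 1 else 0))"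
  proof (intro sum_mono)
    fix k l assume kl: "k \<in> {..<n}" "l \<in> {..<n}"
    show "expectation (\<lambda>\<omega>. X (c k) \<omega> * X (c l) \<omega>) \<le> K\<^sup>2 * (if c k = c l then 1 else 0)"
    proof (cases "c k = c l")
      case True
      have "expectation (\<lambda>\<omega>. X (c k) \<omega> * X (c l) \<omega>) \<le> expectation (\<lambda>\<omega>. K\<^sup>2)"
        using le c kl by (intro integral_mono int) (fastforce intro: order_trans[OF abs_ge_self])+
      then show ?thesis using True by (simp add: prob_space)
    next
      case False
      then show ?thesis using orth c kl by simp
    qed
  qed
  finally show ?thesis by (simp add: sum_distrib_left)
qed

lemma (in prob_space) indep_vars_orthogonal:
  fixes X :: "'i \<Rightarrow> 'a \<Rightarrow> real"
  assumes ind: "indep_vars (\<lambda>_. borel) X I" and ij: "i \<in> I" "j \<in> I" "i \<noteq> j"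
    and int: "\<And>i. i \<in> I \<Longrightarrow> integrable M (X i)" and mean: "\<And>i. i \<in> I \<Longrightarrow> expectation (X i) = 0"
  shows "expectation (\<lambda>\<omega>. X i \<omega> * X j \<omega>) = 0"
proof -
  have "indep_vars (\<lambda>_. borel) X {i, j}" by (rule indep_vars_subset[OF ind]) (use ij in auto)
  then have "expectation (\<lambda>\<omega>. \<Prod>k\<in>{i, j}. X k \<omega>) = (\<Prod>k\<in>{i, j}. expectation (X k))"
    by (intro indep_vars_lebesgue_integral) (use int ij in auto)
  then show ?thesis using ij mean by simp
qed

lemma (in prob_space) indep_vars_reindex_inj:
  assumes ind: "indep_vars (\<lambda>_. N) X I" and f: "inj_on f J" "f ` J \<subseteq> I"
  shows "indep_vars (\<lambda>_. N) (\<lambda>j. X (f j)) J"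
proof -
  have "indep_vars (\<lambda>j. Pi\<^sub>M {f j} (\<lambda>_. N)) (\<lambda>j \<omega>. restrict (\<lambda>i. X i \<omega>) {f j}) J"
    by (rule indep_vars_restrict[OF ind]) (use f in \<open>auto simp: disjoint_family_on_def inj_on_def\<close>)
  from indep_vars_compose2[OF this, of "\<lambda>j v. v (f j)" "\<lambda>_. N"] show ?thesis by simp
qed

text \<open>The second moment of a random walk in the scenery \<open>g\<close>, averaged over the
  walk alone. For a random scenery it is a function of the landscape.\<close>

definition field_square :: "(int \<Rightarrow> real) \<Rightarrow> nat \<Rightarrow> real" where
  "field_square g n = (\<integral>\<xi>. (\<Sum>k<n. g (walk \<xi> k))\<^sup>2 \<partial>step_space)"

lemma field_sum_abs_le:
  fixes K :: real
  shows "(\<And>z. \<bar>g z\<bar> \<le> K) \<Longrightarrow> finite A \<Longrightarrow> \<bar>\<Sum>k\<in>A. g (walk \<xi> k)\<bar> \<le> real (card A) * K"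
  by (rule order_trans[OF sum_abs]) (rule sum_bounded_above, simp)

lemma field_sum_measurable [measurable]:
  "(\<lambda>\<xi>. \<Sum>k\<in>A. g (walk \<xi> k) :: real) \<in> borel_measurable step_space"
  by (intro borel_measurable_sum measurable_compose[OF walk_measurable]) auto

lemma field_square_integrable:
  fixes K :: real
  assumes "\<And>z. \<bar>g z\<bar> \<le> K"
  shows "integrable step_space (\<lambda>\<xi>. (\<Sum>k<n. g (walk \<xi> k))\<^sup>2)"
proof (rule steps.P.integrable_const_bound[of _ "(real n * K)\<^sup>2"])
  show "AE \<xi> in step_space. norm ((\<Sum>k<n. g (walk \<xi> k))\<^sup>2) \<le> (real n * K)\<^sup>2"
  proof (rule AE_I2)
    fix \<xi>
    have "\<bar>\<Sum>k<n. g (walk \<xi> k)\<bar>\<^sup>2 \<le> (real n * K)\<^sup>2"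
      using field_sum_abs_le[OF assms, where A="{..<n}" and \<xi>=\<xi>] by (intro power_mono) auto
    then show "norm ((\<Sum>k<n. g (walk \<xi> k))\<^sup>2) \<le> (real n * K)\<^sup>2" by simp
  qed
qed measurable

lemma field_square_nonneg: "0 \<le> field_square g n"
  unfolding field_square_def by simp

lemma field_square_le:
  assumes g: "\<And>z. \<bar>g z\<bar> \<le> K" and mn: "m \<le> n"
  shows "field_square g n \<le> 2 * field_square g m + 2 * (real (n - m) * K)\<^sup>2"
proof -
  have "field_square g n \<le> (\<integral>\<xi>. 2 * (\<Sum>k<m. g (walk \<xi> k))\<^sup>2 + 2 * (real (n - m) * K)\<^sup>2 \<partial>step_space)"
    unfolding field_square_def
  proof (rule integral_mono)
    fix \<xi>
    have s: "(\<Sum>k<n. g (walk \<xi> k)) = (\<Sum>k<m. g (walk \<xi> k)) + (\<Sum>k\<in>{m..<n}. g (walk \<xi> k))"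
      using sum.atLeastLessThan_concat[of 0 m n "\<lambda>k. g (walk \<xi> k)"] mn by (simp add: lessThan_atLeast0)
    have "\<bar>\<Sum>k\<in>{m..<n}. g (walk \<xi> k)\<bar>\<^sup>2 \<le> (real (n - m) * K)\<^sup>2"
      using field_sum_abs_le[OF g, where A="{m..<n}" and \<xi>=\<xi>] by (intro power_mono) auto
    moreover have "(a + b)\<^sup>2 \<le> 2 * a\<^sup>2 + 2 * b\<^sup>2" for a b :: real
      using zero_le_power2[of "a - b"] by (simp add: power2_sum power2_diff)
    from this[of "\<Sum>k<m. g (walk \<xi> k)" "\<Sum>k\<in>{m..<n}. g (walk \<xi> k)"]
    have "(\<Sum>k<n. g (walk \<xi> k))\<^sup>2 \<le> 2 * (\<Sum>k<m. g (walk \<xi> k))\<^sup>2 + 2 * \<bar>\<Sum>k\<in>{m..<n}. g (walk \<xi> k)\<bar>\<^sup>2"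
      unfolding s power2_abs .
    ultimately show "(\<Sum>k<n. g (walk \<xi> k))\<^sup>2 \<le> 2 * (\<Sum>k<m. g (walk \<xi> k))\<^sup>2 + 2 * (real (n - m) * K)\<^sup>2"
      by linarith
  qed (simp_all add: field_square_integrable[where g=g and K=K, OF g])
  also have "\<dots> = 2 * field_square g m + 2 * (real (n - m) * K)\<^sup>2"
    using field_square_integrable[where g=g and K=K and n=m, OF g] steps.P.prob_space by (simp add: field_square_def)
  finally show ?thesis .
qed

text \<open>Deterministic interpolation: between consecutive fourth powers at most
  \<open>m * ((1 + 1 / (j + 1)) ^ 4 - 1)\<close> terms are added to \<open>m\<close>, a vanishing
  proportion.\<close>

lemma field_square_tendsto:
  assumes g: "\<And>z. \<bar>g z\<bar> \<le> K"
    and sub: "(\<lambda>j. field_square g (Suc j ^ 4) / (real (Suc j ^ 4))\<^sup>2) \<longlonglongrightarrow> 0"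
  shows "(\<lambda>n. field_square g n / (real n)\<^sup>2) \<longlonglongrightarrow> 0"
proof (rule LIMSEQ_I)
  fix r :: real assume r: "0 < r"
  define b where "b j = 2 * (field_square g (Suc j ^ 4) / (real (Suc j ^ 4))\<^sup>2)
      + 2 * (((1 + 1 / real (Suc j)) ^ 4 - 1) * K)\<^sup>2" for j
  have "(\<lambda>j. 1 / real (Suc j)) \<longlonglongrightarrow> 0" by (rule lim_1_over_n[THEN LIMSEQ_Suc])
  then have "b \<longlonglongrightarrow> 2 * 0 + 2 * (((1 + 0) ^ 4 - 1) * K)\<^sup>2"
    unfolding b_def by (intro tendsto_intros sub)
  then have "b \<longlonglongrightarrow> 0" by simp
  then obtain j0 where j0: "\<And>j. j \<ge> j0 \<Longrightarrow> b j < r"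
    using order_tendstoD(2)[of b 0 sequentially r] r by (auto simp: eventually_sequentially)
  have "norm (field_square g n / (real n)\<^sup>2 - 0) < r" if n: "n \<ge> Suc j0 ^ 4" for n
  proof -
    \<comment> \<open>Chosen so that \<open>n\<close> lies between \<open>(j + 1) ^ 4\<close>,
      included, and \<open>(j + 2) ^ 4\<close>, excluded.\<close>
    define j where "j = (LEAST j. n < Suc (Suc j) ^ 4)"
    have "n < Suc (Suc n) ^ 4"
    proof -
      have "n < Suc (Suc n) ^ 1" by simp
      also have "\<dots> \<le> Suc (Suc n) ^ 4" by (rule power_increasing) auto
      finally show ?thesis .
    qed
    then have j1: "n < Suc (Suc j) ^ 4" unfolding j_def by (rule LeastI)
    have j2: "Suc j ^ 4 \<le> n"
    proof (cases j)
      case 0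
      then show ?thesis using n by (metis One_nat_def le_trans one_le_power power_one Suc_leI zero_less_Suc)
    next
      case (Suc i)
      then have "\<not> n < Suc (Suc i) ^ 4" using not_less_Least[of i "\<lambda>j. n < Suc (Suc j) ^ 4"] by (simp add: j_def)
      then show ?thesis using Suc by simp
    qed
    have "Suc j0 ^ 4 < Suc (Suc j) ^ 4" using n j1 by linarith
    then have "j0 \<le> j" using power_less_imp_less_base[of "Suc j0" 4 "Suc (Suc j)"] by simp
    define m where "m = Suc j ^ 4"
    have m: "0 < m" "m \<le> n" using j2 by (auto simp: m_def)
    have rm: "0 < real m" using m by simp
    have "real n \<le> real (Suc (Suc j) ^ 4)" using j1 by (simp only: of_nat_le_iff less_imp_le)
    then have "real (n - m) \<le> real (Suc (Suc j) ^ 4) - real m" unfolding of_nat_diff[OF m(2)] by simp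
    also have "\<dots> = real m * ((1 + 1 / real (Suc j)) ^ 4 - 1)"
    proof -
      have "real (Suc (Suc j)) = real (Suc j) * (1 + 1 / real (Suc j))" by (simp add: field_simps)
      then have "real (Suc (Suc j) ^ 4) = real m * (1 + 1 / real (Suc j)) ^ 4"
        unfolding m_def of_nat_power by (metis power_mult_distrib)
      then show ?thesis by (simp add: right_diff_distrib)
    qed
    finally have nm: "real (n - m) \<le> real m * ((1 + 1 / real (Suc j)) ^ 4 - 1)" .
    have K: "0 \<le> K" using g[of 0] by linarith
    have "(real (n - m) * K)\<^sup>2 \<le> (real m * ((1 + 1 / real (Suc j)) ^ 4 - 1) * K)\<^sup>2"
      using nm K by (intro power_mono mult_right_mono) auto
    then have "field_square g n \<le> 2 * field_square g m + 2 * (real m * ((1 + 1 / real (Suc j)) ^ 4 - 1) * K)\<^sup>2"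
      using field_square_le[where g=g and K=K, OF g m(2)] by linarith
    also have "\<dots> = b j * (real m)\<^sup>2"
      using rm by (simp add: b_def m_def[symmetric] power_mult_distrib distrib_right)
    also have "\<dots> \<le> b j * (real n)\<^sup>2"
    proof (intro mult_left_mono power_mono)
      show "0 \<le> b j" unfolding b_def by (simp add: field_square_nonneg)
    qed (use m in auto)
    finally have "field_square g n / (real n)\<^sup>2 \<le> b j" using m by (simp add: divide_le_eq)
    then show ?thesis using j0[OF \<open>j0 \<le> j\<close>] field_square_nonneg[of g n] by simp
  qed
  then show "\<exists>no. \<forall>n\<ge>no. norm (field_square g n / (real n)\<^sup>2 - 0) < r" by blast
qed

text \<open>By Fubini the landscape is integrated first with the walk held fixed, where values at
  distinct sites are orthogonal. Then \<open>walk_meetings_le\<close> bounds the expectation, and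
  convergence along fourth powers follows from a series with finite expectation.\<close>

lemma (in prob_space) field_square_AE:
  fixes G :: "int \<Rightarrow> 'a \<Rightarrow> real"
  assumes ind: "indep_vars (\<lambda>_. borel) G UNIV" and b: "\<And>z \<omega>. \<omega> \<in> space M \<Longrightarrow> \<bar>G z \<omega>\<bar> \<le> K"
    and mean: "\<And>z. expectation (G z) = 0"
  shows "AE \<omega> in M. (\<lambda>n. field_square (\<lambda>z. G z \<omega>) n / (real n)\<^sup>2) \<longlonglongrightarrow> 0"
proof -
  have Gm[measurable]: "G z \<in> borel_measurable M" for z using ind by (auto simp: indep_vars_def)
  interpret PS: pair_sigma_finite M step_space ..
  have m: "(\<lambda>(\<omega>, \<xi>). (\<Sum>k<n. G (walk \<xi> k) \<omega>)\<^sup>2) \<in> borel_measurable (M \<Otimes>\<^sub>M step_space)" for n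
  proof -
    have "(\<lambda>p. G (walk (snd p) k) (fst p)) \<in> borel_measurable (M \<Otimes>\<^sub>M step_space)" for k
      by (rule measurable_compose_countable[where f="\<lambda>z p. G z (fst p)" and g="\<lambda>p. walk (snd p) k"]) measurable
    then have "(\<lambda>p. (\<Sum>k<n. G (walk (snd p) k) (fst p))\<^sup>2) \<in> borel_measurable (M \<Otimes>\<^sub>M step_space)"
      by measurable
    then show ?thesis by (simp add: case_prod_beta)
  qed
  have Wm[measurable]: "(\<lambda>\<omega>. field_square (\<lambda>z. G z \<omega>) n) \<in> borel_measurable M" for n
    unfolding field_square_def by (rule steps.P.borel_measurable_lebesgue_integral[OF m])
  have W: "(\<integral>\<^sup>+\<omega>. ennreal (field_square (\<lambda>z. G z \<omega>) n) \<partial>M) \<le> ennreal (6 * K\<^sup>2 * real n * sqrt (real n))" for n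
  proof -
    have "(\<integral>\<^sup>+\<omega>. ennreal (field_square (\<lambda>z. G z \<omega>) n) \<partial>M)
        = (\<integral>\<^sup>+\<omega>. (\<integral>\<^sup>+\<xi>. ennreal ((\<Sum>k<n. G (walk \<xi> k) \<omega>)\<^sup>2) \<partial>step_space) \<partial>M)"
    proof (rule nn_integral_cong)
      fix \<omega> assume "\<omega> \<in> space M"
      then show "ennreal (field_square (\<lambda>z. G z \<omega>) n) = (\<integral>\<^sup>+\<xi>. ennreal ((\<Sum>k<n. G (walk \<xi> k) \<omega>)\<^sup>2) \<partial>step_space)"
        unfolding field_square_def
        by (intro nn_integral_eq_integral[symmetric] field_square_integrable[where g="\<lambda>z. G z \<omega>" and K=K] b) auto
    qed
    also have "\<dots> = (\<integral>\<^sup>+\<xi>. (\<integral>\<^sup>+\<omega>. ennreal ((\<Sum>k<n. G (walk \<xi> k) \<omega>)\<^sup>2) \<partial>M) \<partial>step_space)"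
      by (rule PS.Fubini'[symmetric]) (use measurable_compose[OF m measurable_ennreal] in \<open>simp add: case_prod_beta\<close>)
    also have "\<dots> \<le> (\<integral>\<^sup>+\<xi>. ennreal (K\<^sup>2 * (\<Sum>k<n. \<Sum>l<n. indicator {\<xi>. walk \<xi> k = walk \<xi> l} \<xi>)) \<partial>step_space)"
    proof (rule nn_integral_mono)
      fix \<xi>
      have orth: "expectation (\<lambda>\<omega>. G i \<omega> * G j \<omega>) = 0" if "i \<noteq> j" for i j
        by (rule indep_vars_orthogonal[OF ind]) (use that mean b in \<open>auto intro!: integrable_const_bound[of _ K]\<close>)
      have "(\<integral>\<^sup>+\<omega>. ennreal ((\<Sum>k<n. G (walk \<xi> k) \<omega>)\<^sup>2) \<partial>M) = ennreal (expectation (\<lambda>\<omega>. (\<Sum>k<n. G (walk \<xi> k) \<omega>)\<^sup>2))"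
      proof (rule nn_integral_eq_integral)
        show "integrable M (\<lambda>\<omega>. (\<Sum>k<n. G (walk \<xi> k) \<omega>)\<^sup>2)"
        proof (rule integrable_const_bound[of _ "(real n * K)\<^sup>2"])
          show "AE \<omega> in M. norm ((\<Sum>k<n. G (walk \<xi> k) \<omega>)\<^sup>2) \<le> (real n * K)\<^sup>2"
          proof (rule AE_I2)
            fix \<omega> assume "\<omega> \<in> space M"
            then have "\<bar>\<Sum>k<n. G (walk \<xi> k) \<omega>\<bar>\<^sup>2 \<le> (real n * K)\<^sup>2"
              using field_sum_abs_le[where g="\<lambda>z. G z \<omega>" and K=K and A="{..<n}" and \<xi>=\<xi>] b by (intro power_mono) auto
            then show "norm ((\<Sum>k<n. G (walk \<xi> k) \<omega>)\<^sup>2) \<le> (real n * K)\<^sup>2" by simp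
          qed
        qed measurable
      qed simp
      also have "\<dots> \<le> ennreal (K\<^sup>2 * (\<Sum>k<n. \<Sum>l<n. if walk \<xi> k = walk \<xi> l then 1 else 0))"
        by (intro ennreal_leI sum_square_le[where I=UNIV]) (use b orth in auto)
      finally show "(\<integral>\<^sup>+\<omega>. ennreal ((\<Sum>k<n. G (walk \<xi> k) \<omega>)\<^sup>2) \<partial>M)
          \<le> ennreal (K\<^sup>2 * (\<Sum>k<n. \<Sum>l<n. indicator {\<xi>. walk \<xi> k = walk \<xi> l} \<xi>))"
        by (simp only: indicator_def mem_Collect_eq of_bool_def)
    qed
    also have "\<dots> = ennreal (K\<^sup>2 * (\<Sum>k<n. \<Sum>l<n. measure step_space {\<xi>. walk \<xi> k = walk \<xi> l}))"
    proof -
      have "{\<xi> \<in> space step_space. walk \<xi> k = walk \<xi> l} \<in> sets step_space" for k l by measurable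
      then have s[measurable]: "{\<xi>. walk \<xi> k = walk \<xi> l} \<in> sets step_space" for k l by simp
      have i: "integrable step_space (indicat_real {\<xi>. walk \<xi> k = walk \<xi> l})" for k l
        by (rule steps.P.integrable_const_bound[of _ 1]) auto
      have "(\<integral>\<^sup>+\<xi>. ennreal (K\<^sup>2 * (\<Sum>k<n. \<Sum>l<n. indicator {\<xi>. walk \<xi> k = walk \<xi> l} \<xi>)) \<partial>step_space)
          = ennreal (\<integral>\<xi>. K\<^sup>2 * (\<Sum>k<n. \<Sum>l<n. indicator {\<xi>. walk \<xi> k = walk \<xi> l} \<xi>) \<partial>step_space)"
        by (intro nn_integral_eq_integral) (use i in \<open>auto intro!: sum_nonneg mult_nonneg_nonneg\<close>)
      also have "(\<integral>\<xi>. K\<^sup>2 * (\<Sum>k<n. \<Sum>l<n. indicator {\<xi>. walk \<xi> k = walk \<xi> l} \<xi>) \<partial>step_space)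
          = K\<^sup>2 * (\<Sum>k<n. \<Sum>l<n. measure step_space {\<xi>. walk \<xi> k = walk \<xi> l})"
        using i by (simp add: Bochner_Integration.integral_sum)
      finally show ?thesis .
    qed
    also have "\<dots> \<le> ennreal (6 * K\<^sup>2 * real n * sqrt (real n))"
      using mult_left_mono[OF walk_meetings_le[of n], of "K\<^sup>2"] by (intro ennreal_leI) (simp add: mult_ac)
    finally show ?thesis .
  qed
  let ?a = "\<lambda>j \<omega>. field_square (\<lambda>z. G z \<omega>) (Suc j ^ 4) / (real (Suc j ^ 4))\<^sup>2"
  have "(\<integral>\<^sup>+\<omega>. (\<Sum>j. ennreal (?a j \<omega>)) \<partial>M) = (\<Sum>j. \<integral>\<^sup>+\<omega>. ennreal (?a j \<omega>) \<partial>M)"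
    by (rule nn_integral_suminf) measurable
  also have "\<dots> \<le> (\<Sum>j. ennreal (6 * K\<^sup>2 * (1 / real (Suc j) ^ 2)))"
  proof (intro suminf_le summableI)
    fix j
    let ?m = "Suc j ^ 4"
    have "(\<integral>\<^sup>+\<omega>. ennreal (?a j \<omega>) \<partial>M) = (\<integral>\<^sup>+\<omega>. ennreal (1 / (real ?m)\<^sup>2) * ennreal (field_square (\<lambda>z. G z \<omega>) ?m) \<partial>M)"
      by (intro nn_integral_cong) (simp add: ennreal_mult'[symmetric] field_square_nonneg)
    also have "\<dots> = ennreal (1 / (real ?m)\<^sup>2) * (\<integral>\<^sup>+\<omega>. ennreal (field_square (\<lambda>z. G z \<omega>) ?m) \<partial>M)"
      by (rule nn_integral_cmult) measurable
    also have "\<dots> \<le> ennreal (1 / (real ?m)\<^sup>2) * ennreal (6 * K\<^sup>2 * real ?m * sqrt (real ?m))"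
      by (intro mult_left_mono W) simp
    also have "\<dots> = ennreal (1 / (real ?m)\<^sup>2 * (6 * K\<^sup>2 * real ?m * sqrt (real ?m)))"
      by (rule ennreal_mult[symmetric]) auto
    \<comment> \<open>At fourth powers the square root is an integer, and what remains is a multiple
      of \<open>1 / (j + 1)\<^sup>2\<close>.\<close>
    also have "1 / (real ?m)\<^sup>2 * (6 * K\<^sup>2 * real ?m * sqrt (real ?m)) = 6 * K\<^sup>2 * (1 / real (Suc j) ^ 2)"
    proof -
      have x: "0 < real (Suc j)" by simp
      have "sqrt (real ?m) = real (Suc j) ^ 2"
        by (rule real_sqrt_unique) (auto simp: power_mult[symmetric])
      then have "1 / (real ?m)\<^sup>2 * (6 * K\<^sup>2 * real ?m * sqrt (real ?m))
          = 6 * K\<^sup>2 * (real (Suc j) ^ 4 * real (Suc j) ^ 2 / (real (Suc j) ^ 4)\<^sup>2)" by simp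
      also have "real (Suc j) ^ 4 * real (Suc j) ^ 2 / (real (Suc j) ^ 4)\<^sup>2 = 1 / real (Suc j) ^ 2"
        using x by (simp add: field_simps power_add[symmetric] power_mult[symmetric] del: of_nat_Suc)
      finally show ?thesis .
    qed
    finally show "(\<integral>\<^sup>+\<omega>. ennreal (?a j \<omega>) \<partial>M) \<le> ennreal (6 * K\<^sup>2 * (1 / real (Suc j) ^ 2))" .
  qed
  also have "\<dots> < \<infinity>"
  proof -
    have "summable (\<lambda>j. 1 / real (Suc j) ^ 2)"
      using inverse_power_summable[of 2, where 'a=real] by (subst summable_Suc_iff) (simp add: inverse_eq_divide)
    then have "summable (\<lambda>j. 6 * K\<^sup>2 * (1 / real (Suc j) ^ 2))" by (rule summable_mult)
    then show ?thesis by (subst suminf_ennreal2) auto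
  qed
  finally have "(\<integral>\<^sup>+\<omega>. (\<Sum>j. ennreal (?a j \<omega>)) \<partial>M) \<noteq> \<infinity>" by simp
  then have "AE \<omega> in M. (\<Sum>j. ennreal (?a j \<omega>)) \<noteq> \<infinity>"
    by (intro nn_integral_PInf_AE) measurable
  then show ?thesis
    using AE_space
  proof eventually_elim
    case (elim \<omega>)
    then have "summable (\<lambda>j. ?a j \<omega>)"
      by (intro summable_suminf_not_top) (auto simp: field_square_nonneg)
    then have "(\<lambda>j. ?a j \<omega>) \<longlonglongrightarrow> 0" by (rule summable_LIMSEQ_zero)
    then show ?case by (rule field_square_tendsto[OF b[OF elim(2)]])
  qed
qed


text \<open>The sequence \<open>\<mu> K\<close> stands for the means of the truncated trapping times.\<close>

definition homogenizes :: "real \<Rightarrow> (int \<Rightarrow> real measure) \<Rightarrow> bool" where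
  "homogenizes M p \<longleftrightarrow> (\<exists>\<mu> :: nat \<Rightarrow> real.
     (\<forall>K. 0 \<le> \<mu> K \<and> \<mu> K \<le> real K \<and>
        (\<lambda>n. field_square (\<lambda>z. trunc_mean (real K) (p z) - \<mu> K) n / (real n)\<^sup>2) \<longlonglongrightarrow> 0) \<and>
     (\<forall>\<delta>>0. \<exists>K. \<bar>M - \<mu> K\<bar> \<le> \<delta> \<and>
        (\<forall>r. (\<Sum>x\<in>{- int r..int r}. excess (real K) (p x)) \<le> ennreal (\<delta> * (2 * real r + 1)))))"

text \<open>Reduces symmetric averages to two one-sided ones, to which the maximal inequality
  applies; the origin is counted twice.\<close>

lemma sum_symmetric_interval_le:
  fixes h :: "int \<Rightarrow> ennreal"
  shows "(\<Sum>x\<in>{- int r..int r}. h x) \<le> (\<Sum>k<Suc r. h (int k)) + (\<Sum>k<Suc r. h (- int k))"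
proof (induction r)
  case (Suc r)
  have "{- int (Suc r)..int (Suc r)} = insert (int (Suc r)) (insert (- int (Suc r)) {- int r..int r})"
    by auto
  then have "(\<Sum>x\<in>{- int (Suc r)..int (Suc r)}. h x) = h (int (Suc r)) + (h (- int (Suc r)) + (\<Sum>x\<in>{- int r..int r}. h x))"
    by simp
  also have "\<dots> \<le> h (int (Suc r)) + (h (- int (Suc r)) + ((\<Sum>k<Suc r. h (int k)) + (\<Sum>k<Suc r. h (- int k))))"
    by (intro add_mono order_refl Suc)
  also have "\<dots> = (\<Sum>k<Suc (Suc r). h (int k)) + (\<Sum>k<Suc (Suc r). h (- int k))"
    unfolding sum.lessThan_Suc[of _ "Suc r"] by (simp only: ac_simps)
  finally show ?case .
qed simp

text \<open>All almost sure statements about the landscape are collected here. Countably many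
  truncation levels and tolerances \<open>1 / (j + 1)\<close> suffice.\<close>

lemma (in prob_space) landscape_homogenizes:
  fixes \<pi> :: "int \<Rightarrow> 'a \<Rightarrow> real measure" and m :: real
  assumes ind: "indep_vars (\<lambda>_. borel_of trap_laws) \<pi> UNIV"
    and law: "\<And>z. distr M (borel_of trap_laws) (\<pi> z) = P"
    and mean: "(\<integral>\<^sup>+\<nu>. trap_mean \<nu> \<partial>P) = ennreal m" and m: "0 < m"
  shows "AE \<omega> in M. (\<forall>z. trap_law (\<pi> z \<omega>)) \<and> homogenizes m (\<lambda>z. \<pi> z \<omega>)"
proof -
  have \<pi>m[measurable]: "\<pi> z \<in> measurable M (borel_of trap_laws)" for z
    using ind by (auto simp: indep_vars_def)
  have trap: "trap_law (\<pi> z \<omega>)" if "\<omega> \<in> space M" for z \<omega>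
    using measurable_space[OF \<pi>m that] by simp
  have sP: "sets P = sets (borel_of trap_laws)" using law[of 0] by auto
  have P: "prob_space P" using prob_space_distr[OF \<pi>m[of 0]] by (simp add: law)
  interpret P: prob_space P by (rule P)
  have spP: "space P = prob_measures (top_of_set {0<..})" using sets_eq_imp_space_eq[OF sP] by simp
  have Pm: "g \<in> borel_measurable P" if "g \<in> borel_measurable (borel_of trap_laws)" for g :: "real measure \<Rightarrow> 'b::topological_space"
    using that measurable_cong_sets[OF sP refl] by auto
  define \<mu> where "\<mu> K = (\<integral>\<nu>. trunc_mean (real K) \<nu> \<partial>P)" for K :: nat
  have Tm: "trunc_mean (real K) \<in> borel_measurable (borel_of trap_laws)" for K by (rule trunc_mean_measurable) simp
  have Em: "excess (real K) \<in> borel_measurable (borel_of trap_laws)" for K by (rule excess_measurable) simp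
  have tb: "0 \<le> trunc_mean (real K) \<nu>" "trunc_mean (real K) \<nu> \<le> real K" if "\<nu> \<in> space P" for K \<nu>
    using trunc_mean_bounds[of \<nu> "real K"] that by (auto simp: spP)
  have Ti: "integrable P (trunc_mean (real K))" for K
  proof (rule P.integrable_const_bound[of _ "real K"])
    show "AE \<nu> in P. norm (trunc_mean (real K) \<nu>) \<le> real K" using tb by (intro AE_I2) auto
  qed (rule Pm[OF Tm])
  have \<mu>0: "0 \<le> \<mu> K" for K unfolding \<mu>_def by (rule integral_nonneg_AE, rule AE_I2, rule tb)
  have \<mu>K: "\<mu> K \<le> real K" for K
  proof -
    have "\<mu> K \<le> (\<integral>\<nu>. real K \<partial>P)" unfolding \<mu>_def by (rule integral_mono[OF Ti]) (auto intro: tb)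
    then show ?thesis by (simp add: P.prob_space)
  qed
  have \<mu>nn: "(\<integral>\<^sup>+\<nu>. ennreal (trunc_mean (real K) \<nu>) \<partial>P) = ennreal (\<mu> K)" for K
    unfolding \<mu>_def by (rule nn_integral_eq_integral[OF Ti], rule AE_I2, rule tb)
  have tmono: "trunc_mean (real K) \<nu> \<le> trunc_mean (real L) \<nu>" if "K \<le> L" "\<nu> \<in> space P" for K L \<nu>
    unfolding trunc_mean_def
  proof (rule integral_mono)
    have t: "trap_law \<nu>" using that by (simp add: spP)
    show "integrable \<nu> (\<lambda>x. min x (real K))" "integrable \<nu> (\<lambda>x. min x (real L))"
      by (rule trunc_integrable[OF t], simp)+
    show "min x (real K) \<le> min x (real L)" for x using that(1) by (simp add: min.coboundedI2)
  qed
  have \<mu>mono: "\<mu> K \<le> \<mu> L" if "K \<le> L" for K L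
    unfolding \<mu>_def by (rule integral_mono[OF Ti Ti]) (rule tmono[OF that])
  have exc: "(\<integral>\<^sup>+\<nu>. excess (real K) \<nu> \<partial>P) = ennreal (m - \<mu> K)" "\<mu> K \<le> m" for K
  proof -
    have "ennreal m = (\<integral>\<^sup>+\<nu>. ennreal (trunc_mean (real K) \<nu>) + excess (real K) \<nu> \<partial>P)"
      unfolding mean[symmetric] by (intro nn_integral_cong) (simp add: spP trap_mean_split)
    also have "\<dots> = ennreal (\<mu> K) + (\<integral>\<^sup>+\<nu>. excess (real K) \<nu> \<partial>P)"
      by (subst nn_integral_add) (auto simp: \<mu>nn intro: Pm Em Tm measurable_compose[OF Pm[OF Tm] measurable_ennreal])
    finally have e: "ennreal m = ennreal (\<mu> K) + (\<integral>\<^sup>+\<nu>. excess (real K) \<nu> \<partial>P)" .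
    then have "ennreal (\<mu> K) \<le> ennreal m" by simp
    then show "\<mu> K \<le> m" using m by (simp add: ennreal_le_iff)
    have "(\<integral>\<^sup>+\<nu>. excess (real K) \<nu> \<partial>P) = ennreal m - ennreal (\<mu> K)"
      unfolding e by (simp add: ennreal_add_diff_cancel_left)
    then show "(\<integral>\<^sup>+\<nu>. excess (real K) \<nu> \<partial>P) = ennreal (m - \<mu> K)" by (simp add: ennreal_minus \<mu>0)
  qed
  have small: "\<exists>L. \<forall>K\<ge>L. m - \<mu> K \<le> \<delta>" if "0 < \<delta>" for \<delta>
  proof (cases "m - \<delta> < 0")
    case True
    then show ?thesis using \<mu>0 by (intro exI[of _ 0]) (smt (verit))
  next
    case False
    have "ennreal m = (\<integral>\<^sup>+\<nu>. (SUP L::nat. ennreal (trunc_mean (real L) \<nu>)) \<partial>P)"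
      unfolding mean[symmetric] by (intro nn_integral_cong) (simp add: spP trap_mean_SUP)
    \<comment> \<open>Truncated means are monotone in the level for trapping laws only; setting them
      to 0 off \<open>space P\<close> makes the sequence increasing everywhere.\<close>
    also have "\<dots> = (\<integral>\<^sup>+\<nu>. (SUP L::nat. (if \<nu> \<in> space P then ennreal (trunc_mean (real L) \<nu>) else 0)) \<partial>P)"
      by (intro nn_integral_cong) simp
    also have "\<dots> = (SUP L::nat. (\<integral>\<^sup>+\<nu>. (if \<nu> \<in> space P then ennreal (trunc_mean (real L) \<nu>) else 0) \<partial>P))"
    proof (rule nn_integral_monotone_convergence_SUP)
      show "incseq (\<lambda>(L::nat) \<nu>. if \<nu> \<in> space P then ennreal (trunc_mean (real L) \<nu>) else 0)"
        by (auto simp: incseq_def le_fun_def intro!: ennreal_leI tmono)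
      show "(\<lambda>\<nu>. if \<nu> \<in> space P then ennreal (trunc_mean (real L) \<nu>) else 0) \<in> borel_measurable P" for L :: nat
        by (rule measurable_cong[THEN iffD1, OF _ measurable_compose[OF Pm[OF Tm[of L]] measurable_ennreal]]) simp
    qed
    also have "(\<lambda>L::nat. (\<integral>\<^sup>+\<nu>. (if \<nu> \<in> space P then ennreal (trunc_mean (real L) \<nu>) else 0) \<partial>P)) = (\<lambda>L. ennreal (\<mu> L))"
      by (rule ext, subst \<mu>nn[symmetric], rule nn_integral_cong) simp
    finally have "ennreal m = (SUP L. ennreal (\<mu> L))" .
    moreover have "ennreal (m - \<delta>) < ennreal m" using that False by (subst ennreal_less_iff) auto
    ultimately obtain L where "ennreal (m - \<delta>) < ennreal (\<mu> L)" by (auto simp: less_SUP_iff)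
    then have "m - \<delta> < \<mu> L" using False by (subst (asm) ennreal_less_iff) auto
    then show ?thesis using \<mu>mono[of L] by (intro exI[of _ L]) (smt (verit))
  qed
  have A1: "AE \<omega> in M. \<forall>K. (\<lambda>n. field_square (\<lambda>z. trunc_mean (real K) (\<pi> z \<omega>) - \<mu> K) n / (real n)\<^sup>2) \<longlonglongrightarrow> 0"
    unfolding AE_all_countable
  proof
    fix K :: nat
    show "AE \<omega> in M. (\<lambda>n. field_square (\<lambda>z. trunc_mean (real K) (\<pi> z \<omega>) - \<mu> K) n / (real n)\<^sup>2) \<longlonglongrightarrow> 0"
    proof (rule field_square_AE[where K="real K"])
      show "indep_vars (\<lambda>_. borel) (\<lambda>z \<omega>. trunc_mean (real K) (\<pi> z \<omega>) - \<mu> K) UNIV"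
        by (rule indep_vars_compose2[OF ind, of "\<lambda>_ \<nu>. trunc_mean (real K) \<nu> - \<mu> K"])
          (intro borel_measurable_diff Tm borel_measurable_const)
      show "\<bar>trunc_mean (real K) (\<pi> z \<omega>) - \<mu> K\<bar> \<le> real K" if "\<omega> \<in> space M" for z \<omega>
        using trunc_mean_bounds[OF trap[OF that], of "real K" z] \<mu>0[of K] \<mu>K[of K] by auto
      show "expectation (\<lambda>\<omega>. trunc_mean (real K) (\<pi> z \<omega>) - \<mu> K) = 0" for z
      proof -
        have "expectation (\<lambda>\<omega>. trunc_mean (real K) (\<pi> z \<omega>) - \<mu> K)
            = (\<integral>\<nu>. trunc_mean (real K) \<nu> - \<mu> K \<partial>distr M (borel_of trap_laws) (\<pi> z))"
          by (rule integral_distr[symmetric, OF \<pi>m]) (intro borel_measurable_diff Tm borel_measurable_const)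
        also have "\<dots> = 0" unfolding law using Ti[of K] by (simp add: P.prob_space \<mu>_def[symmetric])
        finally show ?thesis .
      qed
    qed
  qed
  \<comment> \<open>The sign \<open>\<sigma>\<close> selects one of the two half-lines issuing from
    the origin.\<close>
  define bad where "bad c \<sigma> K = {\<omega>\<in>space M. \<exists>r\<ge>1. ennreal c * of_nat r < (\<Sum>k<r. excess (real K) (\<pi> (\<sigma> * int k) \<omega>))}"
    for c :: real and \<sigma> :: int and K :: nat
  have Ecm[measurable]: "(\<lambda>\<omega>. excess (real K) (\<pi> z \<omega>)) \<in> borel_measurable M" for K z
    by (rule measurable_compose[OF \<pi>m Em])
  have bad_sets[measurable]: "bad c \<sigma> K \<in> sets M" for c \<sigma> K
    unfolding bad_def by measurable
  have bad_prob: "c * prob (bad c \<sigma> K) \<le> m - \<mu> K" if "0 < c" "\<sigma> = 1 \<or> \<sigma> = -1" for c \<sigma> K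
    unfolding bad_def
  proof (rule iid_maximal_inequality[where D="distr P borel (excess (real K))"])
    have "indep_vars (\<lambda>_. borel) (\<lambda>z \<omega>. excess (real K) (\<pi> z \<omega>)) UNIV"
      by (rule indep_vars_compose2[OF ind, of "\<lambda>_ \<nu>. excess (real K) \<nu>"]) (rule Em)
    then show "indep_vars (\<lambda>_. borel) (\<lambda>k \<omega>. excess (real K) (\<pi> (\<sigma> * int k) \<omega>)) UNIV"
      by (rule indep_vars_reindex_inj) (use that in \<open>auto simp: inj_on_def\<close>)
    show "distr M borel (\<lambda>\<omega>. excess (real K) (\<pi> (\<sigma> * int i) \<omega>)) = distr P borel (excess (real K))" for i
      by (subst law[of "\<sigma> * int i", symmetric], subst distr_distr[OF Em \<pi>m]) (simp add: comp_def)
    show "(\<integral>\<^sup>+\<omega>. excess (real K) (\<pi> (\<sigma> * int i) \<omega>) \<partial>M) = ennreal (m - \<mu> K)" for i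
      unfolding exc(1)[symmetric] by (subst law[of "\<sigma> * int i", symmetric], rule nn_integral_distr[symmetric, OF \<pi>m]) (simp add: Em)
    show "0 \<le> m - \<mu> K" using exc(2) by simp
  qed (rule that(1))
  have A2: "AE \<omega> in M. \<forall>j::nat. \<exists>K. m - \<mu> K \<le> 1 / real (Suc j) \<and>
      \<omega> \<notin> bad (1 / real (Suc j) / 2) 1 K \<and> \<omega> \<notin> bad (1 / real (Suc j) / 2) (-1) K"
    unfolding AE_all_countable
  proof
    fix j :: nat
    \<comment> \<open>The factor 1/2 pays for the two half-lines: together they contribute
      \<open>2 * c * (r + 1)\<close>, at most \<open>(2 * r + 1) / (j + 1)\<close>.\<close>
    define c where "c = 1 / real (Suc j) / 2"
    have c: "0 < c" by (simp add: c_def)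
    obtain L where L: "\<And>K. K \<ge> L \<Longrightarrow> m - \<mu> K \<le> 1 / real (Suc j)" using small[of "1 / real (Suc j)"] by auto
    \<comment> \<open>Landscapes for which every level from \<open>L\<close> on fails. A single
      level \<open>K\<close> fails with probability at most \<open>2 * (m - \<mu> K) / c\<close>,
      which becomes arbitrarily small. Hence almost surely some level works, and it may depend on
      the landscape.\<close>
    define B where "B = (\<Inter>K\<in>{L..}. bad c 1 K \<union> bad c (-1) K)"
    have Bs: "B \<in> sets M" unfolding B_def by (intro sets.countable_INT') auto
    have "prob B = 0"
    proof (rule ccontr)
      assume "prob B \<noteq> 0"
      then have p: "0 < c * prob B / 4" using c by (simp add: less_le)
      obtain L' where L': "\<And>K. K \<ge> L' \<Longrightarrow> m - \<mu> K \<le> c * prob B / 4" using small[OF p] by auto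
      define K where "K = max L L'"
      have "prob B \<le> prob (bad c 1 K \<union> bad c (-1) K)"
        by (rule finite_measure_mono) (auto simp: B_def K_def)
      also have "\<dots> \<le> prob (bad c 1 K) + prob (bad c (-1) K)"
        by (rule measure_Un_le) auto
      finally have "c * prob B \<le> c * prob (bad c 1 K) + c * prob (bad c (-1) K)"
        using c by (simp add: distrib_left[symmetric])
      also have "\<dots> \<le> 2 * (m - \<mu> K)" using bad_prob[OF c, of 1 K] bad_prob[OF c, of "-1" K] by simp
      also have "\<dots> \<le> 2 * (c * prob B / 4)" using L'[of K] by (simp add: K_def)
      finally show False using p by simp
    qed
    then have "emeasure M B = 0" by (simp add: emeasure_eq_measure)
    then have "AE \<omega> in M. \<omega> \<notin> B" using Bs by (intro AE_not_in) (auto simp: null_sets_def)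
    then show "AE \<omega> in M. \<exists>K. m - \<mu> K \<le> 1 / real (Suc j) \<and>
        \<omega> \<notin> bad (1 / real (Suc j) / 2) 1 K \<and> \<omega> \<notin> bad (1 / real (Suc j) / 2) (-1) K"
    proof eventually_elim
      case (elim \<omega>)
      then obtain K where "K \<ge> L" "\<omega> \<notin> bad c 1 K" "\<omega> \<notin> bad c (-1) K" by (auto simp: B_def)
      then show ?case using L[of K] unfolding c_def by blast
    qed
  qed
  show ?thesis
    using A1 A2 AE_space
  proof eventually_elim
    case (elim \<omega>)
    have "\<exists>K. \<bar>m - \<mu> K\<bar> \<le> \<delta> \<and> (\<forall>r. (\<Sum>x\<in>{- int r..int r}. excess (real K) (\<pi> x \<omega>)) \<le> ennreal (\<delta> * (2 * real r + 1)))"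
      if \<delta>: "0 < \<delta>" for \<delta>
    proof -
      obtain j :: nat where "1 / \<delta> < real j" using reals_Archimedean2 by blast
      then have "1 / \<delta> < real (Suc j)" by simp
      then have j: "1 / real (Suc j) \<le> \<delta>" using \<delta> by (simp add: field_simps)
      define c where "c = 1 / real (Suc j) / 2"
      obtain K where K: "m - \<mu> K \<le> 1 / real (Suc j)" "\<omega> \<notin> bad c 1 K" "\<omega> \<notin> bad c (-1) K"
        using elim(2) unfolding c_def by blast
      have s: "(\<Sum>k<Suc r. excess (real K) (\<pi> (\<sigma> * int k) \<omega>)) \<le> ennreal c * of_nat (Suc r)"
        if "\<omega> \<notin> bad c \<sigma> K" for r \<sigma>
        using that elim(3) unfolding bad_def by (auto simp: not_less dest!: spec[of _ "Suc r"])
      have "(\<Sum>x\<in>{- int r..int r}. excess (real K) (\<pi> x \<omega>)) \<le> ennreal (\<delta> * (2 * real r + 1))" for r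
      proof -
        have "(\<Sum>x\<in>{- int r..int r}. excess (real K) (\<pi> x \<omega>))
            \<le> (\<Sum>k<Suc r. excess (real K) (\<pi> (int k) \<omega>)) + (\<Sum>k<Suc r. excess (real K) (\<pi> (- int k) \<omega>))"
          by (rule sum_symmetric_interval_le)
        also have "\<dots> \<le> ennreal c * of_nat (Suc r) + ennreal c * of_nat (Suc r)"
          using s[OF K(2), of r] s[OF K(3), of r] by (intro add_mono) simp_all
        also have "\<dots> = ennreal (c * real (Suc r) + c * real (Suc r))"
          by (simp only: ennreal_of_nat_eq_real_of_nat ennreal_mult[symmetric] ennreal_plus[symmetric] c_def
              of_nat_0_le_iff zero_le_divide_1_iff divide_nonneg_nonneg mult_nonneg_nonneg zero_le_numeral)
        also have "\<dots> \<le> ennreal (\<delta> * (2 * real r + 1))"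
        proof (rule ennreal_leI)
          have "c * real (Suc r) + c * real (Suc r) = 1 / real (Suc j) * real (Suc r)"
            by (simp only: c_def)
          also have "\<dots> \<le> \<delta> * (2 * real r + 1)" using j \<delta> by (intro mult_mono) auto
          finally show "c * real (Suc r) + c * real (Suc r) \<le> \<delta> * (2 * real r + 1)" .
        qed
        finally show ?thesis .
      qed
      moreover have "\<bar>m - \<mu> K\<bar> \<le> \<delta>" using K(1) j exc(2)[of K] by simp
      ultimately show ?thesis by blast
    qed
    then show ?case unfolding homogenizes_def using elim(1,3) \<mu>0 \<mu>K trap by blast
  qed
qed

section \<open>The quenched law of large numbers for the clock\<close>

lemma (in prob_space) markov_bound:
  assumes f[measurable]: "f \<in> borel_measurable M" and b: "(\<integral>\<^sup>+x. ennreal (f x) \<partial>M) \<le> ennreal C"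
    and C: "0 \<le> C" and c: "0 < c"
  shows "prob {x\<in>space M. c \<le> f x} \<le> C / c"
proof -
  have "emeasure M {x\<in>space M. 1 \<le> ennreal (1 / c) * ennreal (f x)}
      \<le> ennreal (1 / c) * (\<integral>\<^sup>+x. ennreal (f x) * indicator (space M) x \<partial>M)"
    by (rule nn_integral_Markov_inequality) auto
  also have "(\<integral>\<^sup>+x. ennreal (f x) * indicator (space M) x \<partial>M) = (\<integral>\<^sup>+x. ennreal (f x) \<partial>M)"
    by (rule nn_integral_cong) simp
  also have "ennreal (1 / c) * \<dots> \<le> ennreal (1 / c) * ennreal C" using b by (rule mult_left_mono) simp
  also have "\<dots> = ennreal (C / c)" using C c by (simp add: ennreal_mult[symmetric])
  finally have "emeasure M {x\<in>space M. 1 \<le> ennreal (1 / c) * ennreal (f x)} \<le> ennreal (C / c)" .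
  moreover have "{x\<in>space M. 1 \<le> ennreal (1 / c) * ennreal (f x)} = {x\<in>space M. c \<le> f x}"
  proof -
    have "1 \<le> ennreal (1 / c) * ennreal (f x) \<longleftrightarrow> c \<le> f x" for x
    proof (cases "0 \<le> f x")
      case True
      then have "ennreal (1 / c) * ennreal (f x) = ennreal (f x / c)" using c by (simp add: ennreal_mult[symmetric])
      then show ?thesis using c by (simp add: le_divide_eq)
    next
      case False
      then show ?thesis using c by (simp add: ennreal_neg)
    qed
    then show ?thesis by simp
  qed
  ultimately show ?thesis using C c by (simp add: emeasure_eq_measure)
qed

section \<open>The trapping times read along the walk\<close>

definition visit :: "(nat \<Rightarrow> int) \<Rightarrow> nat \<Rightarrow> int \<times> nat" where
  "visit \<xi> k = (walk \<xi> k, local_time (walk \<xi>) (walk \<xi> k) k)"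

lemma clock_visit: "clock (walk \<xi>) s n = (\<Sum>k<n. s (visit \<xi> k))"
  by (simp add: clock_def visit_def)

lemma local_time_Suc: "local_time y x (Suc n) = local_time y x n + (if y (Suc n) = x then 1 else 0)"
  by (simp add: local_time_def)

lemma local_time_mono: "m \<le> n \<Longrightarrow> local_time y x m \<le> local_time y x n"
  unfolding local_time_def by (rule sum_mono2) auto

lemma local_time_pos: "1 \<le> local_time y (y k) k"
proof -
  have "(\<Sum>j\<in>{k}. if y j = y k then 1 else 0) \<le> (\<Sum>j=0..k. if y j = y k then 1 else (0::nat))"
    by (rule sum_mono2) auto
  then show ?thesis by (simp add: local_time_def)
qed

lemma visit_in: "visit \<xi> k \<in> UNIV \<times> {1..}"
  using local_time_pos[of "walk \<xi>" k] by (simp add: visit_def)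

text \<open>The local time counts the current visit, so it has grown strictly at every return. No
  trapping time is read twice, and for a given step sequence the times read are independent.\<close>

lemma visit_eq_iff: "visit \<xi> k = visit \<xi> l \<longleftrightarrow> k = l"
proof -
  have *: "visit \<xi> k \<noteq> visit \<xi> l" if kl: "k < l" for k l
  proof
    assume eq: "visit \<xi> k = visit \<xi> l"
    obtain i where l: "l = Suc i" "k \<le> i" using kl by (cases l) auto
    have "local_time (walk \<xi>) (walk \<xi> l) k \<le> local_time (walk \<xi>) (walk \<xi> l) i"
      by (rule local_time_mono[OF l(2)])
    also have "\<dots> < local_time (walk \<xi>) (walk \<xi> l) l" by (simp add: l local_time_Suc)
    finally have "local_time (walk \<xi>) (walk \<xi> l) k < local_time (walk \<xi>) (walk \<xi> l) l" .
    moreover have "local_time (walk \<xi>) (walk \<xi> l) k = local_time (walk \<xi>) (walk \<xi> l) l"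
      using eq by (metis visit_def prod.inject)
    ultimately show False by simp
  qed
  show ?thesis using *[of k l] *[of l k] by (metis linorder_neqE_nat)
qed

lemma local_time_measurable:
  "(\<lambda>\<xi>. local_time (walk \<xi>) (walk \<xi> k) n) \<in> measurable step_space (count_space UNIV)"
proof (induction n)
  case 0
  have "(\<lambda>\<xi>. if walk \<xi> 0 = walk \<xi> k then 1 else 0::nat) \<in> measurable step_space (count_space UNIV)" by measurable
  then show ?case by (simp add: local_time_def)
next
  case (Suc n)
  show ?case unfolding local_time_Suc
    by (rule measurable_compose_countable[OF _ Suc, of "\<lambda>i \<xi>. i + (if walk \<xi> (Suc n) = walk \<xi> k then 1 else 0)"]) measurable
qed

lemma visit_measurable: "(\<lambda>\<xi>. visit \<xi> k) \<in> measurable step_space (count_space (UNIV \<times> {1..}))"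
proof -
  have "(\<lambda>\<xi>. visit \<xi> k) \<in> measurable step_space (count_space UNIV)"
    unfolding visit_def
    by (rule measurable_compose_countable[OF _ walk_measurable, of "\<lambda>z \<xi>. (z, local_time (walk \<xi>) (walk \<xi> k) k)"])
      (rule measurable_compose[OF local_time_measurable], simp)
  then have m: "(\<lambda>\<xi>. visit \<xi> k) -` A \<inter> space step_space \<in> sets step_space" for A
    by (rule measurable_sets) simp
  show ?thesis by (rule measurableI) (use visit_in m in auto)
qed

locale quenched =
  fixes p :: "int \<Rightarrow> real measure"
  assumes trap: "trap_law (p z)"
begin

abbreviation "slots \<equiv> (UNIV :: int set) \<times> {1 :: nat ..}"

definition traps :: "(int \<times> nat \<Rightarrow> real) measure" where
  "traps = Pi\<^sub>M slots (\<lambda>(z, i). p z)"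

abbreviation "Q \<equiv> step_space \<Otimes>\<^sub>M traps"

lemma quenched_space_eq: "quenched_space p = Q"
  by (simp add: quenched_space_def traps_def)

sublocale T: prob_space traps
  unfolding traps_def by (rule prob_space_PiM) (auto intro: trap_law_prob_space trap)

sublocale Q: pair_prob_space step_space traps ..

lemma traps_pos: "s \<in> space traps \<Longrightarrow> c \<in> slots \<Longrightarrow> 0 < s c"
  unfolding traps_def using trap_law_space[OF trap]
  by (cases c) (auto simp: space_PiM PiE_iff)

lemma coordinate_distr: "c \<in> slots \<Longrightarrow> distr traps (p (fst c)) (\<lambda>s. s c) = p (fst c)"
  unfolding traps_def
  using distr_PiM_component[of slots "\<lambda>(z, i). p z" c] trap_law_prob_space[OF trap]
  by (auto simp: case_prod_beta)

lemma coordinate_measurable_trap: "c \<in> slots \<Longrightarrow> (\<lambda>s. s c) \<in> measurable traps (p (fst c))"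
  unfolding traps_def using measurable_component_singleton[of c slots "\<lambda>(z, i). p z"]
  by (simp add: case_prod_beta)

lemma coordinate_measurable: "c \<in> slots \<Longrightarrow> (\<lambda>s. s c) \<in> borel_measurable traps"
  by (rule measurable_compose[OF coordinate_measurable_trap trap_law_ident_measurable[OF trap]])

lemma coordinate_indep: "T.indep_vars (\<lambda>c. p (fst c)) (\<lambda>c s. s c) slots"
proof -
  have e: "(\<lambda>(z, i :: nat). p z) = (\<lambda>c. p (fst c))" by auto
  show ?thesis unfolding traps_def e
    by (rule indep_vars_PiM_coordinates) (auto intro: trap_law_prob_space trap)
qed

text \<open>A coordinate at a random index: since there are countably many slots, measurability may
  be checked slot by slot.\<close>

lemma trap_time_measurable [measurable]: "(\<lambda>q. snd q (visit (fst q) k)) \<in> borel_measurable Q"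
proof (rule measurable_compose_countable'[where I=slots and f="\<lambda>c q. snd q c" and g="\<lambda>q. visit (fst q) k"])
  show "(\<lambda>q. snd q c) \<in> borel_measurable Q" if "c \<in> slots" for c
    by (rule measurable_compose[OF measurable_snd coordinate_measurable[OF that]])
  show "(\<lambda>q. visit (fst q) k) \<in> measurable Q (count_space slots)"
    by (rule measurable_compose[OF measurable_fst visit_measurable])
qed simp

lemma clock_measurable: "(\<lambda>q. clock (walk (fst q)) (snd q) n) \<in> borel_measurable Q"
  unfolding clock_visit by measurable

lemma walk_measurable_Q [measurable]: "(\<lambda>q. walk (fst q) n) \<in> measurable Q (count_space UNIV)"
  by (rule measurable_compose[OF measurable_fst walk_measurable])

lemma clock_strict_mono: "q \<in> space Q \<Longrightarrow> strict_mono (clock (walk (fst q)) (snd q))"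
  unfolding strict_mono_Suc_iff clock_visit
  using traps_pos[OF _ visit_in] by (auto simp: space_pair_measure)

text \<open>With the steps fixed, the centred truncated times sit at distinct slots and are
  orthogonal, leaving only the \<open>n\<close> diagonal terms.\<close>

lemma truncated_deviation:
  assumes K: "0 \<le> K"
  shows "(\<integral>\<^sup>+q. ennreal ((\<Sum>k<n. min (snd q (visit (fst q) k)) K - trunc_mean K (p (walk (fst q) k)))\<^sup>2) \<partial>Q)
    \<le> ennreal (K\<^sup>2 * real n)"
proof -
  define X where "X c s = min (s c) K - trunc_mean K (p (fst c))" for c :: "int \<times> nat" and s
  have Xm: "X c \<in> borel_measurable traps" if "c \<in> slots" for c
    unfolding X_def using coordinate_measurable[OF that] by measurable
  have Xb: "\<bar>X c s\<bar> \<le> K" if "c \<in> slots" "s \<in> space traps" for c s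
    using traps_pos[OF that(2,1)] trunc_mean_bounds[OF trap K, of "fst c"] K unfolding X_def by linarith
  have Xi: "integrable traps (X c)" if "c \<in> slots" for c
    by (rule T.integrable_const_bound[of _ K]) (use Xb[OF that] Xm[OF that] in auto)
  have X0: "T.expectation (X c) = 0" if c: "c \<in> slots" for c
  proof -
    interpret P: prob_space "p (fst c)" by (rule trap_law_prob_space[OF trap])
    have g: "(\<lambda>x. min x K - trunc_mean K (p (fst c))) \<in> borel_measurable (p (fst c))"
      by (rule trap_law_measurable[OF trap]) measurable
    have "T.expectation (X c) = (\<integral>x. min x K - trunc_mean K (p (fst c)) \<partial>distr traps (p (fst c)) (\<lambda>s. s c))"
      unfolding X_def by (rule integral_distr[symmetric, OF coordinate_measurable_trap[OF c] g])
    also have "\<dots> = 0"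
      unfolding coordinate_distr[OF c] using trunc_integrable[OF trap K, of "fst c"]
      by (simp add: P.prob_space trunc_mean_def)
    finally show ?thesis .
  qed
  have "T.indep_vars (\<lambda>_. borel) X slots"
    unfolding X_def[abs_def]
    by (rule T.indep_vars_compose2[OF coordinate_indep, of "\<lambda>c x. min x K - trunc_mean K (p (fst c))"])
      (rule trap_law_measurable[OF trap], measurable)
  note orth = T.indep_vars_orthogonal[OF this _ _ _ Xi X0]
  have inner: "(\<integral>\<^sup>+s. ennreal ((\<Sum>k<n. X (visit \<xi> k) s)\<^sup>2) \<partial>traps) \<le> ennreal (K\<^sup>2 * real n)" for \<xi>
  proof -
    have "integrable traps (\<lambda>s. (\<Sum>k<n. X (visit \<xi> k) s)\<^sup>2)"
    proof (rule T.integrable_const_bound[of _ "(real n * K)\<^sup>2"])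
      show "AE s in traps. norm ((\<Sum>k<n. X (visit \<xi> k) s)\<^sup>2) \<le> (real n * K)\<^sup>2"
      proof (rule AE_I2)
        fix s assume s: "s \<in> space traps"
        have "\<bar>\<Sum>k<n. X (visit \<xi> k) s\<bar> \<le> (\<Sum>k<n. \<bar>X (visit \<xi> k) s\<bar>)" by (rule sum_abs)
        also have "\<dots> \<le> real (card {..<n}) * K" by (rule sum_bounded_above) (rule Xb[OF visit_in s])
        finally have "\<bar>\<Sum>k<n. X (visit \<xi> k) s\<bar>\<^sup>2 \<le> (real n * K)\<^sup>2" by (intro power_mono) auto
        then show "norm ((\<Sum>k<n. X (visit \<xi> k) s)\<^sup>2) \<le> (real n * K)\<^sup>2" by simp
      qed
      show "(\<lambda>s. (\<Sum>k<n. X (visit \<xi> k) s)\<^sup>2) \<in> borel_measurable traps"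
        by (intro borel_measurable_power borel_measurable_sum Xm visit_in)
    qed
    then have "(\<integral>\<^sup>+s. ennreal ((\<Sum>k<n. X (visit \<xi> k) s)\<^sup>2) \<partial>traps) = ennreal (T.expectation (\<lambda>s. (\<Sum>k<n. X (visit \<xi> k) s)\<^sup>2))"
      by (intro nn_integral_eq_integral) auto
    also have "\<dots> \<le> ennreal (K\<^sup>2 * (\<Sum>k<n. \<Sum>l<n. if visit \<xi> k = visit \<xi> l then 1 else 0))"
      by (intro ennreal_leI T.sum_square_le[where I=slots] Xm Xb orth visit_in) auto
    also have "(\<Sum>k<n. \<Sum>l<n. if visit \<xi> k = visit \<xi> l then 1 else 0 :: real) = real n"
      unfolding visit_eq_iff by simp
    finally show ?thesis .
  qed
  let ?F = "\<lambda>q. ennreal ((\<Sum>k<n. min (snd q (visit (fst q) k)) K - trunc_mean K (p (walk (fst q) k)))\<^sup>2)"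
  have m: "?F \<in> borel_measurable Q" by measurable
  have "(\<integral>\<^sup>+q. ?F q \<partial>Q) = (\<integral>\<^sup>+\<xi>. \<integral>\<^sup>+s. ?F (\<xi>, s) \<partial>traps \<partial>step_space)"
    by (rule T.nn_integral_fst[OF m, symmetric])
  also have "\<dots> \<le> (\<integral>\<^sup>+\<xi>. ennreal (K\<^sup>2 * real n) \<partial>step_space)"
    using inner by (intro nn_integral_mono) (simp add: X_def visit_def)
  also have "\<dots> = ennreal (K\<^sup>2 * real n)" using steps.P.emeasure_space_1 by simp
  finally show ?thesis .
qed

lemma field_deviation:
  assumes g: "\<And>z. \<bar>g z\<bar> \<le> K"
  shows "(\<integral>\<^sup>+q. ennreal ((\<Sum>k<n. g (walk (fst q) k))\<^sup>2) \<partial>Q) = ennreal (field_square g n)"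
proof -
  let ?F = "\<lambda>q. ennreal ((\<Sum>k<n. g (walk (fst q) k))\<^sup>2)"
  have m: "?F \<in> borel_measurable Q" by measurable
  have "(\<integral>\<^sup>+q. ?F q \<partial>Q) = (\<integral>\<^sup>+\<xi>. \<integral>\<^sup>+s. ?F (\<xi>, s) \<partial>traps \<partial>step_space)"
    by (rule T.nn_integral_fst[OF m, symmetric])
  also have "\<dots> = (\<integral>\<^sup>+\<xi>. ennreal ((\<Sum>k<n. g (walk \<xi> k))\<^sup>2) \<partial>step_space)"
    by (simp add: T.emeasure_space_1)
  also have "\<dots> = ennreal (field_square g n)"
    unfolding field_square_def by (rule nn_integral_eq_integral[OF field_square_integrable[where g=g, OF g]]) auto
  finally show ?thesis .
qed

text \<open>Integrating the trapping times turns each term into the excess of the visited site;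
  integrating the walk then gives its sum against the Green function, where
  \<open>green_average_le\<close> applies.\<close>

lemma excess_deviation:
  assumes K: "0 \<le> K" and c: "0 \<le> c"
    and avg: "\<And>r. (\<Sum>x\<in>{- int r..int r}. excess K (p x)) \<le> ennreal (c * (2 * real r + 1))"
  shows "(\<integral>\<^sup>+q. ennreal (\<Sum>k<n. max 0 (snd q (visit (fst q) k) - K)) \<partial>Q) \<le> ennreal (c * real n)"
proof -
  let ?F = "\<lambda>q. ennreal (\<Sum>k<n. max 0 (snd q (visit (fst q) k) - K))"
  have m: "?F \<in> borel_measurable Q" by measurable
  have e: "(\<integral>\<^sup>+s. ennreal (max 0 (s (visit \<xi> k) - K)) \<partial>traps) = excess K (p (walk \<xi> k))" for \<xi> k
  proof -
    have g: "(\<lambda>x. ennreal (x - K)) \<in> borel_measurable (p (fst (visit \<xi> k)))"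
      by (rule trap_law_measurable[OF trap]) measurable
    have "(\<integral>\<^sup>+s. ennreal (max 0 (s (visit \<xi> k) - K)) \<partial>traps) = (\<integral>\<^sup>+s. ennreal (s (visit \<xi> k) - K) \<partial>traps)"
      by (intro nn_integral_cong) (simp add: max_def ennreal_neg)
    also have "\<dots> = (\<integral>\<^sup>+x. ennreal (x - K) \<partial>distr traps (p (fst (visit \<xi> k))) (\<lambda>s. s (visit \<xi> k)))"
      by (rule nn_integral_distr[symmetric, OF coordinate_measurable_trap[OF visit_in]]) (use g in simp)
    finally show ?thesis unfolding coordinate_distr[OF visit_in] by (simp add: excess_def visit_def)
  qed
  have inner: "(\<integral>\<^sup>+s. ennreal (\<Sum>k<n. max 0 (s (visit \<xi> k) - K)) \<partial>traps) = (\<Sum>k<n. excess K (p (walk \<xi> k)))" for \<xi>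
  proof -
    have "(\<integral>\<^sup>+s. ennreal (\<Sum>k<n. max 0 (s (visit \<xi> k) - K)) \<partial>traps)
        = (\<integral>\<^sup>+s. (\<Sum>k<n. ennreal (max 0 (s (visit \<xi> k) - K))) \<partial>traps)"
      by (intro nn_integral_cong sum_ennreal[symmetric]) auto
    also have "\<dots> = (\<Sum>k<n. \<integral>\<^sup>+s. ennreal (max 0 (s (visit \<xi> k) - K)) \<partial>traps)"
      by (intro nn_integral_sum measurable_compose[OF coordinate_measurable[OF visit_in],
            of "\<lambda>x. ennreal (max 0 (x - K))"]) measurable
    finally show ?thesis by (simp only: e)
  qed
  \<comment> \<open>Each excess is finite, being one term of a sum over a symmetric interval that
    \<open>avg\<close> bounds; this allows the passage to real sums.\<close>
  define w where "w x = enn2real (excess K (p x))" for x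
  have w: "excess K (p x) = ennreal (w x)" for x
  proof -
    have "excess K (p x) \<le> (\<Sum>x\<in>{- int (nat \<bar>x\<bar>)..int (nat \<bar>x\<bar>)}. excess K (p x))"
      by (rule member_le_sum) auto
    also have "\<dots> < \<infinity>" using avg[of "nat \<bar>x\<bar>"] by (simp add: order.strict_trans1)
    finally show ?thesis by (simp add: w_def)
  qed
  have w0: "0 \<le> w x" for x by (simp add: w_def)
  have "{\<xi> \<in> space step_space. walk \<xi> k = x} \<in> sets step_space" for k x by measurable
  then have s[measurable]: "{\<xi>. walk \<xi> k = x} \<in> sets step_space" for k x by simp
  have "(\<integral>\<^sup>+q. ?F q \<partial>Q) = (\<integral>\<^sup>+\<xi>. \<integral>\<^sup>+s. ?F (\<xi>, s) \<partial>traps \<partial>step_space)"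
    by (rule T.nn_integral_fst[OF m, symmetric])
  also have "\<dots> = (\<integral>\<^sup>+\<xi>. (\<Sum>k<n. excess K (p (walk \<xi> k))) \<partial>step_space)"
    by (simp add: inner)
  \<comment> \<open>An almost everywhere equality: sequences in \<open>step_space\<close> may have
    any integer steps, while confinement to \<open>{- int n..int n}\<close> needs steps of size
    1.\<close>
  also have "\<dots> = (\<integral>\<^sup>+\<xi>. (\<Sum>k<n. \<Sum>x\<in>{- int n..int n}. ennreal (w x) * indicator {\<xi>. walk \<xi> k = x} \<xi>) \<partial>step_space)"
  proof (rule nn_integral_cong_AE)
    show "AE \<xi> in step_space. (\<Sum>k<n. excess K (p (walk \<xi> k)))
        = (\<Sum>k<n. \<Sum>x\<in>{- int n..int n}. ennreal (w x) * indicator {\<xi>. walk \<xi> k = x} \<xi>)"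
      using steps_AE
    proof eventually_elim
      case (elim \<xi>)
      show ?case
      proof (rule sum.cong[OF refl])
        fix k assume k: "k \<in> {..<n}"
        then have "walk \<xi> k \<in> {- int n..int n}" using walk_bounded[OF elim, of k] by auto
        moreover have "(\<Sum>x\<in>{- int n..int n}. ennreal (w x) * indicator {\<xi>. walk \<xi> k = x} \<xi>)
            = (\<Sum>x\<in>{- int n..int n}. if x = walk \<xi> k then ennreal (w x) else 0)"
          by (intro sum.cong) (auto simp: indicator_def)
        ultimately show "excess K (p (walk \<xi> k)) = (\<Sum>x\<in>{- int n..int n}. ennreal (w x) * indicator {\<xi>. walk \<xi> k = x} \<xi>)"
          by (simp add: w)
      qed
    qed
  qed
  also have "\<dots> = (\<Sum>k<n. \<Sum>x\<in>{- int n..int n}. ennreal (w x) * emeasure step_space {\<xi>. walk \<xi> k = x})"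
  proof -
    have "(\<integral>\<^sup>+\<xi>. (\<Sum>k<n. \<Sum>x\<in>{- int n..int n}. ennreal (w x) * indicator {\<xi>. walk \<xi> k = x} \<xi>) \<partial>step_space)
        = (\<Sum>k<n. \<integral>\<^sup>+\<xi>. (\<Sum>x\<in>{- int n..int n}. ennreal (w x) * indicator {\<xi>. walk \<xi> k = x} \<xi>) \<partial>step_space)"
      by (rule nn_integral_sum) (intro borel_measurable_sum borel_measurable_times_ennreal borel_measurable_const borel_measurable_indicator s)
    also have "\<dots> = (\<Sum>k<n. \<Sum>x\<in>{- int n..int n}. \<integral>\<^sup>+\<xi>. ennreal (w x) * indicator {\<xi>. walk \<xi> k = x} \<xi> \<partial>step_space)"
      by (intro sum.cong refl nn_integral_sum borel_measurable_times_ennreal borel_measurable_const borel_measurable_indicator s)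
    also have "\<dots> = (\<Sum>k<n. \<Sum>x\<in>{- int n..int n}. ennreal (w x) * emeasure step_space {\<xi>. walk \<xi> k = x})"
      by (intro sum.cong refl nn_integral_cmult_indicator s)
    finally show ?thesis .
  qed
  also have "\<dots> = ennreal (\<Sum>k<n. \<Sum>x\<in>{- int n..int n}. w x * walk_prob k x)"
    by (simp add: steps.P.emeasure_eq_measure walk_prob_def[symmetric] ennreal_mult[symmetric] w0 walk_prob_nonneg
        sum_ennreal sum_nonneg)
  also have "(\<Sum>k<n. \<Sum>x\<in>{- int n..int n}. w x * walk_prob k x) = (\<Sum>x\<in>{- int n..int n}. green n x * w x)"
    unfolding green_def sum_distrib_right by (subst sum.swap) (simp add: mult.commute)
  also have "ennreal \<dots> \<le> ennreal (c * real n)"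
  proof (intro ennreal_leI green_average_le c)
    fix r
    have "ennreal (\<Sum>x\<in>{- int r..int r}. w x) \<le> ennreal (c * (2 * real r + 1))"
      using avg[of r] by (simp add: w w0)
    then show "(\<Sum>x\<in>{- int r..int r}. w x) \<le> c * (2 * real r + 1)"
      using c by (simp add: ennreal_le_iff)
  qed
  finally show ?thesis .
qed

text \<open>Each trapping time is split into a centred truncated part, the fluctuation of the
  truncated mean of its site, the excess over \<open>K\<close> and the constant
  \<open>\<mu> K\<close>. Chebyshev's inequality handles the first two, Markov's the third, and each
  error gets a quarter of \<open>\<delta> * n\<close>.\<close>

lemma clock_lln:
  assumes hom: "homogenizes M p" and \<delta>: "0 < \<delta>"
  shows "(\<lambda>n. measure Q {q\<in>space Q. \<delta> * real n < \<bar>clock (walk (fst q)) (snd q) n - M * real n\<bar>}) \<longlonglongrightarrow> 0"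
proof (rule LIMSEQ_I)
  fix r :: real assume r: "0 < r"
  obtain \<mu> :: "nat \<Rightarrow> real" where \<mu>: "\<And>K. 0 \<le> \<mu> K" "\<And>K. \<mu> K \<le> real K"
    and fs: "\<And>K. (\<lambda>n. field_square (\<lambda>z. trunc_mean (real K) (p z) - \<mu> K) n / (real n)\<^sup>2) \<longlonglongrightarrow> 0"
    and exc: "\<And>\<delta>. 0 < \<delta> \<Longrightarrow> \<exists>K. \<bar>M - \<mu> K\<bar> \<le> \<delta> \<and>
        (\<forall>r. (\<Sum>x\<in>{- int r..int r}. excess (real K) (p x)) \<le> ennreal (\<delta> * (2 * real r + 1)))"
    using hom unfolding homogenizes_def by blast
  \<comment> \<open>The first bound keeps \<open>\<bar>M - \<mu> K\<bar> * n\<close> within a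
    quarter of \<open>\<delta> * n\<close>; the second makes the Markov bound
    \<open>c * n / (\<delta> * n / 4)\<close> at most \<open>r / 2\<close>.\<close>
  define c where "c = min (\<delta> / 4) (r * \<delta> / 8)"
  have c: "0 < c" "c \<le> \<delta> / 4" "4 * c / \<delta> \<le> r / 2" using r \<delta> by (auto simp: c_def field_simps min_def)
  obtain K where K: "\<bar>M - \<mu> K\<bar> \<le> c"
    "\<And>r. (\<Sum>x\<in>{- int r..int r}. excess (real K) (p x)) \<le> ennreal (c * (2 * real r + 1))"
    using exc[OF c(1)] by blast
  define g where "g z = trunc_mean (real K) (p z) - \<mu> K" for z
  have g: "\<bar>g z\<bar> \<le> real K" for z
    using trunc_mean_bounds[OF trap, of "real K" z] \<mu>[of K] by (auto simp: g_def)
  let ?D = "\<lambda>n q. \<Sum>k<n. min (snd q (visit (fst q) k)) (real K) - trunc_mean (real K) (p (walk (fst q) k))"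
  let ?G = "\<lambda>n q. \<Sum>k<n. g (walk (fst q) k)"
  let ?E = "\<lambda>n q. \<Sum>k<n. max 0 (snd q (visit (fst q) k) - real K)"
  define b where "b n = 16 * (real K)\<^sup>2 / \<delta>\<^sup>2 * (1 / real n) + 16 / \<delta>\<^sup>2 * (field_square g n / (real n)\<^sup>2)" for n
  have "b \<longlonglongrightarrow> 16 * (real K)\<^sup>2 / \<delta>\<^sup>2 * 0 + 16 / \<delta>\<^sup>2 * 0"
    unfolding b_def g_def by (intro tendsto_intros fs lim_1_over_n)
  then have "b \<longlonglongrightarrow> 0" by simp
  then obtain n0 where n0: "\<And>n. n \<ge> n0 \<Longrightarrow> b n < r / 2"
    using order_tendstoD(2)[of b 0 sequentially "r / 2"] r by (auto simp: eventually_sequentially)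
  have le: "measure Q {q\<in>space Q. \<delta> * real n < \<bar>clock (walk (fst q)) (snd q) n - M * real n\<bar>} \<le> b n + r / 2"
    if n: "0 < n" for n
  proof -
    let ?t = "\<delta> * real n / 4"
    have t: "0 < ?t" using n \<delta> by simp
    let ?A1 = "{q\<in>space Q. ?t\<^sup>2 \<le> (?D n q)\<^sup>2}" and ?A2 = "{q\<in>space Q. ?t\<^sup>2 \<le> (?G n q)\<^sup>2}" and ?A3 = "{q\<in>space Q. ?t \<le> ?E n q}"
    have sub: "{q\<in>space Q. \<delta> * real n < \<bar>clock (walk (fst q)) (snd q) n - M * real n\<bar>} \<subseteq> ?A1 \<union> (?A2 \<union> ?A3)"
    proof
      fix q assume q: "q \<in> {q\<in>space Q. \<delta> * real n < \<bar>clock (walk (fst q)) (snd q) n - M * real n\<bar>}"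
      show "q \<in> ?A1 \<union> (?A2 \<union> ?A3)"
      proof (rule ccontr)
        assume "q \<notin> ?A1 \<union> (?A2 \<union> ?A3)"
        then have "(?D n q)\<^sup>2 < ?t\<^sup>2" "(?G n q)\<^sup>2 < ?t\<^sup>2" and E: "?E n q < ?t" using q by auto
        moreover have "\<bar>x\<bar> < ?t" if "x\<^sup>2 < ?t\<^sup>2" for x :: real
          by (rule power_less_imp_less_base[of _ 2]) (use that t in auto)
        ultimately have DG: "\<bar>?D n q\<bar> < ?t" "\<bar>?G n q\<bar> < ?t" by blast+
        have E0: "0 \<le> ?E n q" by (intro sum_nonneg) auto
        have clk: "clock (walk (fst q)) (snd q) n = ?D n q + ?G n q + ?E n q + \<mu> K * real n"
        proof -
          let ?s = "\<lambda>k. snd q (visit (fst q) k)"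
          have "?s k = (min (?s k) (real K) - trunc_mean (real K) (p (walk (fst q) k))) + g (walk (fst q) k)
              + max 0 (?s k - real K) + \<mu> K" for k
            by (simp add: g_def min_def max_def)
          then have "(\<Sum>k<n. ?s k) = (\<Sum>k<n. (min (?s k) (real K) - trunc_mean (real K) (p (walk (fst q) k)))
              + g (walk (fst q) k) + max 0 (?s k - real K) + \<mu> K)"
            by (rule sum.cong[OF refl])
          then show ?thesis unfolding clock_visit sum.distrib by simp
        qed
        have m: "\<bar>(\<mu> K - M) * real n\<bar> \<le> ?t"
        proof -
          have "\<bar>(\<mu> K - M) * real n\<bar> = \<bar>M - \<mu> K\<bar> * real n" by (simp add: abs_mult abs_minus_commute)
          also have "\<dots> \<le> \<delta> / 4 * real n" using K(1) c(2) by (intro mult_right_mono) auto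
          finally show ?thesis by simp
        qed
        have "\<bar>d + g + e + m\<bar> \<le> 4 * t" if "\<bar>d\<bar> < t" "\<bar>g\<bar> < t" "0 \<le> e" "e < t" "\<bar>m\<bar> \<le> t" for d g e m t :: real
          using that by linarith
        from this[OF DG E0 E m] have "\<bar>?D n q + ?G n q + ?E n q + (\<mu> K - M) * real n\<bar> \<le> \<delta> * real n"
          by simp
        moreover have "clock (walk (fst q)) (snd q) n - M * real n = ?D n q + ?G n q + ?E n q + (\<mu> K - M) * real n"
          unfolding clk by (simp only: left_diff_distrib)
        ultimately have "\<bar>clock (walk (fst q)) (snd q) n - M * real n\<bar> \<le> \<delta> * real n" by (simp only:)
        then show False using q by simp
      qed
    qed
    have sets: "?A1 \<in> sets Q" "?A2 \<in> sets Q" "?A3 \<in> sets Q" by measurable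
    have "measure Q {q\<in>space Q. \<delta> * real n < \<bar>clock (walk (fst q)) (snd q) n - M * real n\<bar>} \<le> measure Q (?A1 \<union> (?A2 \<union> ?A3))"
      using sub sets by (intro Q.P.finite_measure_mono) auto
    also have "\<dots> \<le> measure Q ?A1 + (measure Q ?A2 + measure Q ?A3)"
      using sets by (intro order_trans[OF measure_Un_le] add_mono order_refl measure_Un_le) auto
    also have "\<dots> \<le> (real K)\<^sup>2 * real n / ?t\<^sup>2 + (field_square g n / ?t\<^sup>2 + c * real n / ?t)"
    proof (intro add_mono)
      show "measure Q ?A1 \<le> (real K)\<^sup>2 * real n / ?t\<^sup>2"
        by (rule Q.P.markov_bound[OF _ truncated_deviation]) (use n t \<delta> in auto)
      show "measure Q ?A2 \<le> field_square g n / ?t\<^sup>2"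
        by (rule Q.P.markov_bound[OF _ eq_refl[OF field_deviation[where g=g, OF g]]]) (use n t \<delta> field_square_nonneg in auto)
      show "measure Q ?A3 \<le> c * real n / ?t"
        by (rule Q.P.markov_bound[OF _ excess_deviation[OF _ _ K(2)]]) (use n t c \<delta> in auto)
    qed
    also have "\<dots> = b n + 4 * c / \<delta>" using n \<delta> by (simp add: b_def field_simps power2_eq_square)
    finally show ?thesis using c(3) by linarith
  qed
  have "norm (measure Q {q\<in>space Q. \<delta> * real n < \<bar>clock (walk (fst q)) (snd q) n - M * real n\<bar>} - 0) < r"
    if "n \<ge> max n0 1" for n
    using le[of n] n0[of n] that by simp
  then show "\<exists>no. \<forall>n\<ge>no. norm (measure Q {q\<in>space Q. \<delta> * real n < \<bar>clock (walk (fst q)) (snd q) n - M * real n\<bar>} - 0) < r"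
    by blast
qed

end

section \<open>Weak convergence\<close>

text \<open>The defining sets are a subbase only, hence the induction over the generated topology.
  Being a probability measure is asked eventually, since the rescaled laws are considered for
  positive \<open>\<epsilon>\<close>.\<close>

lemma limitin_weak_topology:
  assumes \<mu>: "\<mu> \<in> prob_measures X" and ev: "\<forall>\<^sub>F i in F. \<mu>s i \<in> prob_measures X"
    and conv: "\<And>f. continuous_map X euclideanreal f \<Longrightarrow> bounded (f ` topspace X) \<Longrightarrow>
      ((\<lambda>i. \<integral>x. f x \<partial>\<mu>s i) \<longlongrightarrow> (\<integral>x. f x \<partial>\<mu>)) F"
  shows "limitin (weak_topology X) \<mu>s \<mu> F"
  unfolding limitin_def
proof (intro conjI allI impI)
  show "\<mu> \<in> topspace (weak_topology X)" using \<mu> by simp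
  fix U assume "openin (weak_topology X) U \<and> \<mu> \<in> U"
  then have "generate_topology_on {{\<nu> \<in> prob_measures X. (\<integral>x. f x \<partial>\<nu>) \<in> U} |f U.
      continuous_map X euclideanreal f \<and> bounded (f ` topspace X) \<and> open U} U" and "\<mu> \<in> U"
    unfolding weak_topology_def openin_topology_generated_by_iff by auto
  then show "\<forall>\<^sub>F i in F. \<mu>s i \<in> U"
  proof (induction rule: generate_topology_on.induct)
    case (Int a b)
    then show ?case by (auto intro: eventually_conj)
  next
    case (UN K)
    then obtain k where "k \<in> K" "\<mu> \<in> k" by blast
    then have "\<forall>\<^sub>F i in F. \<mu>s i \<in> k" using UN by blast
    then show ?case by eventually_elim (use \<open>k \<in> K\<close> in blast)
  next
    case (Basis s)
    then obtain f V where f: "continuous_map X euclideanreal f" "bounded (f ` topspace X)" "open V"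
      and s: "s = {\<nu> \<in> prob_measures X. (\<integral>x. f x \<partial>\<nu>) \<in> V}" by blast
    have "(\<integral>x. f x \<partial>\<mu>) \<in> V" using Basis(2) s by simp
    then have "\<forall>\<^sub>F i in F. (\<integral>x. f x \<partial>\<mu>s i) \<in> V" using topological_tendstoD[OF conv[OF f(1,2)] f(3)] by blast
    with ev show ?case by eventually_elim (simp add: s)
  qed simp
qed

lemma continuous_map_borel_of_measurable:
  assumes "continuous_map X euclideanreal f"
  shows "f \<in> borel_measurable (borel_of X)"
proof (rule borel_measurableI)
  fix U :: "real set" assume "open U"
  then have "openin X {x \<in> topspace X. f x \<in> U}"
    using openin_continuous_map_preimage[OF assms, of U] by simp
  then have "{x \<in> topspace X. f x \<in> U} \<in> sets (borel_of X)" by (rule sets_borel_of_open)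
  then show "f -` U \<inter> space (borel_of X) \<in> sets (borel_of X)" by (simp add: vimage_def Int_def conj_commute)
qed

lemma distr_prob_measures:
  assumes "prob_space A" "g \<in> measurable A (borel_of X)"
  shows "distr A (borel_of X) g \<in> prob_measures X"
  unfolding prob_measures_def using prob_space.prob_space_distr[OF assms] by simp

section \<open>Envelopes as functions of finitely many increments\<close>

lemma lip_env_step_cong:
  assumes "\<And>i. i \<le> k * m \<Longrightarrow> v i = w i"
  shows "lip_env f k (step_path m v) = lip_env f k (step_path m w)"
proof -
  have "sup_dist k (step_path m v) y = sup_dist k (step_path m w) y" for y
    unfolding sup_dist_def step_path_def by (intro SUP_cong refl) (use assms[OF step_index_le] in auto)
  then show ?thesis by (simp add: lip_env_def)
qed

text \<open>Stopping at \<open>J\<close> makes every entry depend on the coordinates below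
  \<open>J\<close> alone, so it is measurable on the finite product.\<close>

definition partial_sums :: "nat \<Rightarrow> (nat \<Rightarrow> real) \<Rightarrow> nat \<Rightarrow> real" where
  "partial_sums J u i = (\<Sum>j<min i J. u j)"

lemma partial_sums_telescope:
  assumes "i \<le> J"
  shows "partial_sums J (\<lambda>j\<in>{..<J}. v (Suc j) - v j) i = v i - v 0"
proof -
  have "partial_sums J (\<lambda>j\<in>{..<J}. v (Suc j) - v j) i = (\<Sum>j<i. v (Suc j) - v j)"
    unfolding partial_sums_def using assms by (intro sum.cong) auto
  then show ?thesis by (simp add: sum_lessThan_telescope)
qed

context bounded_path_functional
begin

lemma env_partial_sums_measurable:
  "(\<lambda>u. lip_env f k (step_path m (partial_sums J u))) \<in> borel_measurable (Pi\<^sub>M {..<J} (\<lambda>_. borel))"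
  unfolding partial_sums_def[abs_def]
  by (intro env_step_measurable borel_measurable_sum measurable_component_singleton) auto

lemma env_partial_sums_tendsto:
  assumes "\<And>j. j < J \<Longrightarrow> (\<lambda>n. u n j) \<longlonglongrightarrow> w j"
  shows "(\<lambda>n. lip_env f k (step_path m (partial_sums J (u n)))) \<longlonglongrightarrow> lip_env f k (step_path m (partial_sums J w))"
  by (intro env_tendsto_of_sup_dist step_path_tendsto)
    (unfold partial_sums_def, intro tendsto_sum assms, auto)

end

section \<open>Comparison of the rescaled walk with its block skeleton\<close>

context quenched
begin

lemma fst_distr: "distr Q step_space fst = step_space"
  by (rule T.distr_pair_fst)

text \<open>A clock that stayed bounded would deviate from \<open>M * n\<close> by more than
  \<open>M / 2 * n\<close> for all large \<open>n\<close>, and the probability of such a deviation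
  tends to 0.\<close>

lemma clock_jump_times_AE:
  assumes hom: "homogenizes M p" and M: "0 < M"
  shows "AE q in Q. jump_times (clock (walk (fst q)) (snd q))"
proof -
  have "AE q in Q. \<exists>n. real m < clock (walk (fst q)) (snd q) n" for m :: nat
  proof -
    define B where "B = {q\<in>space Q. \<forall>n. clock (walk (fst q)) (snd q) n \<le> real m}"
    note clock_measurable[measurable]
    have Bs: "B \<in> sets Q" unfolding B_def by measurable
    obtain n0 :: nat where n0: "2 * real m / M < real n0" using reals_Archimedean2 by blast
    have "measure Q B \<le> measure Q {q\<in>space Q. M / 2 * real n < \<bar>clock (walk (fst q)) (snd q) n - M * real n\<bar>}"
      if n: "n \<ge> n0" for n
    proof (rule Q.P.finite_measure_mono)
      have "2 * real m / M < real n" using n0 n by (meson less_le_trans of_nat_le_iff)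
      then have "real m < M / 2 * real n" using M by (simp add: field_simps)
      then show "B \<subseteq> {q\<in>space Q. M / 2 * real n < \<bar>clock (walk (fst q)) (snd q) n - M * real n\<bar>}"
        by (auto simp: B_def dest!: spec[of _ n])
    qed measurable
    then have "measure Q B \<le> 0"
      using M by (intro LIMSEQ_le_const[OF clock_lln[OF hom, of "M / 2"]]) auto
    then have "measure Q B = 0" using measure_nonneg[of Q B] by linarith
    then have "emeasure Q B = 0" by (simp add: Q.P.emeasure_eq_measure)
    then have "AE q in Q. q \<notin> B" using Bs by (intro AE_not_in) (auto simp: null_sets_def)
    then show ?thesis using AE_space by eventually_elim (auto simp: B_def not_le)
  qed
  then have "AE q in Q. \<forall>m::nat. \<exists>n. real m < clock (walk (fst q)) (snd q) n"
    unfolding AE_all_countable by (rule allI)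
  then show ?thesis
    using AE_space
  proof eventually_elim
    case (elim q)
    then show ?case using clock_strict_mono[OF elim(2)] by (simp add: jump_times_def clock_def)
  qed
qed

definition rescaled :: "real \<Rightarrow> real \<Rightarrow> (nat \<Rightarrow> int) \<times> (int \<times> nat \<Rightarrow> real) \<Rightarrow> real \<Rightarrow> real" where
  "rescaled M \<epsilon> q = rescale M \<epsilon> (rtrw (walk (fst q)) (snd q))"

lemma rescaled_measurable:
  assumes "0 < M" "0 < \<epsilon>"
  shows "rescaled M \<epsilon> \<in> measurable Q (borel_of skorokhod_J1)"
  unfolding rescaled_def[abs_def]
  by (rule rescale_rtrw_measurable[OF walk_measurable_Q clock_measurable clock_strict_mono assms])

lemma rescaled_cadlag:
  assumes "0 < M" "0 < \<epsilon>" "q \<in> space Q"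
  shows "rescaled M \<epsilon> q \<in> cadlag_paths"
  using measurable_space[OF rescaled_measurable[OF assms(1,2)] assms(3)] by simp

text \<open>On the event that the clock is close to linear at multiples of \<open>h\<close> and the walk moves little
  within blocks of \<open>h\<close> steps, the index \<open>N\<close> of the walk at time \<open>M t/\<epsilon>\<^sup>2\<close> is at most one block away
  from block \<open>\<lfloor>t m\<rfloor>\<close>.\<close>

lemma rescaled_close_to_blocks:
  fixes k m h :: nat
  assumes M: "0 < M" and \<epsilon>: "0 < \<epsilon>" and m: "0 < m"
    and h: "real h \<le> 1 / (real m * \<epsilon>\<^sup>2)" "1 / (real m * \<epsilon>\<^sup>2) < real h + 1" "2 * (k * m + 1) \<le> h"
    and S: "jump_times (clock (walk \<xi>) s)"
    and clk: "\<And>j. j \<le> k * m + 2 \<Longrightarrow> \<bar>clock (walk \<xi>) s (j * h) - M * real (j * h)\<bar> \<le> M / 2 * real h"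
    and blk: "\<And>b j. b \<le> k * m + 1 \<Longrightarrow> j \<le> h \<Longrightarrow> \<bar>real_of_int (walk \<xi> (b * h + j) - walk \<xi> (b * h))\<bar> < \<eta> / (2 * \<epsilon>)"
    and t: "0 \<le> t" "t \<le> real k"
  shows "\<bar>rescale M \<epsilon> (rtrw (walk \<xi>) s) t - \<epsilon> * real_of_int (walk \<xi> (nat \<lfloor>t * real m\<rfloor> * h))\<bar> < \<eta>"
proof -
  define i where "i = nat \<lfloor>t * real m\<rfloor>"
  define a where "a = 1 / (real m * \<epsilon>\<^sup>2)"
  define T where "T = M * t / \<epsilon>\<^sup>2"
  have "real i = of_int \<lfloor>t * real m\<rfloor>" using t by (simp add: i_def)
  then have i: "real i \<le> t * real m" "t * real m < real i + 1" by linarith+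
  have i3: "i \<le> k * m" using step_index_le[OF t, of m] by (simp add: i_def)
  have a: "real h \<le> a" "a < real h + 1" using h by (auto simp: a_def)
  have Ta: "T = M * (t * real m) * a" using m \<epsilon> by (simp add: T_def a_def)
  have Ti: "M * real i * real h \<le> T"
    unfolding Ta using M i a t by (intro mult_mono) auto
  have Ti': "T < M * (real i + 1) * (real h + 1)"
  proof -
    have "M * (t * real m) * a \<le> M * (t * real m) * (real h + 1)"
      using M a t by (intro mult_left_mono) auto
    also have "\<dots> < M * (real i + 1) * (real h + 1)"
      using M i by (intro mult_strict_right_mono mult_strict_left_mono) auto
    finally show ?thesis by (simp add: Ta)
  qed
  have T0: "0 \<le> T" using M t by (simp add: T_def)
  obtain N where N: "clock (walk \<xi>) s N \<le> T" "T < clock (walk \<xi>) s (Suc N)"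
    using jump_times_index[OF S T0] by blast
  have X: "rescale M \<epsilon> (rtrw (walk \<xi>) s) t = \<epsilon> * real_of_int (walk \<xi> N)"
    using rtrw_eq[OF S N] t by (simp add: rescale_def T_def)
  \<comment> \<open>For \<open>i = 0\<close> truncated subtraction makes this trivial; otherwise
    half a block of clock error is absorbed by going back one block.\<close>
  have low: "(i - 1) * h \<le> N"
  proof (cases i)
    case (Suc i')
    have "clock (walk \<xi>) s (i' * h) \<le> M * real (i' * h) + M / 2 * real h"
      using clk[of i'] i3 Suc by linarith
    also have "\<dots> \<le> M * real i * real h" using M Suc by (simp add: algebra_simps)
    finally have "clock (walk \<xi>) s (i' * h) < clock (walk \<xi>) s (Suc N)" using Ti N by linarith
    then show ?thesis using Suc by (simp add: jump_times_less_iff[OF S] less_Suc_eq_le)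
  qed simp
  have up: "N < (i + 2) * h"
  proof -
    have "M * (real i + 1) * (real h + 1) = M * (real i + 1) * real h + M * (real i + 1)"
      by (simp add: algebra_simps)
    \<comment> \<open>Rounding \<open>1 / (m * \<epsilon>\<^sup>2)\<close> down to \<open>h\<close>
      costs at most \<open>M * (i + 1)\<close>, which \<open>h(3)\<close> limits to half a block;
      the clock error takes the other half.\<close>
    moreover have "M * (real i + 1) \<le> M * (real h / 2)"
    proof (rule mult_left_mono)
      have "real (2 * (k * m + 1)) \<le> real h" using h(3) by (simp only: of_nat_le_iff)
      moreover have "real i \<le> real (k * m)" using i3 by (simp only: of_nat_le_iff)
      ultimately show "real i + 1 \<le> real h / 2" by simp
    qed (use M in simp)
    moreover have "M * (real i + 1) * real h + M * (real h / 2) = M * real ((i + 2) * h) - M / 2 * real h"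
      by (simp add: algebra_simps)
    moreover have "M * real ((i + 2) * h) - M / 2 * real h \<le> clock (walk \<xi>) s ((i + 2) * h)"
      using clk[of "i + 2"] i3 by linarith
    ultimately have "clock (walk \<xi>) s N < clock (walk \<xi>) s ((i + 2) * h)" using N(1) Ti' by linarith
    then show ?thesis by (simp add: jump_times_less_iff[OF S])
  qed
  have h0: "0 < h" using h(3) by simp
  define b where "b = N div h"
  have Nb: "N = b * h + N mod h" by (simp add: b_def)
  have modh: "N mod h \<le> h" using h0 by (simp add: less_imp_le)
  have b1: "b < i + 2" using up by (simp add: b_def less_mult_imp_div_less)
  have b2: "i - 1 \<le> b" using low h0 by (simp add: b_def less_eq_div_iff_mult_less_eq)
  have near: "\<bar>real_of_int (walk \<xi> N - walk \<xi> (b * h))\<bar> < \<eta> / (2 * \<epsilon>)"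
    using blk[of b "N mod h"] modh b1 i3 Nb by simp
  have step: "\<bar>real_of_int (walk \<xi> (b * h) - walk \<xi> (i * h))\<bar> < \<eta> / (2 * \<epsilon>)"
  proof -
    consider "b = i" | "b = i + 1" | "i = b + 1" using b1 b2 by linarith
    then show ?thesis
    proof cases
      case 1
      \<comment> \<open>The difference vanishes; the block bound at 0 only supplies the positivity
        of \<open>\<eta> / (2 * \<epsilon>)\<close>.\<close>
      then show ?thesis using blk[of 0 0] by simp
    next
      case 2
      then show ?thesis using blk[of i h] i3 by (simp add: add.commute)
    next
      case 3
      then show ?thesis using blk[of b h] i3 by (simp add: add.commute abs_minus_commute)
    qed
  qed
  have "\<bar>real_of_int (walk \<xi> N) - real_of_int (walk \<xi> (i * h))\<bar> < \<eta> / \<epsilon>"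
    using near step by (simp add: field_simps)
  then have "\<epsilon> * \<bar>real_of_int (walk \<xi> N) - real_of_int (walk \<xi> (i * h))\<bar> < \<eta>"
    using \<epsilon> by (simp add: field_simps)
  then show ?thesis
    unfolding X i_def[symmetric] right_diff_distrib[symmetric] abs_mult using \<epsilon> by simp
qed

text \<open>The law of large numbers at time \<open>j * h n\<close> with tolerance
  \<open>M / (2 * j)\<close>, which turns into half the mean duration of one block.\<close>

lemma clock_block_tendsto:
  fixes h :: "nat \<Rightarrow> nat"
  assumes hom: "homogenizes M p" and M: "0 < M" and h: "filterlim h at_top sequentially"
  shows "(\<lambda>n. measure Q {q\<in>space Q. M / 2 * real (h n) < \<bar>clock (walk (fst q)) (snd q) (j * h n) - M * real (j * h n)\<bar>})
    \<longlonglongrightarrow> 0"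
proof (cases "j = 0")
  case True
  have "\<not> M * real x < 0" for x using M by (simp add: not_less)
  then show ?thesis using True by (simp add: clock_def)
next
  case False
  have "filterlim (\<lambda>n. j * h n) at_top sequentially"
    by (rule filterlim_at_top_mono[OF h]) (use False in auto)
  from filterlim_compose[OF clock_lln[OF hom, of "M / (2 * real j)"] this]
  show ?thesis using M False by simp
qed

lemma block_oscillation_le:
  assumes "0 < \<epsilon>" "0 < \<eta>" "0 < m" "real h * \<epsilon>\<^sup>2 \<le> 1 / real m"
  shows "{q\<in>space Q. \<exists>j\<le>h. \<eta> / (2 * \<epsilon>) \<le> \<bar>real_of_int (walk (fst q) (i + j) - walk (fst q) i)\<bar>} \<in> sets Q"
    and "measure Q {q\<in>space Q. \<exists>j\<le>h. \<eta> / (2 * \<epsilon>) \<le> \<bar>real_of_int (walk (fst q) (i + j) - walk (fst q) i)\<bar>}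
      \<le> 48 / ((real m)\<^sup>2 * \<eta> ^ 4)"
proof -
  let ?a = "\<eta> / (2 * \<epsilon>)"
  let ?A = "{\<xi>. \<exists>j\<le>h. ?a \<le> \<bar>real_of_int (walk \<xi> (i + j) - walk \<xi> i)\<bar>}"
  have "Measurable.pred step_space (\<lambda>\<xi>. \<exists>j\<le>h. ?a \<le> \<bar>0 + real_of_int (walk (\<lambda>n. \<xi> (i + n)) j)\<bar>)"
    by (rule measurable_compose[OF shift_measurable walk_max_pred])
  then have A: "?A \<in> sets step_space" by (simp add: walk_shift pred_def)
  have e: "{q\<in>space Q. \<exists>j\<le>h. ?a \<le> \<bar>real_of_int (walk (fst q) (i + j) - walk (fst q) i)\<bar>} = fst -` ?A \<inter> space Q"
    by auto
  show "{q\<in>space Q. \<exists>j\<le>h. ?a \<le> \<bar>real_of_int (walk (fst q) (i + j) - walk (fst q) i)\<bar>} \<in> sets Q"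
    unfolding e by (rule measurable_sets[OF measurable_fst A])
  have "measure Q (fst -` ?A \<inter> space Q) = measure step_space ?A"
    using measure_distr[OF measurable_fst A, of traps] unfolding fst_distr by (rule sym)
  also have "\<dots> \<le> 3 * (real h)\<^sup>2 / ?a ^ 4" by (rule walk_block_max) (use assms in simp)
  \<comment> \<open>The constant is \<open>3 * 2 ^ 4\<close>, the power of 2 coming from the
    threshold \<open>\<eta> / (2 * \<epsilon>)\<close>.\<close>
  also have "\<dots> = 48 * (real h * \<epsilon>\<^sup>2)\<^sup>2 / \<eta> ^ 4"
    by (simp add: power_divide power_mult_distrib power_mult[symmetric])
  also have "\<dots> \<le> 48 * (1 / real m)\<^sup>2 / \<eta> ^ 4"
    using assms by (intro divide_right_mono mult_left_mono power_mono) auto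
  also have "\<dots> = 48 / ((real m)\<^sup>2 * \<eta> ^ 4)" by (simp add: power_divide)
  finally show "measure Q {q\<in>space Q. \<exists>j\<le>h. ?a \<le> \<bar>real_of_int (walk (fst q) (i + j) - walk (fst q) i)\<bar>}
      \<le> 48 / ((real m)\<^sup>2 * \<eta> ^ 4)" unfolding e .
qed

end

text \<open>One-sided because envelopes lie below \<open>f\<close>. The choice order is
  \<open>k\<close>, then \<open>\<eta>\<close>, then \<open>m\<close>, then \<open>n\<close>. Six
  errors of at most \<open>r / 6\<close> are spent: envelope, grid, central limit theorem,
  \<open>k * \<eta>\<close>, clock and block oscillation.\<close>

lemma (in quenched) rescaled_liminf:
  fixes N :: "'b measure" and B :: "real \<Rightarrow> 'b \<Rightarrow> real"
  assumes hom: "homogenizes M p" and M: "0 < M" and BM: "standard_brownian_motion N B"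
    and f: "continuous_map skorokhod_J1 euclideanreal f"
    and C: "\<And>x. x \<in> cadlag_paths \<Longrightarrow> \<bar>f x\<bar> \<le> C"
    and \<epsilon>: "\<And>n. 0 < \<epsilon> n" "\<epsilon> \<longlonglongrightarrow> 0" and r: "0 < r"
  shows "\<forall>\<^sub>F n in sequentially. (\<integral>w. f (\<lambda>t\<in>{0..}. B t w) \<partial>N) - r \<le> (\<integral>q. f (rescaled M (\<epsilon> n) q) \<partial>Q)"
proof -
  interpret bounded_path_functional f C by standard (rule C)
  interpret N: prob_space N using BM by (simp add: standard_brownian_motion_def)
  have Bm: "B t \<in> borel_measurable N" if "t \<ge> 0" for t
    using BM that by (simp add: standard_brownian_motion_def)
  have Bc: "continuous_on {0..} (\<lambda>t. B t w)" and B0: "B 0 w = 0" if "w \<in> space N" for w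
    using BM that by (simp_all add: standard_brownian_motion_def)
  have fm: "f \<in> borel_measurable (borel_of skorokhod_J1)" by (rule continuous_map_borel_of_measurable[OF f])
  have lsc: "\<exists>T>0. \<exists>d>0. \<forall>y\<in>J1_nbhd x T d. f x - \<eta> < f y" if x: "x \<in> cadlag_paths" and \<eta>: "0 < \<eta>" for x \<eta>
  proof -
    have "openin skorokhod_J1 {y \<in> topspace skorokhod_J1. f y \<in> {f x - \<eta><..}}"
      by (rule openin_continuous_map_preimage[OF f]) simp
    moreover have "x \<in> {y \<in> topspace skorokhod_J1. f y \<in> {f x - \<eta><..}}" using x \<eta> by simp
    ultimately obtain T d where "T > 0" "d > 0" "J1_nbhd x T d \<subseteq> {y \<in> topspace skorokhod_J1. f y \<in> {f x - \<eta><..}}"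
      unfolding openin_skorokhod_J1 by blast
    then show ?thesis by (intro exI[of _ T] conjI exI[of _ d]) auto
  qed
  define L where "L = (\<integral>w. f (\<lambda>t\<in>{0..}. B t w) \<partial>N)"
  have "(\<lambda>k. \<integral>w. lip_env f k (\<lambda>t. B t w) \<partial>N) \<longlonglongrightarrow> L"
    unfolding L_def
  proof (rule integral_dominated_convergence[where w="\<lambda>_. C"])
    show "(\<lambda>w. f (\<lambda>t\<in>{0..}. B t w)) \<in> borel_measurable N"
      by (rule measurable_compose[OF continuous_process_measurable[OF Bm Bc] fm])
    show "(\<lambda>w. lip_env f k (\<lambda>t. B t w)) \<in> borel_measurable N" for k
      by (rule env_continuous_measurable[OF Bm Bc])
    show "AE w in N. (\<lambda>k. lip_env f k (\<lambda>t. B t w)) \<longlonglongrightarrow> f (\<lambda>t\<in>{0..}. B t w)"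
    proof (rule AE_I2)
      fix w assume "w \<in> space N"
      then have x: "(\<lambda>t\<in>{0..}. B t w) \<in> cadlag_paths" by (rule cadlag_paths_continuous[OF Bc])
      from env_tendsto[OF x lsc[OF x]]
      show "(\<lambda>k. lip_env f k (\<lambda>t. B t w)) \<longlonglongrightarrow> f (\<lambda>t\<in>{0..}. B t w)" by (simp add: env_restrict)
    qed
    show "AE w in N. norm (lip_env f k (\<lambda>t. B t w)) \<le> C" for k
    proof (rule AE_I2)
      fix w assume "w \<in> space N"
      then have x: "(\<lambda>t\<in>{0..}. B t w) \<in> cadlag_paths" by (rule cadlag_paths_continuous[OF Bc])
      show "norm (lip_env f k (\<lambda>t. B t w)) \<le> C"
        using env_le[OF x, of k] env_ge[of k "\<lambda>t. B t w"] C[OF x] by (simp add: env_restrict)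
    qed
  qed simp
  then have "\<forall>\<^sub>F k in sequentially. L - r / 6 < (\<integral>w. lip_env f k (\<lambda>t. B t w) \<partial>N)"
    using r by (intro order_tendstoD(1)) auto
  then have "\<forall>\<^sub>F k in sequentially. 0 < k \<and> L - r / 6 < (\<integral>w. lip_env f k (\<lambda>t. B t w) \<partial>N)"
    by (intro eventually_conj eventually_gt_at_top)
  then obtain k where k: "0 < k" "L - r / 6 < (\<integral>w. lip_env f k (\<lambda>t. B t w) \<partial>N)"
    by (auto simp: eventually_sequentially)
  define \<eta> where "\<eta> = r / (6 * real k)"
  have \<eta>: "0 < \<eta>" "real k * \<eta> = r / 6" using r k by (auto simp: \<eta>_def)
  let ?S = "\<lambda>m w. lip_env f k (step_path m (\<lambda>i. B (real i / real m) w))"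
  have "(\<lambda>m. \<integral>w. ?S (Suc m) w \<partial>N) \<longlonglongrightarrow> (\<integral>w. lip_env f k (\<lambda>t. B t w) \<partial>N)"
  proof (rule integral_dominated_convergence[where w="\<lambda>_. C + real k"])
    show "(\<lambda>w. lip_env f k (\<lambda>t. B t w)) \<in> borel_measurable N"
      by (rule env_continuous_measurable[OF Bm Bc])
    show "?S (Suc m) \<in> borel_measurable N" for m
      by (rule env_step_measurable, rule Bm) simp
    show "AE w in N. (\<lambda>m. ?S (Suc m) w) \<longlonglongrightarrow> lip_env f k (\<lambda>t. B t w)"
      by (rule AE_I2, rule env_tendsto_of_sup_dist, rule step_path_continuous_tendsto[OF Bc])
    show "AE w in N. norm (?S (Suc m) w) \<le> C + real k" for m
      using env_abs_le by simp
  qed simp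
  then have ev1: "\<forall>\<^sub>F m in sequentially. L - r / 6 - r / 6 < (\<integral>w. ?S (Suc m) w \<partial>N)"
    using r k by (intro order_tendstoD(1)) auto
  \<comment> \<open>This is \<open>k * (k * m + 2) * 48 / (m\<^sup>2 * \<eta> ^ 4)\<close>, the cost
    of the union bound over blocks, written in powers of \<open>1 / m\<close>.\<close>
  have "(\<lambda>m. real k * (48 / \<eta> ^ 4 * (real k * (1 / real (Suc m)) + 2 * ((1 / real (Suc m)) * (1 / real (Suc m))))))
      \<longlonglongrightarrow> real k * (48 / \<eta> ^ 4 * (real k * 0 + 2 * (0 * 0)))"
    by (intro tendsto_intros lim_1_over_n[THEN LIMSEQ_Suc])
  then have ev2: "\<forall>\<^sub>F m in sequentially. real k * (48 / \<eta> ^ 4 * (real k * (1 / real (Suc m)) + 2 * ((1 / real (Suc m)) * (1 / real (Suc m))))) < r / 6"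
    using r by (intro order_tendstoD(2)) auto
  obtain m' where m': "L - r / 6 - r / 6 < (\<integral>w. ?S (Suc m') w \<partial>N)"
    "real k * (48 / \<eta> ^ 4 * (real k * (1 / real (Suc m')) + 2 * ((1 / real (Suc m')) * (1 / real (Suc m'))))) < r / 6"
    using eventually_conj[OF ev1 ev2] by (auto simp: eventually_sequentially)
  define m where "m = Suc m'"
  have m: "0 < m" by (simp add: m_def)
  define J where "J = k * m"
  have J: "0 < J" using k m by (simp add: J_def)
  have blocks: "real k * (real (J + 2) * (48 / ((real m)\<^sup>2 * \<eta> ^ 4))) < r / 6"
  proof -
    have "real k * (real (J + 2) * (48 / ((real m)\<^sup>2 * \<eta> ^ 4)))
        = real k * (48 / \<eta> ^ 4 * (real k * (1 / real m) + 2 * ((1 / real m) * (1 / real m))))"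
      using m \<eta> by (simp add: J_def field_simps power2_eq_square)
    then show ?thesis using m'(2) by (simp add: m_def)
  qed
  \<comment> \<open>A block of \<open>h n\<close> steps of size \<open>\<epsilon> n\<close> has
    variance close to \<open>1 / m\<close>, so blocks match the cells of the time grid of mesh
    \<open>1 / m\<close>.\<close>
  define h where "h n = nat \<lfloor>1 / (real m * (\<epsilon> n)\<^sup>2)\<rfloor>" for n
  have h: "real (h n) \<le> 1 / (real m * (\<epsilon> n)\<^sup>2)" "1 / (real m * (\<epsilon> n)\<^sup>2) < real (h n) + 1" for n
  proof -
    have "0 \<le> 1 / (real m * (\<epsilon> n)\<^sup>2)" by simp
    then have "real (h n) = of_int \<lfloor>1 / (real m * (\<epsilon> n)\<^sup>2)\<rfloor>" by (simp add: h_def)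
    then show "real (h n) \<le> 1 / (real m * (\<epsilon> n)\<^sup>2)" "1 / (real m * (\<epsilon> n)\<^sup>2) < real (h n) + 1" by linarith+
  qed
  have \<epsilon>2: "0 < (\<epsilon> n)\<^sup>2" for n using \<epsilon>(1)[of n] by simp
  have h\<epsilon>: "real (h n) * (\<epsilon> n)\<^sup>2 \<le> 1 / real m" "1 / real m - (\<epsilon> n)\<^sup>2 \<le> real (h n) * (\<epsilon> n)\<^sup>2" for n
  proof -
    have e: "1 / (real m * (\<epsilon> n)\<^sup>2) * (\<epsilon> n)\<^sup>2 = 1 / real m" using \<epsilon>2[of n] by simp
    show "real (h n) * (\<epsilon> n)\<^sup>2 \<le> 1 / real m"
      using mult_right_mono[OF h(1)[of n] less_imp_le[OF \<epsilon>2[of n]]] unfolding e .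
    have "1 / real m \<le> (real (h n) + 1) * (\<epsilon> n)\<^sup>2"
      using mult_right_mono[OF less_imp_le[OF h(2)[of n]] less_imp_le[OF \<epsilon>2[of n]]] unfolding e .
    then show "1 / real m - (\<epsilon> n)\<^sup>2 \<le> real (h n) * (\<epsilon> n)\<^sup>2" by (simp add: distrib_right)
  qed
  have h_top: "filterlim h at_top sequentially"
  proof -
    have "(\<lambda>n. real m * (\<epsilon> n)\<^sup>2) \<longlonglongrightarrow> real m * 0\<^sup>2" by (intro tendsto_intros \<epsilon>)
    then have "filterlim (\<lambda>n. inverse (real m * (\<epsilon> n)\<^sup>2)) at_top sequentially"
      using m \<epsilon>2 by (intro filterlim_inverse_at_top) auto
    then have x: "filterlim (\<lambda>n. 1 / (real m * (\<epsilon> n)\<^sup>2)) at_top sequentially"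
      by (simp only: inverse_eq_divide)
    show ?thesis unfolding h_def
      by (rule filterlim_compose[OF filterlim_nat_sequentially filterlim_compose[OF filterlim_floor_sequentially x]])
  qed
  have c: "(\<lambda>n. \<epsilon> n * sqrt (real (h n))) \<longlonglongrightarrow> sqrt (1 / real m)"
  proof -
    have l: "(\<lambda>n. 1 / real m - (\<epsilon> n)\<^sup>2) \<longlonglongrightarrow> 1 / real m - 0\<^sup>2" by (intro tendsto_intros \<epsilon>)
    have "(\<lambda>n. real (h n) * (\<epsilon> n)\<^sup>2) \<longlonglongrightarrow> 1 / real m"
      by (rule tendsto_sandwich[of "\<lambda>n. 1 / real m - (\<epsilon> n)\<^sup>2" _ _ "\<lambda>_. 1 / real m"]) (use l h\<epsilon> in auto)
    then have "(\<lambda>n. sqrt (real (h n) * (\<epsilon> n)\<^sup>2)) \<longlonglongrightarrow> sqrt (1 / real m)" by (rule tendsto_real_sqrt)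
    moreover have "sqrt (real (h n) * (\<epsilon> n)\<^sup>2) = \<epsilon> n * sqrt (real (h n))" for n
      using \<epsilon>(1)[of n] by (simp add: real_sqrt_mult mult.commute)
    ultimately show ?thesis by simp
  qed
  define \<Phi> where "\<Phi> u = lip_env f k (step_path m (partial_sums J u))" for u
  define U where "U n \<xi> = (\<lambda>j\<in>{..<J}. \<epsilon> n * real_of_int (walk \<xi> (j * h n + h n) - walk \<xi> (j * h n)))" for n and \<xi> :: "nat \<Rightarrow> int"
  have \<Phi>m: "\<Phi> \<in> borel_measurable (Pi\<^sub>M {..<J} (\<lambda>_. borel))"
    unfolding \<Phi>_def by (rule env_partial_sums_measurable)
  have "(\<lambda>n. \<integral>\<xi>. \<Phi> (U n \<xi>) \<partial>step_space) \<longlonglongrightarrow> (\<integral>u. \<Phi> u \<partial>Pi\<^sub>M {..<J} (\<lambda>_. density lborel (normal_density 0 (sqrt (1 / real m)))))"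
    unfolding U_def
    by (rule block_increments_converge[OF h_top c _ J \<Phi>m])
      (use m env_abs_le in \<open>auto simp: \<Phi>_def intro: env_partial_sums_tendsto\<close>)
  also have "(\<integral>u. \<Phi> u \<partial>Pi\<^sub>M {..<J} (\<lambda>_. density lborel (normal_density 0 (sqrt (1 / real m)))))
      = (\<integral>w. \<Phi> (\<lambda>j\<in>{..<J}. B (real (Suc j) / real m) w - B (real j / real m) w) \<partial>N)"
    by (rule brownian_block_integral[OF BM m J \<Phi>m, symmetric])
  also have "\<dots> = (\<integral>w. ?S m w \<partial>N)"
  proof (rule Bochner_Integration.integral_cong[OF refl])
    fix w assume "w \<in> space N"
    then show "\<Phi> (\<lambda>j\<in>{..<J}. B (real (Suc j) / real m) w - B (real j / real m) w) = ?S m w"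
      unfolding \<Phi>_def
      by (intro lip_env_step_cong) (simp add: J_def partial_sums_telescope[of _ _ "\<lambda>j. B (real j / real m) w"] B0 del: of_nat_Suc)
  qed
  finally have ev3: "\<forall>\<^sub>F n in sequentially. L - r / 6 - r / 6 - r / 6 < (\<integral>\<xi>. \<Phi> (U n \<xi>) \<partial>step_space)"
    using m'(1) r by (intro order_tendstoD(1)) (auto simp: m_def)
  define cb where "cb n j = {q\<in>space Q. M / 2 * real (h n) < \<bar>clock (walk (fst q)) (snd q) (j * h n) - M * real (j * h n)\<bar>}" for n j
  define bb where "bb n b = {q\<in>space Q. \<exists>j\<le>h n. \<eta> / (2 * \<epsilon> n) \<le> \<bar>real_of_int (walk (fst q) (b * h n + j) - walk (fst q) (b * h n))\<bar>}" for n b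
  note clock_measurable[measurable]
  have cbs: "cb n j \<in> sets Q" for n j unfolding cb_def by measurable
  have bbs: "bb n b \<in> sets Q" for n b
    unfolding bb_def by (rule block_oscillation_le(1)[OF \<epsilon>(1) \<eta>(1) m h\<epsilon>(1)])
  have bbm: "measure Q (bb n b) \<le> 48 / ((real m)\<^sup>2 * \<eta> ^ 4)" for n b
    unfolding bb_def by (rule block_oscillation_le(2)[OF \<epsilon>(1) \<eta>(1) m h\<epsilon>(1)])
  have "(\<lambda>n. real k * (\<Sum>j\<le>J+2. measure Q (cb n j))) \<longlonglongrightarrow> real k * (\<Sum>j\<le>J+2. 0)"
    unfolding cb_def by (intro tendsto_intros clock_block_tendsto[OF hom M h_top])
  then have ev4: "\<forall>\<^sub>F n in sequentially. real k * (\<Sum>j\<le>J+2. measure Q (cb n j)) < r / 6"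
    using r by (intro order_tendstoD(2)) auto
  have ev5: "\<forall>\<^sub>F n in sequentially. 2 * (k * m + 1) \<le> h n"
    using h_top unfolding filterlim_at_top by blast
  show ?thesis
    using ev3 ev4 ev5
  proof eventually_elim
    case (elim n)
    define bad where "bad = (\<Union>j\<in>{..J+2}. cb n j) \<union> (\<Union>b\<in>{..<J+2}. bb n b)"
    have bad: "bad \<in> sets Q" unfolding bad_def using cbs bbs by auto
    have "measure Q bad \<le> measure Q (\<Union>j\<in>{..J+2}. cb n j) + measure Q (\<Union>b\<in>{..<J+2}. bb n b)"
      unfolding bad_def by (rule measure_Un_le) (use cbs bbs in auto)
    also have "\<dots> \<le> (\<Sum>j\<le>J+2. measure Q (cb n j)) + (\<Sum>b<J+2. measure Q (bb n b))"
      by (intro add_mono Q.P.finite_measure_subadditive_finite) (use cbs bbs in auto)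
    also have "(\<Sum>b<J+2. measure Q (bb n b)) \<le> real (card {..<J+2}) * (48 / ((real m)\<^sup>2 * \<eta> ^ 4))"
      by (rule sum_bounded_above) (rule bbm)
    finally have "real k * measure Q bad \<le> real k * ((\<Sum>j\<le>J+2. measure Q (cb n j)) + real (J + 2) * (48 / ((real m)\<^sup>2 * \<eta> ^ 4)))"
      by (intro mult_left_mono) simp_all
    then have badm: "real k * measure Q bad \<le> r / 6 + r / 6"
      using elim(2) blocks by (simp only: distrib_left)
    let ?X = "rescaled M (\<epsilon> n)"
    have Xm: "(\<lambda>q. f (?X q)) \<in> borel_measurable Q"
      by (rule measurable_compose[OF rescaled_measurable[OF M \<epsilon>(1)] fm])
    have \<Phi>U: "(\<lambda>\<xi>. \<Phi> (U n \<xi>)) \<in> borel_measurable step_space"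
      unfolding U_def of_int_diff
      by (intro measurable_compose[OF measurable_restrict \<Phi>m] borel_measurable_times borel_measurable_const
          borel_measurable_diff measurable_compose[OF walk_measurable]) auto
    have \<Phi>Q: "(\<lambda>q. \<Phi> (U n (fst q))) \<in> borel_measurable Q"
      by (rule measurable_compose[OF measurable_fst \<Phi>U])
    have X_int: "integrable Q (\<lambda>q. f (?X q))"
      by (rule Q.P.integrable_const_bound[OF _ Xm, of C]) (auto intro!: AE_I2 C rescaled_cadlag[OF M \<epsilon>(1)])
    have \<Phi>_int: "integrable Q (\<lambda>q. \<Phi> (U n (fst q)))"
      by (rule Q.P.integrable_const_bound[OF _ \<Phi>Q, of "C + real k"]) (use env_abs_le in \<open>auto simp: \<Phi>_def\<close>)
    \<comment> \<open>Off \<open>bad\<close> the block skeleton is within \<open>\<eta>\<close> of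
      the path; on \<open>bad\<close> the truncation in \<open>sup_dist\<close> limits the loss to
      \<open>k\<close>.\<close>
    have pointwise: "AE q in Q. \<Phi> (U n (fst q)) - real k * (\<eta> + indicator bad q) \<le> f (?X q)"
      using clock_jump_times_AE[OF hom M] AE_space
    proof eventually_elim
      case q: (elim q)
      let ?v = "\<lambda>i. \<epsilon> n * real_of_int (walk (fst q) (i * h n))"
      have "\<Phi> (U n (fst q)) = lip_env f k (step_path m ?v)"
      proof -
        have e: "U n (fst q) = (\<lambda>j\<in>{..<J}. ?v (Suc j) - ?v j)"
          unfolding U_def by (simp add: right_diff_distrib add.commute)
        show ?thesis unfolding \<Phi>_def e
        proof (rule lip_env_step_cong)
          fix i assume "i \<le> k * m"
          then have "partial_sums J (\<lambda>j\<in>{..<J}. ?v (Suc j) - ?v j) i = ?v i - ?v 0"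
            unfolding J_def by (rule partial_sums_telescope)
          also have "\<dots> = ?v i" by simp
          finally show "partial_sums J (\<lambda>j\<in>{..<J}. ?v (Suc j) - ?v j) i = ?v i" .
        qed
      qed
      also have "\<dots> \<le> lip_env f k (?X q) + real k * sup_dist k (step_path m ?v) (?X q)"
        by (rule env_lipschitz)
      also have "lip_env f k (?X q) \<le> f (?X q)" by (rule env_le[OF rescaled_cadlag[OF M \<epsilon>(1) q(2)]])
      also have "sup_dist k (step_path m ?v) (?X q) \<le> \<eta> + indicator bad q"
      proof (cases "q \<in> bad")
        case True
        then show ?thesis using sup_dist_le_1[of k "step_path m ?v" "?X q"] \<eta> by simp
      next
        case False
        have "sup_dist k (step_path m ?v) (?X q) \<le> \<eta>"
        proof (rule sup_dist_le)
          fix t assume t: "0 \<le> t" "t \<le> real k"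
          have "\<bar>?X q t - ?v (nat \<lfloor>t * real m\<rfloor>)\<bar> < \<eta>"
            unfolding rescaled_def
          proof (rule rescaled_close_to_blocks[OF M \<epsilon>(1) m h elim(3) q(1) _ _ t])
            show "\<bar>clock (walk (fst q)) (snd q) (j * h n) - M * real (j * h n)\<bar> \<le> M / 2 * real (h n)"
              if "j \<le> k * m + 2" for j
              using False that q(2) unfolding bad_def cb_def J_def by (auto simp: not_less)
            show "\<bar>real_of_int (walk (fst q) (b * h n + j) - walk (fst q) (b * h n))\<bar> < \<eta> / (2 * \<epsilon> n)"
              if "b \<le> k * m + 1" "j \<le> h n" for b j
            proof -
              have "q \<notin> bb n b" using False that(1) unfolding bad_def J_def by auto
              then show ?thesis using q(2) that(2) unfolding bb_def not_le[symmetric] by blast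
            qed
          qed
          then show "min 1 \<bar>step_path m ?v t - ?X q t\<bar> \<le> \<eta>"
            unfolding step_path_def by linarith
        qed
        then show ?thesis using False by simp
      qed
      finally show ?case by (simp add: mult_left_mono)
    qed
    have "(\<integral>q. \<Phi> (U n (fst q)) - real k * (\<eta> + indicator bad q) \<partial>Q) \<le> (\<integral>q. f (?X q) \<partial>Q)"
      by (rule integral_mono_AE[OF _ X_int pointwise])
        (use \<Phi>_int bad in \<open>auto intro!: Bochner_Integration.integrable_diff integrable_mult_right Bochner_Integration.integrable_add
            integrable_real_indicator Q.P.emeasure_finite simp: less_top[symmetric]\<close>)
    moreover have "(\<integral>q. \<Phi> (U n (fst q)) - real k * (\<eta> + indicator bad q) \<partial>Q)
        = (\<integral>q. \<Phi> (U n (fst q)) \<partial>Q) - (real k * \<eta> + real k * measure Q bad)"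
    proof -
      have ib: "integrable Q (indicat_real bad)"
        by (rule integrable_real_indicator[OF bad]) (simp add: less_top[symmetric])
      have "(\<integral>q. \<Phi> (U n (fst q)) - real k * (\<eta> + indicator bad q) \<partial>Q)
          = (\<integral>q. \<Phi> (U n (fst q)) \<partial>Q) - (\<integral>q. real k * (\<eta> + indicator bad q) \<partial>Q)"
        by (rule Bochner_Integration.integral_diff[OF \<Phi>_int]) (use ib in auto)
      also have "(\<integral>q. real k * (\<eta> + indicator bad q) \<partial>Q) = real k * (\<eta> + measure Q bad)"
        using ib bad Q.P.prob_space by (simp add: Int_absorb2 sets.sets_into_space)
      finally show ?thesis by (simp add: distrib_left)
    qed
    moreover have "(\<integral>q. \<Phi> (U n (fst q)) \<partial>Q) = (\<integral>\<xi>. \<Phi> (U n \<xi>) \<partial>step_space)"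
    proof -
      have "(\<integral>\<xi>. \<Phi> (U n \<xi>) \<partial>distr Q step_space fst) = (\<integral>q. \<Phi> (U n (fst q)) \<partial>Q)"
        by (rule integral_distr[OF measurable_fst \<Phi>U])
      then show ?thesis unfolding fst_distr by (rule sym)
    qed
    ultimately show ?case
      using elim(1) badm \<eta>(2) unfolding L_def[symmetric] by linarith
  qed
qed

theorem theorem2p10:
  fixes \<Omega> :: "'w measure" and P :: "real measure measure"
    and \<pi> :: "int \<Rightarrow> 'w \<Rightarrow> real measure" and M :: real
    and N :: "'b measure" and B :: "real \<Rightarrow> 'b \<Rightarrow> real"
  assumes "prob_space \<Omega>"
    and "P \<in> prob_measures trap_laws"
    and "prob_space.indep_vars \<Omega> (\<lambda>_. borel_of trap_laws) \<pi> UNIV"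
    and "\<And>z. distr \<Omega> (borel_of trap_laws) (\<pi> z) = P"
    and "(\<integral>\<^sup>+\<nu>. trap_mean \<nu> \<partial>P) = ennreal M" and "0 < M"
    and "standard_brownian_motion N B"
  shows "AE \<omega> in \<Omega>. limitin (weak_topology skorokhod_J1)
           (\<lambda>\<epsilon>. quenched_rescaled_law (\<lambda>z. \<pi> z \<omega>) M \<epsilon>)
           (distr N (borel_of skorokhod_J1) (\<lambda>w. \<lambda>t\<in>{0..}. B t w))
           (at_right 0)"
proof -
  interpret \<Omega>: prob_space \<Omega> by fact
  interpret N: prob_space N using assms(7) by (simp add: standard_brownian_motion_def)
  have Bm: "(\<lambda>w. \<lambda>t\<in>{0..}. B t w) \<in> measurable N (borel_of skorokhod_J1)"
    using assms(7) by (intro continuous_process_measurable) (simp_all add: standard_brownian_motion_def)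
  \<comment> \<open>The exceptional null set is fixed here, before any test function or sequence of
    scales.\<close>
  from \<Omega>.landscape_homogenizes[OF assms(3-6)] show ?thesis
  proof eventually_elim
    case (elim \<omega>)
    define p where "p z = \<pi> z \<omega>" for z
    interpret quenched p by standard (use elim in \<open>simp add: p_def\<close>)
    have hom: "homogenizes M p" using elim by (simp add: p_def[abs_def])
    have law: "quenched_rescaled_law p M \<epsilon> = distr Q (borel_of skorokhod_J1) (rescaled M \<epsilon>)" for \<epsilon>
      unfolding quenched_rescaled_law_def quenched_space_eq rescaled_def[abs_def] by (simp add: case_prod_beta')
    have "limitin (weak_topology skorokhod_J1) (\<lambda>\<epsilon>. quenched_rescaled_law p M \<epsilon>)
        (distr N (borel_of skorokhod_J1) (\<lambda>w. \<lambda>t\<in>{0..}. B t w)) (at_right 0)"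
    proof (rule limitin_weak_topology)
      show "distr N (borel_of skorokhod_J1) (\<lambda>w. \<lambda>t\<in>{0..}. B t w) \<in> prob_measures skorokhod_J1"
        by (rule distr_prob_measures[OF N.prob_space_axioms Bm])
      show "\<forall>\<^sub>F \<epsilon> in at_right 0. quenched_rescaled_law p M \<epsilon> \<in> prob_measures skorokhod_J1"
        using eventually_at_right_less[of 0]
      proof eventually_elim
        case (elim \<epsilon>)
        show ?case unfolding law
          by (rule distr_prob_measures[OF Q.P.prob_space_axioms rescaled_measurable[OF assms(6) elim]])
      qed
      fix f :: "(real \<Rightarrow> real) \<Rightarrow> real"
      assume f: "continuous_map skorokhod_J1 euclideanreal f" and "bounded (f ` topspace skorokhod_J1)"
      then obtain C where C: "\<And>x. x \<in> cadlag_paths \<Longrightarrow> \<bar>f x\<bar> \<le> C"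
        unfolding bounded_iff by auto
      have fm: "f \<in> borel_measurable (borel_of skorokhod_J1)" by (rule continuous_map_borel_of_measurable[OF f])
      have Bf: "(\<integral>x. f x \<partial>distr N (borel_of skorokhod_J1) (\<lambda>w. \<lambda>t\<in>{0..}. B t w)) = (\<integral>w. f (\<lambda>t\<in>{0..}. B t w) \<partial>N)"
        by (rule integral_distr[OF Bm fm])
      have Xf: "(\<integral>x. f x \<partial>quenched_rescaled_law p M \<epsilon>) = (\<integral>q. f (rescaled M \<epsilon> q) \<partial>Q)" if "0 < \<epsilon>" for \<epsilon>
        unfolding law by (rule integral_distr[OF rescaled_measurable[OF assms(6) that] fm])
      show "((\<lambda>\<epsilon>. \<integral>x. f x \<partial>quenched_rescaled_law p M \<epsilon>) \<longlongrightarrow>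
          (\<integral>x. f x \<partial>distr N (borel_of skorokhod_J1) (\<lambda>w. \<lambda>t\<in>{0..}. B t w))) (at_right 0)"
        unfolding Bf tendsto_at_iff_sequentially
      proof (intro allI impI)
        fix \<epsilon> :: "nat \<Rightarrow> real" assume "\<forall>i. \<epsilon> i \<in> {0<..} - {0}" and e0: "\<epsilon> \<longlonglongrightarrow> 0"
        then have e: "0 < \<epsilon> n" for n by auto
        have f': "continuous_map skorokhod_J1 euclideanreal (\<lambda>x. - f x)"
          using f by (intro continuous_intros)
        have C': "\<bar>- f x\<bar> \<le> C" if "x \<in> cadlag_paths" for x using C[OF that] by simp
        have "(\<lambda>n. \<integral>q. f (rescaled M (\<epsilon> n) q) \<partial>Q) \<longlonglongrightarrow> (\<integral>w. f (\<lambda>t\<in>{0..}. B t w) \<partial>N)"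
        proof (rule tendstoI)
          fix r :: real assume "0 < r"
          then have r: "0 < r / 2" by simp
          have "\<forall>\<^sub>F n in sequentially. (\<integral>w. f (\<lambda>t\<in>{0..}. B t w) \<partial>N) - r / 2 \<le> (\<integral>q. f (rescaled M (\<epsilon> n) q) \<partial>Q)"
            by (rule rescaled_liminf[OF hom assms(6,7) f _ e e0 r]) (rule C)
          \<comment> \<open>The upper bound is the lower bound for \<open>- f\<close>, which is just
            as bounded and continuous.\<close>
          moreover have "\<forall>\<^sub>F n in sequentially. (\<integral>w. - f (\<lambda>t\<in>{0..}. B t w) \<partial>N) - r / 2 \<le> (\<integral>q. - f (rescaled M (\<epsilon> n) q) \<partial>Q)"
            by (rule rescaled_liminf[OF hom assms(6,7) f' _ e e0 r]) (rule C')
          ultimately show "\<forall>\<^sub>F n in sequentially. dist (\<integral>q. f (rescaled M (\<epsilon> n) q) \<partial>Q) (\<integral>w. f (\<lambda>t\<in>{0..}. B t w) \<partial>N) < r"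
            by eventually_elim (use \<open>0 < r\<close> in \<open>simp add: dist_real_def abs_less_iff\<close>)
        qed
        then show "((\<lambda>\<epsilon>. \<integral>x. f x \<partial>quenched_rescaled_law p M \<epsilon>) \<circ> \<epsilon>) \<longlonglongrightarrow> (\<integral>w. f (\<lambda>t\<in>{0..}. B t w) \<partial>N)"
          by (simp add: comp_def Xf[OF e])
      qed
    qed
    then show ?case by (simp add: p_def[abs_def])
  qed
qed

end
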